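(* Let $\mathbf H=\mathbf H_{t,c}$ be a rational Cherednik algebra with $t\in\mathbb R$ and $c(s)\in\mathbb R$ for all $s\in\mathcal R$. Let $M$ be a $\ast$-unitary $\mathbf H$-module. Then, for the operators $D_x,D_y,D=D_x+D_y$ on $M\otimes S$: (a) $H_D(M)=\ker D=\ker D^2$; (b) $M\otimes S=\ker D\oplus\mathrm{im}\,D_x\oplus\mathrm{im}\,D_y$; (c) $\ker D_x=\ker D\oplus\mathrm{im}\,D_x$ and $\ker D_y=\ker D\oplus\mathrm{im}\,D_y$. Consequently, as $\widetilde W$-modules, $H_D(M)=\ker D\cong\ker D_x/\mathrm{im}\,D_x\cong H^\bullet(\mathfrak h^*,M)\otimes\chi$, and likewise $H_D(M)=\ker D\cong\ker D_y/\mathrm{im}\,D_y\cong H_\bullet(\mathfrak h,M)\otimes\chi$.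
   Context: **Rational Cherednik algebra.** $\mathfrak h$ is a finite-dimensional complex vector space, $n=\dim\mathfrak h$, $W\subset GL(\mathfrak h)$ a finite complex reflection group, $\mathcal R\subset W$ its set of (pseudo-)reflections, $\langle\ ,\ \rangle$ the natural pairing between $\mathfrak h$ and $\mathfrak h^*$. For $s\in\mathcal R$, $\alpha_s\in\mathfrak h^*$ is a nonzero vector vanishing on the hyperplane of $\mathfrak h$ fixed by $s$, $\alpha_s^\vee\in\mathfrak h$ a nonzero vector vanishing on the hyperplane of $\mathfrak h^*$ fixed by $s$, and $\lambda_s=\det_{\mathfrak h}(s)$. $c:\mathcal R\to\mathbb C$ is conjugation-invariant. $\mathbf H_{t,c}$ is the quotient of $T(\mathfrak h\oplus\mathfrak h^* )\rtimes\mathbb C[W]$ by the relations $[x,x']=0$, $[y,y']=0$, $[y,x]=t\langle y,x\rangle-\sum_{s\in\mathcal R}c(s)\frac{\langle y,\alpha_s\rangle\langle\alpha_s^\vee,x\rangle}{\langle\alpha_s^\vee,\alpha_s\rangle}s$ for $x,x'\in\mathfrak h^*$, $y,y'\in\mathfrak h$. **$\ast$-unitary modules.** Fix a $W$-invariant positive definite Hermitian form on $\mathfrak h$, an orthonormal basis $y_1,\dots,y_n$ of $\mathfrak h$ and the dual basis $x_1,\dots,x_n$ of $\mathfrak h^*$. The conjugate-linear anti-involution $\ast$ is given on generators by $x_i^*=y_i$, $y_i^*=x_i$, $w^*=w^{-1}$. An $\mathbf H$-module $M$ is $\ast$-unitary if it carries a positive definite Hermitian form with $(zm_1,m_2)=(m_1,z^*m_2)$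 for all $m_1,m_2\in M$ and all generators $z\in\{x_i,y_i\}\cup W$ (hence all $z\in\mathbf H$). **Clifford algebra, spinors, $\widetilde W$, $\chi$.** $V=\mathfrak h\oplus\mathfrak h^*$. $C(V)$ is the tensor algebra of $V$ modulo $x_ix_j+x_jx_i=0=y_iy_j+y_jy_i$, $x_iy_j+y_jx_i=-2\delta_{ij}$. The spinor module is $S=\wedge^\bullet\mathfrak h$, where $y\in\mathfrak h$ acts by $y\wedge\cdot$ and $x\in\mathfrak h^*$ by $x(y_{i_1}\wedge\dots\wedge y_{i_p})=2\sum_j(-1)^j\langle x,y_{i_j}\rangle y_{i_1}\wedge\dots\widehat{y_{i_j}}\dots\wedge y_{i_p}$. $\widetilde W\subset C(V)^\times$ is the group generated by the elements $\pm\mu_s$, $s\in\mathcal R$, where $\mu_s=\frac{\sqrt{\lambda_s}-1/\sqrt{\lambda_s}}{2\langle\alpha_s^\vee,\alpha_s\rangle}\alpha_s\alpha_s^\vee+\sqrt{\lambda_s}$; it is a double cover $p:\widetilde W\to W$ with kernel $\{\pm1\}$ and $p(\pm\mu_s)=s$. $\chi:\widetilde W\to\mathbb C^\times$ is the character by which $\widetilde W$ acts on $\wedge^0\mathfrak h\subset S$; it is genuine ($\chi(-1)=-1$) and $\chi^2=\det_{\mathfrak h^*}\circ p$. $\widetilde W$ acts on $M\otimes S$ by $\widetilde w\mapsto p(\widetilde w)\otimes\widetilde w$. **(Co)homology.** $H^\bullet(\mathfrak h^*,M)$ is the total cohomology of $M\otimes\wedge^\bullet\mathfrak h$ with $d(m\otimes\omega)=\sum_jx_jm\otimes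 y_j\wedge\omega$. $H_\bullet(\mathfrak h,M)$ is the total homology of $M\otimes\wedge^\bullet\mathfrak h$ with $\partial(m\otimes y_{i_1}\wedge\dots\wedge y_{i_p})=\sum_k(-1)^ky_{i_k}m\otimes y_{i_1}\wedge\dots\widehat{y_{i_k}}\dots\wedge y_{i_p}$. Both are $W$-modules via the diagonal action, regarded as $\widetilde W$-modules through $p$. **Dirac operators.** $D_x=\sum_ix_i\otimes y_i$, $D_y=\sum_iy_i\otimes x_i$, $D=D_x+D_y$ in $\mathbf H\otimes C(V)$, acting on $M\otimes S$ and commuting with $\widetilde W$; $D_x^2=D_y^2=0$. $H_D(M)=\ker D/(\ker D\cap\mathrm{im}\,D)$. The equality $H_D(M)=\ker D$ means $\ker D\cap\mathrm{im}\,D=0$.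
   Formalization: Parts (b), (c) and the isomorphisms of ker D with ker D_x/im D_x and ker D_y/im D_y are proved when Σ x_i y_i acts locally finitely on M (as in category O); without this they fail, e.g. for polynomials in z, z̄ on the unit disc with t = c = 0. *)

theory Defs
  imports
    "HOL-Library.Poly_Mapping"
    "HOL-Algebra.QuotRing"
    "HOL-Algebra.Generated_Groups"
    "Jordan_Normal_Form.Determinant"
    Complex_Main
begin

hide_const (open) Polynomial.smult

section \<open>Algebras given by generators and relations\<close>

text \<open>Lists form the free monoid, so finitely supported functions on lists, with the
  convolution product of \<^theory>\<open>HOL-Library.Poly_Mapping\<close>, form the free associative algebra.\<close>

instantiation list :: (type) monoid_add
begin
definition zero_list :: "'a list" where "zero_list = []"
definition plus_list :: "'a list \<Rightarrow> 'a list \<Rightarrow> 'a list" where "plus_list = (@)"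
instance by standard (simp_all add: zero_list_def plus_list_def)
end

definition free_algebra :: "'g set \<Rightarrow> ('g list \<Rightarrow>\<^sub>0 complex) ring" where
  "free_algebra X = \<lparr>carrier = {f. \<forall>w\<in>Poly_Mapping.keys f. set w \<subseteq> X},
     monoid.mult = (*), one = 1, zero = 0, add = (+)\<rparr>"

definition letter :: "'g \<Rightarrow> 'g list \<Rightarrow>\<^sub>0 complex" where
  "letter g = Poly_Mapping.single [g] 1"

definition scalar :: "complex \<Rightarrow> 'g list \<Rightarrow>\<^sub>0 complex" where
  "scalar a = Poly_Mapping.single [] a"

definition presented :: "'g set \<Rightarrow> ('g list \<Rightarrow>\<^sub>0 complex) set \<Rightarrow> ('g list \<Rightarrow>\<^sub>0 complex) set ring" where
  "presented X R = free_algebra X Quot (Idl\<^bsub>free_algebra X\<^esub> R)"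

definition pclass :: "'g set \<Rightarrow> ('g list \<Rightarrow>\<^sub>0 complex) set \<Rightarrow> ('g list \<Rightarrow>\<^sub>0 complex) \<Rightarrow> ('g list \<Rightarrow>\<^sub>0 complex) set" where
  "pclass X R f = Idl\<^bsub>free_algebra X\<^esub> R +>\<^bsub>free_algebra X\<^esub> f"

section \<open>Complex vector spaces and representations\<close>

text \<open>Hermitian forms are linear in the first and conjugate-linear in the second argument.\<close>

definition pos_def_hermitian ::
    "(complex \<Rightarrow> 'v \<Rightarrow> 'v) \<Rightarrow> ('v::ab_group_add \<Rightarrow> 'v \<Rightarrow> complex) \<Rightarrow> bool" where
  "pos_def_hermitian sc B \<longleftrightarrow>
     (\<forall>u v w. B (u + v) w = B u w + B v w) \<and>
     (\<forall>a u w. B (sc a u) w = a * B u w) \<and>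
     (\<forall>u w. B w u = cnj (B u w)) \<and>
     (\<forall>u. u \<noteq> 0 \<longrightarrow> Re (B u u) > 0)"

definition End_ring :: "(complex \<Rightarrow> 'm \<Rightarrow> 'm) \<Rightarrow> ('m::ab_group_add \<Rightarrow> 'm) ring" where
  "End_ring sc = \<lparr>carrier = {f. Vector_Spaces.linear sc sc f},
     monoid.mult = (\<circ>), one = id, zero = (\<lambda>_. 0), add = (\<lambda>f g m. f m + g m)\<rparr>"

definition complex_field :: "complex ring" where
  "complex_field = \<lparr>carrier = UNIV, monoid.mult = (*), one = 1, zero = 0, add = (+)\<rparr>"

record ('g, 'v) rep = "(complex, 'v) module" +
  ract :: "'g \<Rightarrow> 'v \<Rightarrow> 'v"

definition is_rep :: "('g, 'x) monoid_scheme \<Rightarrow> ('g, 'v) rep \<Rightarrow> bool" where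
  "is_rep G V \<longleftrightarrow> Module.module complex_field V \<and>
     (\<forall>g\<in>carrier G. \<forall>v\<in>carrier V. ract V g v \<in> carrier V) \<and>
     (\<forall>g\<in>carrier G. \<forall>u\<in>carrier V. \<forall>v\<in>carrier V.
        ract V g (u \<oplus>\<^bsub>V\<^esub> v) = ract V g u \<oplus>\<^bsub>V\<^esub> ract V g v) \<and>
     (\<forall>g\<in>carrier G. \<forall>a. \<forall>v\<in>carrier V. ract V g (a \<odot>\<^bsub>V\<^esub> v) = a \<odot>\<^bsub>V\<^esub> ract V g v) \<and>
     (\<forall>v\<in>carrier V. ract V \<one>\<^bsub>G\<^esub> v = v) \<and>
     (\<forall>g\<in>carrier G. \<forall>h\<in>carrier G. \<forall>v\<in>carrier V. ract V (g \<otimes>\<^bsub>G\<^esub> h) v = ract V g (ract V h v))"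

definition rep_iso :: "('g, 'x) monoid_scheme \<Rightarrow> ('g, 'v) rep \<Rightarrow> ('g, 'w) rep \<Rightarrow> bool" where
  "rep_iso G V V' \<longleftrightarrow> is_rep G V \<and> is_rep G V' \<and>
     (\<exists>f. bij_betw f (carrier V) (carrier V') \<and>
        (\<forall>u\<in>carrier V. \<forall>v\<in>carrier V. f (u \<oplus>\<^bsub>V\<^esub> v) = f u \<oplus>\<^bsub>V'\<^esub> f v) \<and>
        (\<forall>a. \<forall>v\<in>carrier V. f (a \<odot>\<^bsub>V\<^esub> v) = a \<odot>\<^bsub>V'\<^esub> f v) \<and>
        (\<forall>g\<in>carrier G. \<forall>v\<in>carrier V. f (ract V g v) = ract V' g (f v)))"

definition subrep :: "('g, 'v) rep \<Rightarrow> 'v set \<Rightarrow> ('g, 'v) rep" where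
  "subrep V U = V\<lparr>carrier := U\<rparr>"

definition quotrep :: "('g, 'v) rep \<Rightarrow> 'v set \<Rightarrow> ('g, 'v set) rep" where
  "quotrep V N = \<lparr>carrier = a_rcosets\<^bsub>V\<^esub> N, monoid.mult = undefined, one = undefined,
     zero = N, add = set_add V,
     smult = (\<lambda>a A. \<Union>v\<in>A. N +>\<^bsub>V\<^esub> (a \<odot>\<^bsub>V\<^esub> v)),
     ract = (\<lambda>g A. \<Union>v\<in>A. N +>\<^bsub>V\<^esub> ract V g v)\<rparr>"

text \<open>The tensor product of a representation with a one-dimensional character.\<close>

definition twist :: "('g \<Rightarrow> complex) \<Rightarrow> ('g, 'v) rep \<Rightarrow> ('g, 'v) rep" where
  "twist \<psi> V = V\<lparr>ract := (\<lambda>g v. \<psi> g \<odot>\<^bsub>V\<^esub> ract V g v)\<rparr>"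

text \<open>Internal direct sums: the addition map is a bijection.\<close>

definition direct_sum2 :: "('g, 'v) rep \<Rightarrow> 'v set \<Rightarrow> 'v set \<Rightarrow> 'v set \<Rightarrow> bool" where
  "direct_sum2 V U A B \<longleftrightarrow> bij_betw (\<lambda>(a, b). a \<oplus>\<^bsub>V\<^esub> b) (A \<times> B) U"

definition direct_sum3 :: "('g, 'v) rep \<Rightarrow> 'v set \<Rightarrow> 'v set \<Rightarrow> 'v set \<Rightarrow> 'v set \<Rightarrow> bool" where
  "direct_sum3 V U A B C \<longleftrightarrow> bij_betw (\<lambda>(a, b, c). a \<oplus>\<^bsub>V\<^esub> b \<oplus>\<^bsub>V\<^esub> c) (A \<times> B \<times> C) U"

section \<open>Reflection groups and Cherednik data\<close>

text \<open>The space \<open>\<hh>\<close> is the type \<open>'h\<close> with scalar multiplication \<open>scal\<close>; elements of the dual space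
  are the linear functions \<open>'h \<Rightarrow> complex\<close>, and the pairing of \<open>y\<close> and \<open>x\<close> is \<open>x y\<close>. Bases are
  indexed by \<open>{..<rk}\<close>.\<close>

record 'h rca =
  scal :: "complex \<Rightarrow> 'h \<Rightarrow> 'h"
  herm :: "'h \<Rightarrow> 'h \<Rightarrow> complex"
  rk :: nat
  ybas :: "nat \<Rightarrow> 'h"
  xbas :: "nat \<Rightarrow> 'h \<Rightarrow> complex"
  grp :: "('h \<Rightarrow> 'h) set"
  root :: "('h \<Rightarrow> 'h) \<Rightarrow> 'h \<Rightarrow> complex"
  coroot :: "('h \<Rightarrow> 'h) \<Rightarrow> 'h"
  par_t :: complex
  par_c :: "('h \<Rightarrow> 'h) \<Rightarrow> complex"

hide_const (open) NthRoot.root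

definition dual :: "'h::ab_group_add rca \<Rightarrow> ('h \<Rightarrow> complex) set" where
  "dual A = {\<xi>. Vector_Spaces.linear (scal A) (*) \<xi>}"

definition GL :: "'h::ab_group_add rca \<Rightarrow> ('h \<Rightarrow> 'h) monoid" where
  "GL A = \<lparr>carrier = {f. Vector_Spaces.linear (scal A) (scal A) f \<and> bij f},
     monoid.mult = (\<circ>), one = id\<rparr>"

definition Wgroup :: "'h::ab_group_add rca \<Rightarrow> ('h \<Rightarrow> 'h) monoid" where
  "Wgroup A = (GL A)\<lparr>carrier := grp A\<rparr>"

definition reflections :: "'h::ab_group_add rca \<Rightarrow> ('h \<Rightarrow> 'h) set" where
  "reflections A = {s \<in> grp A. vector_space.dim (scal A) {v. s v = v} + 1 = rk A}"

text \<open>The contragredient action of an invertible \<open>w\<close> on the dual space.\<close>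

definition dual_act :: "('h \<Rightarrow> 'h) \<Rightarrow> ('h \<Rightarrow> complex) \<Rightarrow> 'h \<Rightarrow> complex" where
  "dual_act w \<xi> = \<xi> \<circ> inv_into UNIV w"

locale rca_data =
  fixes A :: "'h::ab_group_add rca"
  assumes vs: "vector_space (scal A)"
    and basis_inj: "inj_on (ybas A) {..<rk A}"
    and basis_indep: "\<not> Modules.module.dependent (scal A) (ybas A ` {..<rk A})"
    and basis_span: "Modules.module.span (scal A) (ybas A ` {..<rk A}) = UNIV"
    and dual_basis: "i < rk A \<Longrightarrow> xbas A i \<in> dual A"
      "i < rk A \<Longrightarrow> j < rk A \<Longrightarrow> xbas A i (ybas A j) = (if i = j then 1 else 0)"
    and W_subgroup: "subgroup (grp A) (GL A)"
    and W_finite: "finite (grp A)"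
    and W_reflection_group: "generate (GL A) (reflections A) = grp A"
    and herm: "pos_def_hermitian (scal A) (herm A)"
    and herm_invariant: "w \<in> grp A \<Longrightarrow> herm A (w u) (w v) = herm A u v"
    and orthonormal: "i < rk A \<Longrightarrow> j < rk A \<Longrightarrow>
      herm A (ybas A i) (ybas A j) = (if i = j then 1 else 0)"
    and root: "s \<in> reflections A \<Longrightarrow> root A s \<in> dual A"
      "s \<in> reflections A \<Longrightarrow> root A s \<noteq> (\<lambda>_. 0)"
      "s \<in> reflections A \<Longrightarrow> s v = v \<Longrightarrow> root A s v = 0"
    and coroot: "s \<in> reflections A \<Longrightarrow> coroot A s \<noteq> 0"
      "s \<in> reflections A \<Longrightarrow> \<xi> \<in> dual A \<Longrightarrow> dual_act s \<xi> = \<xi> \<Longrightarrow> \<xi> (coroot A s) = 0"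
    and c_invariant: "s \<in> reflections A \<Longrightarrow> w \<in> grp A \<Longrightarrow>
      par_c A (w \<circ> s \<circ> inv_into UNIV w) = par_c A s"

definition det_h :: "'h rca \<Rightarrow> ('h \<Rightarrow> 'h) \<Rightarrow> complex" where
  "det_h A w = Determinant.det (mat (rk A) (rk A) (\<lambda>(i, j). xbas A i (w (ybas A j))))"

section \<open>The rational Cherednik algebra and its modules\<close>

datatype 'h gen = Vec 'h | Cov "'h \<Rightarrow> complex" | Grp "'h \<Rightarrow> 'h"

type_synonym 'h falg = "'h gen list \<Rightarrow>\<^sub>0 complex"

abbreviation lv :: "'h \<Rightarrow> 'h falg" where "lv y \<equiv> letter (Vec y)"
abbreviation lc :: "('h \<Rightarrow> complex) \<Rightarrow> 'h falg" where "lc \<xi> \<equiv> letter (Cov \<xi>)"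
abbreviation lg :: "('h \<Rightarrow> 'h) \<Rightarrow> 'h falg" where "lg w \<equiv> letter (Grp w)"

definition V_gens :: "'h::ab_group_add rca \<Rightarrow> 'h gen set" where
  "V_gens A = range Vec \<union> Cov ` dual A"

text \<open>Modulo these relations, the free algebra on \<open>V_gens A\<close> is the tensor algebra of
  \<open>V = \<hh> \<oplus> \<hh>\<^sup>*\<close>.\<close>

definition tensor_rels :: "'h::ab_group_add rca \<Rightarrow> 'h falg set" where
  "tensor_rels A =
     {lv (u + v) - lv u - lv v | u v. True} \<union>
     {lv (scal A a v) - scalar a * lv v | a v. True} \<union>
     {lc (\<lambda>v. \<xi> v + \<eta> v) - lc \<xi> - lc \<eta> | \<xi> \<eta>. \<xi> \<in> dual A \<and> \<eta> \<in> dual A} \<union>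
     {lc (\<lambda>v. a * \<xi> v) - scalar a * lc \<xi> | a \<xi>. \<xi> \<in> dual A}"

definition H_gens :: "'h::ab_group_add rca \<Rightarrow> 'h gen set" where
  "H_gens A = V_gens A \<union> Grp ` grp A"

text \<open>Together with \<open>tensor_rels A\<close>, these present the smash product of the tensor algebra of \<open>V\<close>
  with the group algebra of \<open>W\<close>.\<close>

definition smash_rels :: "'h::ab_group_add rca \<Rightarrow> 'h falg set" where
  "smash_rels A =
     {lg id - 1} \<union>
     {lg (v \<circ> w) - lg v * lg w | v w. v \<in> grp A \<and> w \<in> grp A} \<union>
     {lg w * lv y - lv (w y) * lg w | w y. w \<in> grp A} \<union>
     {lg w * lc \<xi> - lc (dual_act w \<xi>) * lg w | w \<xi>. w \<in> grp A \<and> \<xi> \<in> dual A}"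

definition cherednik_rels :: "'h::ab_group_add rca \<Rightarrow> 'h falg set" where
  "cherednik_rels A =
     {lc \<xi> * lc \<eta> - lc \<eta> * lc \<xi> | \<xi> \<eta>. \<xi> \<in> dual A \<and> \<eta> \<in> dual A} \<union>
     {lv u * lv v - lv v * lv u | u v. True} \<union>
     {lv y * lc \<xi> - lc \<xi> * lv y -
        (scalar (par_t A * \<xi> y) -
         (\<Sum>s\<in>reflections A.
            scalar (par_c A s * (root A s y * \<xi> (coroot A s) / root A s (coroot A s))) * lg s))
      | y \<xi>. \<xi> \<in> dual A}"

definition H_rels :: "'h::ab_group_add rca \<Rightarrow> 'h falg set" where
  "H_rels A = tensor_rels A \<union> smash_rels A \<union> cherednik_rels A"

definition H_alg :: "'h::ab_group_add rca \<Rightarrow> 'h falg set ring" where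
  "H_alg A = presented (H_gens A) (H_rels A)"

definition H_class :: "'h::ab_group_add rca \<Rightarrow> 'h falg \<Rightarrow> 'h falg set" where
  "H_class A = pclass (H_gens A) (H_rels A)"

record ('h, 'm) hmod =
  mscale :: "complex \<Rightarrow> 'm \<Rightarrow> 'm"
  mact :: "'h falg set \<Rightarrow> 'm \<Rightarrow> 'm"

definition H_module :: "'h::ab_group_add rca \<Rightarrow> ('h, 'm::ab_group_add) hmod \<Rightarrow> bool" where
  "H_module A M \<longleftrightarrow> vector_space (mscale M) \<and>
     mact M \<in> Ring.ring_hom (H_alg A) (End_ring (mscale M)) \<and>
     (\<forall>a. mact M (H_class A (scalar a)) = mscale M a)"

definition xact :: "'h::ab_group_add rca \<Rightarrow> ('h, 'm) hmod \<Rightarrow> nat \<Rightarrow> 'm \<Rightarrow> 'm" where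
  "xact A M i = mact M (H_class A (lc (xbas A i)))"

definition yact :: "'h::ab_group_add rca \<Rightarrow> ('h, 'm) hmod \<Rightarrow> nat \<Rightarrow> 'm \<Rightarrow> 'm" where
  "yact A M i = mact M (H_class A (lv (ybas A i)))"

definition wact :: "'h::ab_group_add rca \<Rightarrow> ('h, 'm) hmod \<Rightarrow> ('h \<Rightarrow> 'h) \<Rightarrow> 'm \<Rightarrow> 'm" where
  "wact A M w = mact M (H_class A (lg w))"

definition star_unitary :: "'h::ab_group_add rca \<Rightarrow> ('h, 'm::ab_group_add) hmod \<Rightarrow> bool" where
  "star_unitary A M \<longleftrightarrow> (\<exists>B. pos_def_hermitian (mscale M) B \<and>
     (\<forall>i<rk A. \<forall>m m'. B (xact A M i m) m' = B m (yact A M i m')) \<and>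
     (\<forall>i<rk A. \<forall>m m'. B (yact A M i m) m' = B m (xact A M i m')) \<and>
     (\<forall>w\<in>grp A. \<forall>m m'. B (wact A M w m) m' = B m (wact A M (inv_into UNIV w) m')))"

text \<open>Local finiteness of the action of \<open>\<Sum>\<^sub>i x\<^sub>i y\<^sub>i\<close>, which holds for every module in category O
  and every finite-dimensional module.\<close>

definition euler :: "'h::ab_group_add rca \<Rightarrow> ('h, 'm::ab_group_add) hmod \<Rightarrow> 'm \<Rightarrow> 'm" where
  "euler A M m = (\<Sum>i<rk A. xact A M i (yact A M i m))"

definition euler_locally_finite :: "'h::ab_group_add rca \<Rightarrow> ('h, 'm::ab_group_add) hmod \<Rightarrow> bool" where
  "euler_locally_finite A M \<longleftrightarrow> (\<forall>m. \<exists>F. finite F \<and>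
     m \<in> Modules.module.span (mscale M) F \<and>
     euler A M ` Modules.module.span (mscale M) F \<subseteq> Modules.module.span (mscale M) F)"

section \<open>The exterior algebra, the Clifford algebra and spinors\<close>

text \<open>An element of the exterior algebra of \<open>\<hh>\<close> is given by its coordinates in the basis of the
  \<open>blade I = y\<^sub>i\<^sub>1 \<and> \<dots> \<and> y\<^sub>i\<^sub>p\<close> for \<open>I = {i\<^sub>1 < \<dots> < i\<^sub>p} \<subseteq> {..<rk}\<close>.\<close>

type_synonym ext = "nat set \<Rightarrow> complex"

definition blade :: "nat set \<Rightarrow> ext" where
  "blade I = (\<lambda>J. if J = I then 1 else 0)"

definition lin_ext :: "'h rca \<Rightarrow> (nat set \<Rightarrow> ext) \<Rightarrow> ext \<Rightarrow> ext" where
  "lin_ext A F \<omega> = (\<lambda>J. \<Sum>I\<in>Pow {..<rk A}. \<omega> I * F I J)"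

definition position :: "nat set \<Rightarrow> nat \<Rightarrow> nat" where
  "position I i = card {j\<in>I. j < i}"

definition wedge :: "'h rca \<Rightarrow> 'h \<Rightarrow> ext \<Rightarrow> ext" where
  "wedge A v = lin_ext A (\<lambda>I J. \<Sum>i\<in>{..<rk A} - I.
     xbas A i v * (-1) ^ position I i * blade (insert i I) J)"

text \<open>The sign is \<open>(-1)\<^sup>k\<close> when \<open>i\<close> is the \<open>k\<close>-th smallest element of \<open>I\<close>, counting from 1.\<close>

definition contract :: "'h rca \<Rightarrow> ('h \<Rightarrow> complex) \<Rightarrow> ext \<Rightarrow> ext" where
  "contract A \<xi> = lin_ext A (\<lambda>I J. \<Sum>i\<in>I.
     (-1) ^ (position I i + 1) * \<xi> (ybas A i) * blade (I - {i}) J)"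

text \<open>The action of \<open>W\<close> by \<open>w (y\<^sub>i\<^sub>1 \<and> \<dots> \<and> y\<^sub>i\<^sub>p) = w y\<^sub>i\<^sub>1 \<and> \<dots> \<and> w y\<^sub>i\<^sub>p\<close>.\<close>

definition ext_act :: "'h rca \<Rightarrow> ('h \<Rightarrow> 'h) \<Rightarrow> ext \<Rightarrow> ext" where
  "ext_act A w = lin_ext A (\<lambda>I.
     foldr (\<lambda>i. wedge A (w (ybas A i))) (sorted_list_of_set I) (blade {}))"

definition cliff_rels :: "'h::ab_group_add rca \<Rightarrow> 'h falg set" where
  "cliff_rels A = tensor_rels A \<union>
     {lc (xbas A i) * lc (xbas A j) + lc (xbas A j) * lc (xbas A i) | i j. i < rk A \<and> j < rk A} \<union>
     {lv (ybas A i) * lv (ybas A j) + lv (ybas A j) * lv (ybas A i) | i j. i < rk A \<and> j < rk A} \<union>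
     {lc (xbas A i) * lv (ybas A j) + lv (ybas A j) * lc (xbas A i) -
        scalar (if i = j then -2 else 0) | i j. i < rk A \<and> j < rk A}"

definition cliff :: "'h::ab_group_add rca \<Rightarrow> 'h falg set ring" where
  "cliff A = presented (V_gens A) (cliff_rels A)"

definition cliff_class :: "'h::ab_group_add rca \<Rightarrow> 'h falg \<Rightarrow> 'h falg set" where
  "cliff_class A = pclass (V_gens A) (cliff_rels A)"

text \<open>Group letters do not occur in the Clifford algebra; their value here is irrelevant.\<close>

fun spin_gen :: "'h rca \<Rightarrow> 'h gen \<Rightarrow> ext \<Rightarrow> ext" where
  "spin_gen A (Vec v) = wedge A v"
| "spin_gen A (Cov \<xi>) = (\<lambda>\<omega> J. 2 * contract A \<xi> \<omega> J)"
| "spin_gen A (Grp w) = id"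

definition spin_free :: "'h rca \<Rightarrow> 'h falg \<Rightarrow> ext \<Rightarrow> ext" where
  "spin_free A f \<omega> = (\<lambda>J. \<Sum>w\<in>Poly_Mapping.keys f.
     Poly_Mapping.lookup f w * foldr (spin_gen A) w \<omega> J)"

text \<open>The spinor action of a class in the Clifford algebra, computed on a representative.\<close>

definition spin :: "'h rca \<Rightarrow> 'h falg set \<Rightarrow> ext \<Rightarrow> ext" where
  "spin A g = spin_free A (SOME f. f \<in> g)"

section \<open>The double cover of the reflection group\<close>

definition mu_rep :: "'h::ab_group_add rca \<Rightarrow> ('h \<Rightarrow> 'h) \<Rightarrow> 'h falg" where
  "mu_rep A s = (let l = csqrt (det_h A s) in
     scalar ((l - 1 / l) / (2 * root A s (coroot A s))) * lc (root A s) * lv (coroot A s) + scalar l)"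

definition mu :: "'h::ab_group_add rca \<Rightarrow> ('h \<Rightarrow> 'h) \<Rightarrow> 'h falg set" where
  "mu A s = cliff_class A (mu_rep A s)"

definition neg_mu :: "'h::ab_group_add rca \<Rightarrow> ('h \<Rightarrow> 'h) \<Rightarrow> 'h falg set" where
  "neg_mu A s = \<ominus>\<^bsub>cliff A\<^esub> mu A s"

definition Wtilde :: "'h::ab_group_add rca \<Rightarrow> 'h falg set monoid" where
  "Wtilde A = subgroup_generated (units_of (cliff A)) (mu A ` reflections A \<union> neg_mu A ` reflections A)"

definition cover :: "'h::ab_group_add rca \<Rightarrow> 'h falg set \<Rightarrow> 'h \<Rightarrow> 'h" where
  "cover A = (THE p. p \<in> hom (Wtilde A) (Wgroup A) \<and> p \<in> extensional (carrier (Wtilde A)) \<and>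
     (\<forall>s\<in>reflections A. p (mu A s) = s \<and> p (neg_mu A s) = s))"

text \<open>The scalar by which an element acts on the line spanned by \<open>blade {}\<close>.\<close>

definition chi :: "'h rca \<Rightarrow> 'h falg set \<Rightarrow> complex" where
  "chi A g = spin A g (blade {}) {}"

section \<open>Dirac operators and (co)homology\<close>

text \<open>As a vector space, \<open>M \<otimes> S = M \<otimes> \<And>\<hh>\<close>. The function \<open>\<psi>\<close> represents
  \<open>\<Sum>\<^sub>I \<psi> I \<otimes> blade I\<close>, and \<open>tensor_op A M S T\<close> is the operator \<open>S \<otimes> T\<close>.\<close>

type_synonym 'm spinors = "nat set \<Rightarrow> 'm"

definition MS :: "'h rca \<Rightarrow> ('m::ab_group_add) spinors set" where
  "MS A = {\<psi>. \<forall>I. \<not> I \<subseteq> {..<rk A} \<longrightarrow> \<psi> I = 0}"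

definition tensor_op :: "'h rca \<Rightarrow> ('h, 'm::ab_group_add) hmod \<Rightarrow>
    ('m \<Rightarrow> 'm) \<Rightarrow> (ext \<Rightarrow> ext) \<Rightarrow> 'm spinors \<Rightarrow> 'm spinors" where
  "tensor_op A M S T \<psi> = (\<lambda>J. \<Sum>I\<in>Pow {..<rk A}. mscale M (T (blade I) J) (S (\<psi> I)))"

definition MS_rep :: "'h rca \<Rightarrow> ('h, 'm::ab_group_add) hmod \<Rightarrow>
    ('g \<Rightarrow> 'm spinors \<Rightarrow> 'm spinors) \<Rightarrow> ('g, 'm spinors) rep" where
  "MS_rep A M a = \<lparr>carrier = MS A, monoid.mult = undefined, one = undefined,
     zero = (\<lambda>_. 0), add = (\<lambda>\<phi> \<psi> I. \<phi> I + \<psi> I),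
     smult = (\<lambda>z \<psi> I. mscale M z (\<psi> I)), ract = a\<rparr>"

definition spinor_rep :: "'h::ab_group_add rca \<Rightarrow> ('h, 'm::ab_group_add) hmod \<Rightarrow>
    ('h falg set, 'm spinors) rep" where
  "spinor_rep A M = MS_rep A M (\<lambda>g. tensor_op A M (wact A M (cover A g)) (spin A g))"

definition ext_rep :: "'h::ab_group_add rca \<Rightarrow> ('h, 'm::ab_group_add) hmod \<Rightarrow>
    ('h falg set, 'm spinors) rep" where
  "ext_rep A M = MS_rep A M (\<lambda>g. tensor_op A M (wact A M (cover A g)) (ext_act A (cover A g)))"

definition ker_on :: "'h rca \<Rightarrow> ('m::ab_group_add spinors \<Rightarrow> 'm spinors) \<Rightarrow> 'm spinors set" where
  "ker_on A T = {\<psi> \<in> MS A. T \<psi> = (\<lambda>_. 0)}"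

definition im_on :: "'h rca \<Rightarrow> ('m::ab_group_add spinors \<Rightarrow> 'm spinors) \<Rightarrow> 'm spinors set" where
  "im_on A T = T ` MS A"

definition Dx :: "'h::ab_group_add rca \<Rightarrow> ('h, 'm::ab_group_add) hmod \<Rightarrow> 'm spinors \<Rightarrow> 'm spinors" where
  "Dx A M \<psi> = (\<lambda>J. \<Sum>i<rk A.
     tensor_op A M (xact A M i) (spin A (cliff_class A (lv (ybas A i)))) \<psi> J)"

definition Dy :: "'h::ab_group_add rca \<Rightarrow> ('h, 'm::ab_group_add) hmod \<Rightarrow> 'm spinors \<Rightarrow> 'm spinors" where
  "Dy A M \<psi> = (\<lambda>J. \<Sum>i<rk A.
     tensor_op A M (yact A M i) (spin A (cliff_class A (lc (xbas A i)))) \<psi> J)"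

definition Dirac :: "'h::ab_group_add rca \<Rightarrow> ('h, 'm::ab_group_add) hmod \<Rightarrow> 'm spinors \<Rightarrow> 'm spinors" where
  "Dirac A M \<psi> = (\<lambda>J. Dx A M \<psi> J + Dy A M \<psi> J)"

definition dirac_cohomology :: "'h::ab_group_add rca \<Rightarrow> ('h, 'm::ab_group_add) hmod \<Rightarrow>
    ('h falg set, 'm spinors set) rep" where
  "dirac_cohomology A M = quotrep (subrep (spinor_rep A M) (ker_on A (Dirac A M)))
     (ker_on A (Dirac A M) \<inter> im_on A (Dirac A M))"

definition coh_d :: "'h::ab_group_add rca \<Rightarrow> ('h, 'm::ab_group_add) hmod \<Rightarrow> 'm spinors \<Rightarrow> 'm spinors" where
  "coh_d A M \<psi> = (\<lambda>J. \<Sum>i<rk A. tensor_op A M (xact A M i) (wedge A (ybas A i)) \<psi> J)"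

definition hom_d :: "'h::ab_group_add rca \<Rightarrow> ('h, 'm::ab_group_add) hmod \<Rightarrow> 'm spinors \<Rightarrow> 'm spinors" where
  "hom_d A M \<psi> = (\<lambda>J. \<Sum>i<rk A. tensor_op A M (yact A M i) (contract A (xbas A i)) \<psi> J)"

definition cohomology :: "'h::ab_group_add rca \<Rightarrow> ('h, 'm::ab_group_add) hmod \<Rightarrow>
    ('h falg set, 'm spinors set) rep" where
  "cohomology A M = quotrep (subrep (ext_rep A M) (ker_on A (coh_d A M))) (im_on A (coh_d A M))"

definition homology :: "'h::ab_group_add rca \<Rightarrow> ('h, 'm::ab_group_add) hmod \<Rightarrow>
    ('h falg set, 'm spinors set) rep" where
  "homology A M = quotrep (subrep (ext_rep A M) (ker_on A (hom_d A M))) (im_on A (hom_d A M))"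

end

theory Submission
  imports Defs "HOL-Library.Function_Algebras"
begin

text \<open>Writing \<open>D\<^sub>x\<close> for the Koszul differential and \<open>D\<^sub>y\<close> for twice the homology differential, a
  unitary structure on \<open>M\<close> and the form on \<open>\<And>\<hh>\<close> in which the blades of degree \<open>p\<close> are orthogonal of
  squared length \<open>2\<^sup>p\<close> make \<open>D\<^sub>x\<close> and \<open>- D\<^sub>y\<close> adjoint. Hence \<open>D\<close> is skew-adjoint, which gives (a), and
  \<open>ker D = ker D\<^sub>x \<inter> ker D\<^sub>y\<close> is orthogonal to the mutually orthogonal images of \<open>D\<^sub>x\<close> and \<open>D\<^sub>y\<close>.
  The square of \<open>D\<close> is \<open>- 2 \<Sum>\<^sub>i x\<^sub>i y\<^sub>i \<otimes> 1\<close> plus terms in \<open>\<complex>[W] \<otimes> C(V)\<close>, so it is locally finite when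
  the Euler operator is; a locally finite operator with \<open>ker T\<^sup>2 = ker T\<close> splits the space into its
  kernel and its image, and the Hodge decomposition follows.
  The comparison with (co)homology holds because \<open>\<mu>\<^sub>s\<close> acts on the spinors as \<open>\<lambda>\<^sub>s\<^sup>-\<^sup>1\<^sup>/\<^sup>2\<close> times the natural
  action of \<open>s\<close> on \<open>\<And>\<hh>\<close>, so an element \<open>g\<close> of the cover acts as \<open>\<chi>(g)\<close> times the action of its
  image in \<open>W\<close>; this also shows that the covering map is well defined.\<close>

section \<open>Presented algebras\<close>

text \<open>\<open>M\<close> may be infinite-dimensional and its form need not be complete, so
  orthogonality makes the sums direct but does not make them exhaust \<open>M \<otimes> S\<close>: a
  skew-adjoint operator need not split such a space algebraically. Exhaustion is obtained inside a
  finite-dimensional subspace attached to each spinor. That subspace has to absorb the group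
  elements in the square of the Dirac operator; it does so by adding the finitely many
  \<open>W\<close>-translates of an Euler-stable span, and these stay Euler-stable because the sum
  of the \<open>x_i y_i\<close> is \<open>W\<close>-invariant. It need not be stable under the two
  differentials themselves, which contain single \<open>x_i\<close> and \<open>y_i\<close>, so the
  argument runs through the square. A second obstacle is that \<open>spin\<close> picks a
  representative and \<open>cover\<close> is a definite description. The choice is harmless because
  the Clifford ideal annihilates spinors, and the covering map is read off the action in degrees 0
  and 1: degree 0 yields the scalar, degree 1 the group element. Invertibility of the generators of
  the cover is a computation with roots and coroots, for which the Clifford relations, imposed on
  bases only, must be extended bilinearly.\<close>

lemma poly_mapping_sum_single:
  fixes f :: "'a \<Rightarrow>\<^sub>0 'b::comm_monoid_add"
  shows "f = (\<Sum>w\<in>Poly_Mapping.keys f. Poly_Mapping.single w (Poly_Mapping.lookup f w))"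
proof (rule poly_mapping_eqI)
  fix k
  have "(\<Sum>w\<in>Poly_Mapping.keys f. Poly_Mapping.lookup f w when w = k)
      = (\<Sum>w\<in>Poly_Mapping.keys f. if k = w then Poly_Mapping.lookup f k else 0)"
    by (rule sum.cong) (auto simp: when_def)
  then show "Poly_Mapping.lookup f k
      = Poly_Mapping.lookup (\<Sum>w\<in>Poly_Mapping.keys f. Poly_Mapping.single w (Poly_Mapping.lookup f w)) k"
    by (simp add: lookup_sum lookup_single in_keys_iff)
qed

text \<open>Additive properties of a free-algebra element need checking on scaled words only. The
  zero element is a scaled word with coefficient 0, so it needs no case of its own.\<close>

lemma poly_mapping_additive_induct:
  fixes f :: "'a \<Rightarrow>\<^sub>0 'b::comm_monoid_add"
  assumes single: "\<And>w a. P (Poly_Mapping.single w a)"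
    and add: "\<And>f g. P f \<Longrightarrow> P g \<Longrightarrow> P (f + g)"
  shows "P f"
proof -
  have zero: "P 0" using single[of undefined 0] by simp
  have "P (\<Sum>w\<in>K. Poly_Mapping.single w (Poly_Mapping.lookup f w))" if "finite K" for K
    using that by (induction K rule: finite_induct) (auto simp: zero single add)
  from this[of "Poly_Mapping.keys f"] show ?thesis
    using poly_mapping_sum_single[of f] by simp
qed

lemma carrier_free_algebra:
  "f \<in> carrier (free_algebra X) \<longleftrightarrow> (\<forall>w\<in>Poly_Mapping.keys f. set w \<subseteq> X)"
  by (simp add: free_algebra_def)

lemma free_algebra_simps [simp]:
  "f \<otimes>\<^bsub>free_algebra X\<^esub> g = f * g" "f \<oplus>\<^bsub>free_algebra X\<^esub> g = f + g"
  "\<one>\<^bsub>free_algebra X\<^esub> = 1" "\<zero>\<^bsub>free_algebra X\<^esub> = 0"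
  by (simp_all add: free_algebra_def)

lemma free_algebra_closed [simp, intro]:
  "0 \<in> carrier (free_algebra X)"
  "1 \<in> carrier (free_algebra X)"
  "scalar a \<in> carrier (free_algebra X)"
  "x \<in> X \<Longrightarrow> letter x \<in> carrier (free_algebra X)"
  "f \<in> carrier (free_algebra X) \<Longrightarrow> g \<in> carrier (free_algebra X) \<Longrightarrow> f + g \<in> carrier (free_algebra X)"
  "f \<in> carrier (free_algebra X) \<Longrightarrow> g \<in> carrier (free_algebra X) \<Longrightarrow> f - g \<in> carrier (free_algebra X)"
  "f \<in> carrier (free_algebra X) \<Longrightarrow> g \<in> carrier (free_algebra X) \<Longrightarrow> f * g \<in> carrier (free_algebra X)"
  "f \<in> carrier (free_algebra X) \<Longrightarrow> - f \<in> carrier (free_algebra X)"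
proof -
  show "f * g \<in> carrier (free_algebra X)"
    if "f \<in> carrier (free_algebra X)" "g \<in> carrier (free_algebra X)"
    using that keys_mult[of f g] by (fastforce simp: carrier_free_algebra plus_list_def)
  show "f + g \<in> carrier (free_algebra X)"
    if "f \<in> carrier (free_algebra X)" "g \<in> carrier (free_algebra X)"
    using that keys_add[of f g] by (auto simp: carrier_free_algebra)
  show neg: "- f \<in> carrier (free_algebra X)" if "f \<in> carrier (free_algebra X)" for f :: "'a list \<Rightarrow>\<^sub>0 complex"
    using that by (auto simp: carrier_free_algebra in_keys_iff)
  show "f - g \<in> carrier (free_algebra X)"
    if "f \<in> carrier (free_algebra X)" "g \<in> carrier (free_algebra X)"
    using that neg[of g] keys_add[of f "- g"] by (auto simp: carrier_free_algebra)
qed (auto simp: carrier_free_algebra scalar_def letter_def in_keys_iff lookup_one lookup_single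
    when_def zero_list_def split: if_splits)

lemma free_algebra_sum_closed [intro]:
  assumes "\<And>i. i \<in> I \<Longrightarrow> f i \<in> carrier (free_algebra X)"
  shows "(\<Sum>i\<in>I. f i) \<in> carrier (free_algebra X)"
  using assms by (induction I rule: infinite_finite_induct) auto

lemma ring_free_algebra: "ring (free_algebra X)"
proof (rule ringI)
  show "abelian_group (free_algebra X)"
  proof (rule abelian_groupI)
    show "\<exists>y\<in>carrier (free_algebra X). y \<oplus>\<^bsub>free_algebra X\<^esub> x = \<zero>\<^bsub>free_algebra X\<^esub>"
      if "x \<in> carrier (free_algebra X)" for x
      by (rule bexI[of _ "- x"]) (use that in auto)
  qed (auto simp: algebra_simps)
  show "Group.monoid (free_algebra X)"
    by (rule monoidI) (auto simp: algebra_simps)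
qed (auto simp: algebra_simps)

lemma scalar_simps:
  "scalar (a + b) = scalar a + scalar b"
  "scalar (a * b) = scalar a * scalar b"
  "scalar (a - b) = scalar a - scalar b"
  "scalar (- a) = - scalar a"
  "scalar 0 = 0" "scalar 1 = 1"
  by (simp_all add: scalar_def single_add single_diff single_uminus mult_single plus_list_def
      flip: single_one[where 'a="'a list"] zero_list_def)
    (simp_all add: zero_list_def)

lemma scalar_central: "f * scalar a = scalar a * f"
proof (induction f rule: poly_mapping_additive_induct)
  case (1 w b)
  show ?case by (simp add: scalar_def mult_single plus_list_def mult.commute)
qed (simp add: algebra_simps)

text \<open>Shared by the Clifford algebra and the Cherednik algebra. Membership in the ideal
  \<open>J\<close> is expressed with the type-class operations of the free algebra, so congruences
  can be computed by ordinary algebra before passing to classes.\<close>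

locale presentation =
  fixes X :: "'g set" and R :: "('g list \<Rightarrow>\<^sub>0 complex) set"
  assumes rels_closed: "R \<subseteq> carrier (free_algebra X)"
begin

abbreviation "F \<equiv> free_algebra X"
abbreviation "Q \<equiv> presented X R"
abbreviation "cl \<equiv> pclass X R"

definition "J = Idl\<^bsub>F\<^esub> R"

sublocale F: ring F by (rule ring_free_algebra)

sublocale J: ideal J F
  unfolding J_def by (rule F.genideal_ideal[OF rels_closed])

lemma Q_eq: "Q = F Quot J" and cl_eq_coset: "cl f = J +>\<^bsub>F\<^esub> f"
  by (simp_all add: presented_def pclass_def J_def)

sublocale Q: ring Q
  unfolding Q_eq by (rule J.quotient_is_ring)

lemma rel_in_J: "f \<in> R \<Longrightarrow> f \<in> J"
  using F.genideal_self[OF rels_closed] by (auto simp: J_def)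

lemma J_minimal: "ideal K F \<Longrightarrow> R \<subseteq> K \<Longrightarrow> J \<subseteq> K"
  unfolding J_def by (rule F.genideal_minimal)

lemma minus_eq_diff: "f \<in> carrier F \<Longrightarrow> \<ominus>\<^bsub>F\<^esub> f = - f"
  by (rule F.minus_equality) auto

lemma J_closed:
  "0 \<in> J" "f \<in> J \<Longrightarrow> g \<in> J \<Longrightarrow> f + g \<in> J" "f \<in> J \<Longrightarrow> - f \<in> J"
  "f \<in> J \<Longrightarrow> g \<in> J \<Longrightarrow> f - g \<in> J"
  "f \<in> J \<Longrightarrow> g \<in> carrier F \<Longrightarrow> g * f \<in> J" "f \<in> J \<Longrightarrow> g \<in> carrier F \<Longrightarrow> f * g \<in> J"
proof -
  show "0 \<in> J" using J.zero_closed by simp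
  show add: "f + g \<in> J" if "f \<in> J" "g \<in> J" for f g using J.a_closed[OF that] by simp
  show neg: "- f \<in> J" if "f \<in> J" for f
    using J.a_inv_closed[OF that] minus_eq_diff[OF J.a_Hcarr[OF that]] by simp
  show "f - g \<in> J" if "f \<in> J" "g \<in> J" using add[OF that(1) neg[OF that(2)]] by simp
  show "g * f \<in> J" if "f \<in> J" "g \<in> carrier F" using J.I_l_closed[OF that] by simp
  show "f * g \<in> J" if "f \<in> J" "g \<in> carrier F" using J.I_r_closed[OF that] by simp
qed

lemma J_sum: "(\<And>i. i \<in> I \<Longrightarrow> f i \<in> J) \<Longrightarrow> (\<Sum>i\<in>I. f i) \<in> J"
  by (induction I rule: infinite_finite_induct) (auto intro: J_closed)

lemma cl_hom: "cl \<in> Ring.ring_hom F Q"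
  using J.rcos_ring_hom unfolding Q_eq cl_eq_coset[abs_def] .

lemma cl_closed: "f \<in> carrier F \<Longrightarrow> cl f \<in> carrier Q"
  and cl_mult: "f \<in> carrier F \<Longrightarrow> g \<in> carrier F \<Longrightarrow> cl (f * g) = cl f \<otimes>\<^bsub>Q\<^esub> cl g"
  and cl_add: "f \<in> carrier F \<Longrightarrow> g \<in> carrier F \<Longrightarrow> cl (f + g) = cl f \<oplus>\<^bsub>Q\<^esub> cl g"
  and cl_one: "cl 1 = \<one>\<^bsub>Q\<^esub>"
  using ring_hom_closed[OF cl_hom] ring_hom_mult[OF cl_hom] ring_hom_add[OF cl_hom]
    ring_hom_one[OF cl_hom] by auto

lemma Q_carrierE:
  assumes "g \<in> carrier Q"
  obtains f where "f \<in> carrier F" "g = cl f"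
  using assms that unfolding Q_eq cl_eq_coset[abs_def] FactRing_def A_RCOSETS_def'
  by auto

text \<open>Classes are sets of free-algebra elements; in this form any element picked from a class
  differs from a given representative by a member of the ideal.\<close>

lemma in_cl_iff: "h \<in> cl f \<longleftrightarrow> h - f \<in> J"
proof
  show "h \<in> cl f \<Longrightarrow> h - f \<in> J"
    by (auto simp: cl_eq_coset a_r_coset_def')
next
  assume "h - f \<in> J"
  moreover have "h = (h - f) + f" by simp
  ultimately show "h \<in> cl f"
    unfolding cl_eq_coset a_r_coset_def' by (metis (mono_tags, lifting) UN_iff free_algebra_simps(2) singletonI)
qed

lemma cl_eqI: "f - g \<in> J \<Longrightarrow> cl f = cl g"
proof -
  assume a: "f - g \<in> J"
  then have b: "g - f \<in> J" using J_closed(3) by fastforce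
  have "h - f \<in> J \<longleftrightarrow> h - g \<in> J" for h
    using J_closed(2)[OF _ a, of "h - f"] J_closed(2)[OF _ b, of "h - g"] by auto
  then show ?thesis by (auto simp: in_cl_iff)
qed

lemma cl_rel_eqI: "f - g \<in> R \<Longrightarrow> cl f = cl g"
  by (rule cl_eqI[OF rel_in_J])

lemma cl_uminus: "f \<in> carrier F \<Longrightarrow> \<ominus>\<^bsub>Q\<^esub> cl f = cl (- f)"
proof (rule Q.minus_equality)
  assume f: "f \<in> carrier F"
  have "cl (- f) \<oplus>\<^bsub>Q\<^esub> cl f = cl 0" using cl_add[of "- f" f] f by simp
  also have "\<dots> = \<zero>\<^bsub>Q\<^esub>"
    using Q.add.r_cancel_one[of "cl 0" "cl 0"] cl_add[of 0 0] cl_closed[of 0] by auto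
  finally show "cl (- f) \<oplus>\<^bsub>Q\<^esub> cl f = \<zero>\<^bsub>Q\<^esub>" .
qed (auto intro: cl_closed)

end

section \<open>The exterior algebra\<close>

definition ext_scale :: "complex \<Rightarrow> ext \<Rightarrow> ext" where
  "ext_scale a \<omega> = (\<lambda>J. a * \<omega> J)"

lemma ext_scale_apply [simp]: "ext_scale a \<omega> J = a * \<omega> J"
  by (simp add: ext_scale_def)

interpretation ext_vs: vector_space ext_scale
  by standard (auto simp: fun_eq_iff algebra_simps)

abbreviation "ext_linear \<equiv> Vector_Spaces.linear ext_scale ext_scale"

text \<open>The actual exterior algebra inside the type \<open>ext\<close>, whose elements may also
  have coordinates at index sets outside \<open>{..<rk A}\<close>. Operators built by
  \<open>lin_ext\<close> ignore those coordinates whereas the identity keeps them, so algebraic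
  identities are stated on this subspace.\<close>

definition ext_space :: "'h rca \<Rightarrow> ext set" where
  "ext_space A = {\<omega>. \<forall>J. \<not> J \<subseteq> {..<rk A} \<longrightarrow> \<omega> J = 0}"

lemma sum_fun_apply: "(\<Sum>i\<in>I. f i) x = (\<Sum>i\<in>I. f i x)"
  by (induction I rule: infinite_finite_induct) auto

lemma ext_linearI:
  assumes "\<And>\<omega> \<eta>. T (\<omega> + \<eta>) = T \<omega> + T \<eta>" "\<And>a \<omega>. T (ext_scale a \<omega>) = ext_scale a (T \<omega>)"
  shows "ext_linear T"
  by unfold_locales (use assms in auto)

lemma ext_linear_simps:
  assumes "ext_linear T"
  shows "T (\<omega> + \<eta>) = T \<omega> + T \<eta>" "T (ext_scale a \<omega>) = ext_scale a (T \<omega>)"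
    "T 0 = 0" "T (- \<omega>) = - T \<omega>" "T (\<omega> - \<eta>) = T \<omega> - T \<eta>"
    "T (\<Sum>i\<in>I. f i) = (\<Sum>i\<in>I. T (f i))"
proof -
  interpret T: Vector_Spaces.linear ext_scale ext_scale T by fact
  show "T (\<omega> + \<eta>) = T \<omega> + T \<eta>" "T (ext_scale a \<omega>) = ext_scale a (T \<omega>)"
    "T 0 = 0" "T (- \<omega>) = - T \<omega>" "T (\<omega> - \<eta>) = T \<omega> - T \<eta>"
    "T (\<Sum>i\<in>I. f i) = (\<Sum>i\<in>I. T (f i))"
    by (auto simp: T.add T.scale T.zero T.neg T.diff T.sum)
qed

lemma ext_linear_compose:
  assumes "ext_linear S" "ext_linear T"
  shows "ext_linear (\<lambda>\<omega>. S (T \<omega>))"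
  by (rule ext_linearI)
    (simp_all only: ext_linear_simps[OF assms(1)] ext_linear_simps[OF assms(2)])

lemma ext_linear_id: "ext_linear (\<lambda>\<omega>. \<omega>)"
  by (rule ext_linearI) auto

lemma ext_linear_scale:
  assumes "ext_linear T"
  shows "ext_linear (\<lambda>\<omega>. ext_scale a (T \<omega>))"
  by (rule ext_linearI) (simp_all add: ext_linear_simps(1,2)[OF assms] fun_eq_iff algebra_simps)

lemma ext_linear_add:
  assumes "ext_linear S" "ext_linear T"
  shows "ext_linear (\<lambda>\<omega>. S \<omega> + T \<omega>)"
  by (rule ext_linearI)
    (simp_all add: ext_linear_simps(1,2)[OF assms(1)] ext_linear_simps(1,2)[OF assms(2)]
      fun_eq_iff algebra_simps)

lemma ext_linear_sum:
  assumes "\<And>i. i \<in> I \<Longrightarrow> ext_linear (T i)"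
  shows "ext_linear (\<lambda>\<omega>. \<Sum>i\<in>I. T i \<omega>)"
proof (rule ext_linearI)
  fix \<omega> \<eta> a
  have "(\<Sum>i\<in>I. T i (\<omega> + \<eta>)) = (\<Sum>i\<in>I. T i \<omega> + T i \<eta>)"
    by (rule sum.cong[OF refl]) (rule ext_linear_simps(1)[OF assms])
  then show "(\<Sum>i\<in>I. T i (\<omega> + \<eta>)) = (\<Sum>i\<in>I. T i \<omega>) + (\<Sum>i\<in>I. T i \<eta>)"
    by (simp only: sum.distrib)
  have "(\<Sum>i\<in>I. T i (ext_scale a \<omega>)) = (\<Sum>i\<in>I. ext_scale a (T i \<omega>))"
    by (rule sum.cong[OF refl]) (rule ext_linear_simps(2)[OF assms])
  then show "(\<Sum>i\<in>I. T i (ext_scale a \<omega>)) = ext_scale a (\<Sum>i\<in>I. T i \<omega>)"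
    by (simp only: ext_vs.scale_sum_right)
qed

lemma ext_space_closed [intro]:
  "0 \<in> ext_space A" "\<omega> \<in> ext_space A \<Longrightarrow> \<eta> \<in> ext_space A \<Longrightarrow> \<omega> + \<eta> \<in> ext_space A"
  "\<omega> \<in> ext_space A \<Longrightarrow> ext_scale a \<omega> \<in> ext_space A"
  "I \<subseteq> {..<rk A} \<Longrightarrow> blade I \<in> ext_space A"
  by (auto simp: ext_space_def blade_def)

lemma ext_space_sum:
  "(\<And>i. i \<in> I \<Longrightarrow> f i \<in> ext_space A) \<Longrightarrow> (\<Sum>i\<in>I. f i) \<in> ext_space A"
  by (induction I rule: infinite_finite_induct) (auto simp: ext_space_closed)

lemma ext_expand:
  assumes "\<omega> \<in> ext_space A"
  shows "\<omega> = (\<Sum>I\<in>Pow {..<rk A}. ext_scale (\<omega> I) (blade I))"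
proof
  fix J
  show "\<omega> J = (\<Sum>I\<in>Pow {..<rk A}. ext_scale (\<omega> I) (blade I)) J"
    using assms by (auto simp: sum_fun_apply blade_def ext_space_def if_distrib cong: if_cong)
qed

lemma ext_linear_expand:
  assumes "ext_linear T" "\<omega> \<in> ext_space A"
  shows "T \<omega> J = (\<Sum>I\<in>Pow {..<rk A}. \<omega> I * T (blade I) J)"
  by (subst ext_expand[OF assms(2)]) (simp add: ext_linear_simps[OF assms(1)] sum_fun_apply)

lemma lin_ext_linear: "ext_linear (lin_ext A F)"
  by (rule ext_linearI)
    (auto simp: lin_ext_def fun_eq_iff algebra_simps sum.distrib sum_distrib_left)

lemma lin_ext_blade: "I \<subseteq> {..<rk A} \<Longrightarrow> lin_ext A F (blade I) = F I"
  by (auto simp: lin_ext_def blade_def fun_eq_iff if_distrib[of "\<lambda>x. x * _"] cong: if_cong)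

lemma lin_ext_closed:
  "(\<And>I. I \<subseteq> {..<rk A} \<Longrightarrow> F I \<in> ext_space A) \<Longrightarrow> lin_ext A F \<omega> \<in> ext_space A"
  by (auto simp: lin_ext_def ext_space_def intro!: sum.neutral)

section \<open>Creation and annihilation operators on blades\<close>

definition create :: "'h rca \<Rightarrow> nat \<Rightarrow> ext \<Rightarrow> ext" where
  "create A i = lin_ext A (\<lambda>I. if i \<in> I then 0
     else ext_scale ((-1) ^ position I i) (blade (insert i I)))"

text \<open>Contraction by a basis covector, with positions counted from 1. The extra sign relative
  to \<open>create\<close> makes their anticommutator negative, and the factor 2 of the spinor
  action turns it into the Clifford constant -2.\<close>

definition annihilate :: "'h rca \<Rightarrow> nat \<Rightarrow> ext \<Rightarrow> ext" where
  "annihilate A i = lin_ext A (\<lambda>I. if i \<in> I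
     then ext_scale ((-1) ^ (position I i + 1)) (blade (I - {i})) else 0)"

lemma create_blade: "I \<subseteq> {..<rk A} \<Longrightarrow> create A i (blade I) =
    (if i \<in> I then 0 else ext_scale ((-1) ^ position I i) (blade (insert i I)))"
  by (simp add: create_def lin_ext_blade)

lemma annihilate_blade: "I \<subseteq> {..<rk A} \<Longrightarrow> annihilate A i (blade I) =
    (if i \<in> I then ext_scale ((-1) ^ (position I i + 1)) (blade (I - {i})) else 0)"
  by (simp add: annihilate_def lin_ext_blade)

lemma create_linear: "ext_linear (create A i)" and annihilate_linear: "ext_linear (annihilate A i)"
  by (simp_all add: create_def annihilate_def lin_ext_linear)

lemma create_closed: "i < rk A \<Longrightarrow> create A i \<omega> \<in> ext_space A"
  unfolding create_def by (rule lin_ext_closed) auto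

lemma annihilate_closed: "annihilate A i \<omega> \<in> ext_space A"
proof -
  have "ext_scale ((-1) ^ (position I i + 1)) (blade (I - {i})) \<in> ext_space A"
    if "I \<subseteq> {..<rk A}" for I
    using that by (intro ext_space_closed) auto
  then show ?thesis
    unfolding annihilate_def by (intro lin_ext_closed) (simp only: split: if_split, blast)
qed

lemma wedge_eq_create: "wedge A v \<omega> = (\<Sum>i<rk A. ext_scale (xbas A i v) (create A i \<omega>))"
proof
  fix J
  have "(\<Sum>i\<in>{..<rk A} - I. xbas A i v * (-1) ^ position I i * blade (insert i I) J)
    = (\<Sum>i<rk A. if i \<in> I then 0 else xbas A i v * (-1) ^ position I i * blade (insert i I) J)" for I
    by (rule sum.mono_neutral_cong_left) auto
  then show "wedge A v \<omega> J = (\<Sum>i<rk A. ext_scale (xbas A i v) (create A i \<omega>)) J"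
    unfolding wedge_def create_def lin_ext_def sum_fun_apply
    by (simp add: sum_distrib_left if_distrib[of "\<lambda>x. x J"] if_distrib[of "\<lambda>x. _ * x"] mult_ac cong: if_cong)
      (rule sum.swap)
qed

lemma contract_eq_annihilate:
  "contract A \<xi> \<omega> = (\<Sum>i<rk A. ext_scale (\<xi> (ybas A i)) (annihilate A i \<omega>))"
proof
  fix J
  have *: "(\<Sum>i\<in>I. (-1) ^ (position I i + 1) * \<xi> (ybas A i) * blade (I - {i}) J)
    = (\<Sum>i<rk A. if i \<in> I then (-1) ^ (position I i + 1) * \<xi> (ybas A i) * blade (I - {i}) J else 0)"
    if "I \<in> Pow {..<rk A}" for I
    by (rule sum.mono_neutral_cong_left) (use that in auto)
  have "contract A \<xi> \<omega> J = (\<Sum>I\<in>Pow {..<rk A}. \<Sum>i<rk A. \<omega> I *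
     (if i \<in> I then (-1) ^ (position I i + 1) * \<xi> (ybas A i) * blade (I - {i}) J else 0))"
    unfolding contract_def lin_ext_def sum_distrib_left[symmetric]
    by (rule sum.cong[OF refl]) (use * in auto)
  also have "\<dots> = (\<Sum>i<rk A. ext_scale (\<xi> (ybas A i)) (annihilate A i \<omega>)) J"
    unfolding annihilate_def lin_ext_def sum_fun_apply
    by (subst sum.swap)
      (auto simp: sum_distrib_left mult_ac intro!: sum.cong)
  finally show "contract A \<xi> \<omega> J = (\<Sum>i<rk A. ext_scale (\<xi> (ybas A i)) (annihilate A i \<omega>)) J" .
qed

lemma wedge_linear: "ext_linear (wedge A v)" and contract_linear: "ext_linear (contract A \<xi>)"
  by (simp_all add: wedge_def contract_def lin_ext_linear)

lemma wedge_closed: "wedge A v \<omega> \<in> ext_space A"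
  unfolding wedge_eq_create by (rule ext_space_sum) (auto intro: create_closed)

lemma contract_closed: "contract A \<xi> \<omega> \<in> ext_space A"
  unfolding contract_eq_annihilate by (rule ext_space_sum) (auto intro: annihilate_closed)

text \<open>The source of all signs: a new index shifts the positions of exactly the indices above
  it.\<close>

lemma position_insert:
  assumes "finite I" "j \<notin> I"
  shows "position (insert j I) i = position I i + (if j < i then 1 else 0)"
proof -
  have "{k \<in> insert j I. k < i} = (if j < i then insert j {k \<in> I. k < i} else {k \<in> I. k < i})"
    by auto
  then show ?thesis using assms by (simp add: position_def)
qed

lemma position_remove:
  assumes "finite I" "j \<in> I"
  shows "position I i = position (I - {j}) i + (if j < i then 1 else 0)"
  using position_insert[of "I - {j}" j i] assms by (simp add: insert_absorb)

lemma ext_linear_eqI: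
  assumes "ext_linear S" "ext_linear T" "\<omega> \<in> ext_space A"
    and "\<And>I. I \<subseteq> {..<rk A} \<Longrightarrow> S (blade I) = T (blade I)"
  shows "S \<omega> = T \<omega>"
  by (rule ext) (use assms(4) in \<open>auto simp: ext_linear_expand[OF assms(1,3)]
    ext_linear_expand[OF assms(2,3)] intro!: sum.cong\<close>)

text \<open>Of two distinct indices exactly one lies below the other, so exchanging the two
  insertions changes exactly one exponent by 1. For \<open>i = j\<close> both sides vanish on
  blades, so squares are included.\<close>

lemma create_create:
  assumes "i < rk A" "j < rk A" "\<omega> \<in> ext_space A"
  shows "create A i (create A j \<omega>) = - create A j (create A i \<omega>)"
proof (rule ext_linear_eqI[OF _ _ assms(3)])
  show "ext_linear (\<lambda>\<omega>. create A i (create A j \<omega>))"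
    by (rule ext_linear_compose[OF create_linear create_linear])
  show "ext_linear (\<lambda>\<omega>. - create A j (create A i \<omega>))"
    using ext_linear_scale[OF ext_linear_compose[OF create_linear create_linear], of "- 1" A j A i]
    by (simp add: ext_scale_def fun_Compl_def)
  fix I assume I: "I \<subseteq> {..<rk A}"
  then have "finite I" using finite_subset by blast
  then show "create A i (create A j (blade I)) = - create A j (create A i (blade I))"
    using I assms
    by (auto simp: create_blade ext_linear_simps[OF create_linear] position_insert fun_eq_iff
        insert_commute)
qed

lemma annihilate_annihilate:
  assumes "\<omega> \<in> ext_space A"
  shows "annihilate A i (annihilate A j \<omega>) = - annihilate A j (annihilate A i \<omega>)"
proof (rule ext_linear_eqI[OF _ _ assms])
  show "ext_linear (\<lambda>\<omega>. annihilate A i (annihilate A j \<omega>))"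
    by (rule ext_linear_compose[OF annihilate_linear annihilate_linear])
  show "ext_linear (\<lambda>\<omega>. - annihilate A j (annihilate A i \<omega>))"
    using ext_linear_scale[OF ext_linear_compose[OF annihilate_linear annihilate_linear], of "- 1" A j A i]
    by (simp add: ext_scale_def fun_Compl_def)
  fix I assume I: "I \<subseteq> {..<rk A}"
  then have fin: "finite I" using finite_subset by blast
  have d: "I - {i} \<subseteq> {..<rk A}" "I - {i} - {j} = I - {j} - {i}" for i j using I by auto
  have p: "position I i = position (I - {j}) i + (if j < i then 1 else 0)" if "j \<in> I" for i j
    by (rule position_remove[OF fin that])
  show "annihilate A i (annihilate A j (blade I)) = - annihilate A j (annihilate A i (blade I))"
    using I p[of j i] p[of i j]
    by (auto simp: annihilate_blade ext_linear_simps[OF annihilate_linear] d(1) d(2)[of i j] fun_eq_iff)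
qed

lemma annihilate_create:
  assumes "i < rk A" "j < rk A" "\<omega> \<in> ext_space A"
  shows "annihilate A i (create A j \<omega>) + create A j (annihilate A i \<omega>)
    = ext_scale (if i = j then -1 else 0) \<omega>"
proof (rule ext_linear_eqI[OF _ _ assms(3)])
  show "ext_linear (\<lambda>\<omega>. annihilate A i (create A j \<omega>) + create A j (annihilate A i \<omega>))"
    by (rule ext_linear_add[OF ext_linear_compose[OF annihilate_linear create_linear]
          ext_linear_compose[OF create_linear annihilate_linear]])
  show "ext_linear (ext_scale (if i = j then -1 else 0))"
    by (rule ext_linear_scale[OF ext_linear_id])
  fix I assume I: "I \<subseteq> {..<rk A}"
  then have fin: "finite I" using finite_subset by blast
  have d: "I - {i} \<subseteq> {..<rk A}" "insert j I \<subseteq> {..<rk A}" using I assms by auto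
  have ss: "(-1) ^ k * ((-1) ^ k * z) = z" for k and z :: complex
    by (simp flip: mult.assoc power_mult_distrib)
  note simps = annihilate_blade create_blade ext_linear_simps(2-4)[OF annihilate_linear]
    ext_linear_simps(2-4)[OF create_linear]
  show "annihilate A i (create A j (blade I)) + create A j (annihilate A i (blade I))
    = ext_scale (if i = j then -1 else 0) (blade I)"
  proof (cases "i = j")
    case True
    show ?thesis
    proof (cases "j \<in> I")
      case j: True
      then show ?thesis
        using True I d by (simp add: simps position_remove[OF fin j, of j] insert_absorb fun_eq_iff ss)
    next
      case j: False
      then show ?thesis
        using True I d by (simp add: simps position_insert[OF fin j] fun_eq_iff ss)
    qed
  next
    case False
    \<comment> \<open>For distinct indices both terms vanish unless \<open>i\<close> can be removed
      and \<open>j\<close> inserted. In that case exactly one of the two positions depends on the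
      order of the operations, so the two terms cancel.\<close>
    consider "j \<in> I" | "i \<notin> I" "j \<notin> I" | "i \<in> I" "j \<notin> I" by blast
    then show ?thesis
    proof cases
      case 1
      then show ?thesis using False I d by (simp add: simps fun_eq_iff)
    next
      case 2
      then show ?thesis using False I d by (simp add: simps fun_eq_iff)
    next
      case 3
      have "insert j I - {i} = insert j (I - {i})" using False by auto
      then show ?thesis
        using 3 False I d
        by (simp add: simps position_insert[OF fin 3(2)] position_remove[OF fin 3(1), of j] fun_eq_iff
            algebra_simps)
    qed
  qed
qed

section \<open>Anticommutation of wedges and contractions\<close>

lemma wedge_wedge:
  assumes "\<omega> \<in> ext_space A"
  shows "wedge A u (wedge A v \<omega>) = - wedge A v (wedge A u \<omega>)"
proof -
  have e: "wedge A u (wedge A v \<omega>)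
    = (\<Sum>i<rk A. \<Sum>j<rk A. ext_scale (xbas A i u * xbas A j v) (create A i (create A j \<omega>)))" for u v
    by (simp add: wedge_eq_create ext_linear_simps[OF create_linear] ext_vs.scale_sum_right)
  have "wedge A u (wedge A v \<omega>)
    = (\<Sum>i<rk A. \<Sum>j<rk A. - ext_scale (xbas A j v * xbas A i u) (create A j (create A i \<omega>)))"
    unfolding e by (intro sum.cong refl) (subst create_create[OF _ _ assms], simp_all add: mult.commute)
  also have "\<dots> = - wedge A v (wedge A u \<omega>)"
    unfolding e by (simp add: sum_negf) (rule sum.swap)
  finally show ?thesis .
qed

lemma contract_contract:
  assumes "\<omega> \<in> ext_space A"
  shows "contract A \<xi> (contract A \<eta> \<omega>) = - contract A \<eta> (contract A \<xi> \<omega>)"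
proof -
  have e: "contract A \<xi> (contract A \<eta> \<omega>) = (\<Sum>i<rk A. \<Sum>j<rk A.
      ext_scale (\<xi> (ybas A i) * \<eta> (ybas A j)) (annihilate A i (annihilate A j \<omega>)))" for \<xi> \<eta>
    by (simp add: contract_eq_annihilate ext_linear_simps[OF annihilate_linear] ext_vs.scale_sum_right)
  have "contract A \<xi> (contract A \<eta> \<omega>) = (\<Sum>i<rk A. \<Sum>j<rk A.
      - ext_scale (\<eta> (ybas A j) * \<xi> (ybas A i)) (annihilate A j (annihilate A i \<omega>)))"
    unfolding e
    by (intro sum.cong refl) (subst annihilate_annihilate[OF assms], simp add: mult.commute)
  also have "\<dots> = - contract A \<eta> (contract A \<xi> \<omega>)"
    unfolding e by (simp add: sum_negf) (rule sum.swap)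
  finally show ?thesis .
qed

lemma contract_blade_empty: "contract A \<xi> (blade {}) = 0"
  by (simp add: contract_eq_annihilate annihilate_blade)

lemma dual_linear:
  assumes "\<xi> \<in> dual A"
  shows "\<xi> (u + v) = \<xi> u + \<xi> v" "\<xi> (scal A a v) = a * \<xi> v" "\<xi> 0 = 0" "\<xi> (u - v) = \<xi> u - \<xi> v"
    "\<xi> (\<Sum>i\<in>I. f i) = (\<Sum>i\<in>I. \<xi> (f i))"
proof -
  interpret Vector_Spaces.linear "scal A" "(*)" \<xi> using assms by (simp add: dual_def)
  show "\<xi> (u + v) = \<xi> u + \<xi> v" "\<xi> (scal A a v) = a * \<xi> v" "\<xi> 0 = 0" "\<xi> (u - v) = \<xi> u - \<xi> v"
    "\<xi> (\<Sum>i\<in>I. f i) = (\<Sum>i\<in>I. \<xi> (f i))"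
    by (rule add scale zero diff sum)+
qed

context rca_data
begin

sublocale h: vector_space "scal A"
  by (rule vs)

lemma dualI:
  assumes "\<And>u v. \<xi> (u + v) = \<xi> u + \<xi> v" "\<And>a v. \<xi> (scal A a v) = a * \<xi> v"
  shows "\<xi> \<in> dual A"
  unfolding dual_def mem_Collect_eq
  by unfold_locales (use assms in \<open>auto simp: algebra_simps\<close>)

lemma y_expand: "v = (\<Sum>i<rk A. scal A (xbas A i v) (ybas A i))"
proof -
  have "v \<in> h.span (ybas A ` {..<rk A})" using basis_span by simp
  then obtain c where "v = (\<Sum>b\<in>ybas A ` {..<rk A}. scal A (c b) b)"
    unfolding h.span_finite[OF finite_imageI[OF finite_lessThan]] by auto
  then have v: "v = (\<Sum>i<rk A. scal A (c (ybas A i)) (ybas A i))"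
    by (simp add: sum.reindex[OF basis_inj])
  have "xbas A j v = c (ybas A j)" if "j < rk A" for j
  proof -
    have "xbas A j v = (\<Sum>i<rk A. c (ybas A i) * xbas A j (ybas A i))"
      by (subst v) (simp add: dual_linear[OF dual_basis(1)[OF that]])
    also have "\<dots> = (\<Sum>i<rk A. if i = j then c (ybas A i) else 0)"
      by (rule sum.cong) (auto simp: dual_basis that)
    finally show ?thesis using that by simp
  qed
  then show ?thesis using v by simp
qed

lemma xbas_eqI:
  assumes "\<And>i. i < rk A \<Longrightarrow> xbas A i u = xbas A i v"
  shows "u = v"
proof -
  have "u = (\<Sum>i<rk A. scal A (xbas A i u) (ybas A i))" by (rule y_expand)
  also have "\<dots> = (\<Sum>i<rk A. scal A (xbas A i v) (ybas A i))" by (simp add: assms)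
  also have "\<dots> = v" by (rule y_expand[symmetric])
  finally show ?thesis .
qed

lemma dual_expand: "\<xi> \<in> dual A \<Longrightarrow> \<xi> v = (\<Sum>i<rk A. xbas A i v * \<xi> (ybas A i))"
  by (subst y_expand[of v]) (simp add: dual_linear)

lemma wedge_add: "wedge A (u + v) \<omega> = wedge A u \<omega> + wedge A v \<omega>"
  by (simp add: wedge_eq_create dual_linear[OF dual_basis(1)] ext_vs.scale_left_distrib sum.distrib)

lemma wedge_scale: "wedge A (scal A a v) \<omega> = ext_scale a (wedge A v \<omega>)"
  by (simp add: wedge_eq_create dual_linear[OF dual_basis(1)] ext_vs.scale_sum_right)

lemma wedge_sum: "wedge A (\<Sum>i\<in>I. f i) \<omega> = (\<Sum>i\<in>I. wedge A (f i) \<omega>)"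
proof -
  have "wedge A 0 \<omega> = 0" using wedge_scale[of 0 0 \<omega>] by (simp add: fun_eq_iff)
  then show ?thesis by (induction I rule: infinite_finite_induct) (auto simp: wedge_add)
qed

lemma wedge_ybas: "i < rk A \<Longrightarrow> wedge A (ybas A i) \<omega> = create A i \<omega>"
proof -
  assume i: "i < rk A"
  have "wedge A (ybas A i) \<omega> = (\<Sum>j<rk A. if j = i then create A i \<omega> else 0)"
    unfolding wedge_eq_create by (rule sum.cong) (use i in \<open>auto simp: dual_basis fun_eq_iff\<close>)
  then show ?thesis using i by simp
qed

lemma contract_xbas: "i < rk A \<Longrightarrow> contract A (xbas A i) \<omega> = annihilate A i \<omega>"
proof -
  assume i: "i < rk A"
  have "contract A (xbas A i) \<omega> = (\<Sum>j<rk A. if j = i then annihilate A i \<omega> else 0)"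
    unfolding contract_eq_annihilate
    by (rule sum.cong) (use i in \<open>auto simp: dual_basis fun_eq_iff\<close>)
  then show ?thesis using i by simp
qed

lemma wedge_apply_empty: "wedge A v (blade {}) = (\<Sum>i<rk A. ext_scale (xbas A i v) (blade {i}))"
  by (simp add: wedge_eq_create create_blade position_def)

text \<open>Degree 1 of the exterior algebra remembers the vector, whose coordinates are the entries
  at singletons. This later recovers a group element from its action on spinors.\<close>

lemma wedge_inj:
  assumes "wedge A u (blade {}) = wedge A v (blade {})"
  shows "u = v"
proof -
  have e: "wedge A v (blade {}) {i} = xbas A i v" if "i < rk A" for v i
  proof -
    have "wedge A v (blade {}) {i} = (\<Sum>j<rk A. if j = i then xbas A i v else 0)"
      unfolding wedge_apply_empty sum_fun_apply by (rule sum.cong) (auto simp: blade_def)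
    then show ?thesis using that by simp
  qed
  show ?thesis
    by (rule xbas_eqI) (use e[of _ u] e[of _ v] assms in simp)
qed

text \<open>The double sum over \<open>annihilate_create\<close> collapses to its diagonal, which is
  the expansion of \<open>\<xi> v\<close>. Later computations move contractions past wedges with
  this rule until they reach \<open>blade {}\<close>, which they kill.\<close>

lemma contract_wedge:
  assumes "\<omega> \<in> ext_space A" "\<xi> \<in> dual A"
  shows "contract A \<xi> (wedge A v \<omega>) = - ext_scale (\<xi> v) \<omega> - wedge A v (contract A \<xi> \<omega>)"
proof -
  have l: "contract A \<xi> (wedge A v \<omega>) = (\<Sum>i<rk A. \<Sum>j<rk A.
      ext_scale (\<xi> (ybas A i) * xbas A j v) (annihilate A i (create A j \<omega>)))"
    by (simp add: contract_eq_annihilate wedge_eq_create ext_linear_simps[OF annihilate_linear]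
        ext_vs.scale_sum_right)
  have r: "wedge A v (contract A \<xi> \<omega>) = (\<Sum>j<rk A. \<Sum>i<rk A.
      ext_scale (\<xi> (ybas A i) * xbas A j v) (create A j (annihilate A i \<omega>)))"
    by (simp add: contract_eq_annihilate wedge_eq_create ext_linear_simps[OF create_linear]
        ext_vs.scale_sum_right mult.commute)
  have "contract A \<xi> (wedge A v \<omega>) + wedge A v (contract A \<xi> \<omega>) = (\<Sum>i<rk A. \<Sum>j<rk A.
      ext_scale (\<xi> (ybas A i) * xbas A j v)
        (annihilate A i (create A j \<omega>) + create A j (annihilate A i \<omega>)))"
    unfolding l r by (subst (2) sum.swap) (simp add: ext_vs.scale_right_distrib sum.distrib)
  also have "\<dots> = (\<Sum>i<rk A. \<Sum>j<rk A.
      if j = i then - ext_scale (\<xi> (ybas A i) * xbas A j v) \<omega> else 0)"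
    by (intro sum.cong refl) (simp add: annihilate_create[OF _ _ assms(1)] fun_eq_iff)
  also have "\<dots> = - ext_scale (\<xi> v) \<omega>"
    by (subst dual_expand[OF assms(2), of v])
      (simp add: sum_negf ext_vs.scale_sum_left mult.commute)
  finally show ?thesis by (simp add: eq_diff_eq)
qed

text \<open>Wedges with basis vectors generate the exterior algebra from \<open>blade {}\<close>.
  Operators with the same value there and the same commutation rule with wedges therefore agree,
  which replaces computations with ordered products.\<close>

lemma ext_generate_eq:
  assumes S: "ext_linear S" and T: "ext_linear T"
    and empty: "S (blade {}) = T (blade {})"
    and step: "\<And>i \<omega>. i < rk A \<Longrightarrow> \<omega> \<in> ext_space A \<Longrightarrow> S \<omega> = T \<omega> \<Longrightarrow>
      S (wedge A (ybas A i) \<omega>) = T (wedge A (ybas A i) \<omega>)"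
    and \<omega>: "\<omega> \<in> ext_space A"
  shows "S \<omega> = T \<omega>"
proof (rule ext_linear_eqI[OF S T \<omega>])
  fix I assume "I \<subseteq> {..<rk A}"
  then have "finite I" using finite_subset by blast
  then show "S (blade I) = T (blade I)" using \<open>I \<subseteq> {..<rk A}\<close>
  proof (induction I)
    case empty
    show ?case by (rule assms(3))
  next
    case (insert i I)
    from insert.prems insert.hyps have I: "I \<subseteq> {..<rk A}" and i: "i < rk A" "i \<notin> I" by auto
    have ss: "(-1) ^ k * ((-1) ^ k * z) = z" for k and z :: complex
      by (simp flip: mult.assoc power_mult_distrib)
    \<comment> \<open>The sign produced by \<open>create_blade\<close> squares to 1, so it can be
      moved to the other side.\<close>
    have b: "blade (insert i I) = ext_scale ((-1) ^ position I i) (wedge A (ybas A i) (blade I))"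
      using i I by (simp add: wedge_ybas create_blade fun_eq_iff ss)
    show ?case
      unfolding b by (simp only: ext_linear_simps(2)[OF S] ext_linear_simps(2)[OF T]
          step[OF i(1) ext_space_closed(4)[OF I] insert.IH[OF I]])
  qed
qed

section \<open>The reflection group and its functorial action on the exterior algebra\<close>

lemma grp_GL: "w \<in> grp A \<Longrightarrow> Vector_Spaces.linear (scal A) (scal A) w" "w \<in> grp A \<Longrightarrow> bij w"
  using subgroup.subset[OF W_subgroup] by (auto simp: GL_def)

lemma grp_linear:
  assumes "w \<in> grp A"
  shows "w (u + v) = w u + w v" "w (scal A a v) = scal A a (w v)" "w 0 = 0" "w (u - v) = w u - w v"
    "w (\<Sum>i\<in>I. f i) = (\<Sum>i\<in>I. w (f i))"
proof -
  interpret Vector_Spaces.linear "scal A" "scal A" w by (rule grp_GL[OF assms])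
  show "w (u + v) = w u + w v" "w (scal A a v) = scal A a (w v)" "w 0 = 0" "w (u - v) = w u - w v"
    "w (\<Sum>i\<in>I. f i) = (\<Sum>i\<in>I. w (f i))"
    by (rule add scale zero diff sum)+
qed

lemma grp_inv: "w \<in> grp A \<Longrightarrow> w (inv_into UNIV w v) = v" "w \<in> grp A \<Longrightarrow> inv_into UNIV w (w v) = v"
  using grp_GL(2) by (auto simp: bij_is_surj surj_f_inv_f bij_is_inj)

lemma group_GL: "Group.group (GL A)"
proof (rule groupI)
  fix f g assume "f \<in> carrier (GL A)" "g \<in> carrier (GL A)"
  then show "f \<otimes>\<^bsub>GL A\<^esub> g \<in> carrier (GL A)"
    by (auto simp: GL_def bij_comp Vector_Spaces.linear_compose)
next
  show "\<one>\<^bsub>GL A\<^esub> \<in> carrier (GL A)" by (simp add: GL_def h.linear_id)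
next
  fix f assume f: "f \<in> carrier (GL A)"
  show "\<exists>g\<in>carrier (GL A). g \<otimes>\<^bsub>GL A\<^esub> f = \<one>\<^bsub>GL A\<^esub>"
  proof (rule bexI[of _ "inv_into UNIV f"])
    from f have b: "bij f" and l: "Vector_Spaces.linear (scal A) (scal A) f" by (auto simp: GL_def)
    interpret f: Vector_Spaces.linear "scal A" "scal A" f by (rule l)
    have s: "f (inv_into UNIV f v) = v" "inv_into UNIV f (f v) = v" for v
      using b by (auto simp: bij_is_surj surj_f_inv_f bij_is_inj)
    have "Vector_Spaces.linear (scal A) (scal A) (inv_into UNIV f)"
    proof unfold_locales
      fix u v a
      show "inv_into UNIV f (u + v) = inv_into UNIV f u + inv_into UNIV f v" by (metis f.add s)
      show "inv_into UNIV f (scal A a v) = scal A a (inv_into UNIV f v)" by (metis f.scale s)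
    qed
    then show "inv_into UNIV f \<in> carrier (GL A)" using b by (simp add: GL_def bij_imp_bij_inv)
    show "inv_into UNIV f \<otimes>\<^bsub>GL A\<^esub> f = \<one>\<^bsub>GL A\<^esub>" using s by (auto simp: GL_def)
  qed
qed (auto simp: GL_def comp_assoc)

lemma group_W: "Group.group (Wgroup A)"
  unfolding Wgroup_def by (rule subgroup.subgroup_is_group[OF W_subgroup group_GL])

lemma Wgroup_simps [simp]: "carrier (Wgroup A) = grp A" "v \<otimes>\<^bsub>Wgroup A\<^esub> w = v \<circ> w" "\<one>\<^bsub>Wgroup A\<^esub> = id"
  by (simp_all add: Wgroup_def GL_def)

lemma grp_closed: "id \<in> grp A" "v \<in> grp A \<Longrightarrow> w \<in> grp A \<Longrightarrow> v \<circ> w \<in> grp A"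
  using subgroup.one_closed[OF W_subgroup] subgroup.m_closed[OF W_subgroup] by (auto simp: GL_def)

lemma grp_inv_closed: "w \<in> grp A \<Longrightarrow> inv_into UNIV w \<in> grp A"
proof -
  assume w: "w \<in> grp A"
  have "inv\<^bsub>Wgroup A\<^esub> w \<in> grp A" "w \<circ> inv\<^bsub>Wgroup A\<^esub> w = id"
    using group.inv_closed[OF group_W, of w] group.r_inv[OF group_W, of w] w by auto
  moreover from this have "inv\<^bsub>Wgroup A\<^esub> w = inv_into UNIV w"
    using grp_inv(2)[OF w] by (metis comp_apply ext id_apply)
  ultimately show ?thesis by simp
qed

lemma dual_act_apply: "dual_act w \<xi> v = \<xi> (inv_into UNIV w v)"
  by (simp add: dual_act_def)

lemma dual_act_closed: "w \<in> grp A \<Longrightarrow> \<xi> \<in> dual A \<Longrightarrow> dual_act w \<xi> \<in> dual A"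
  by (rule dualI) (simp_all add: dual_act_apply dual_linear grp_linear[OF grp_inv_closed])

lemma ext_act_linear: "ext_linear (ext_act A w)"
  by (simp add: ext_act_def lin_ext_linear)

lemma foldr_wedge_closed: "\<omega> \<in> ext_space A \<Longrightarrow> foldr (\<lambda>i. wedge A (u i)) xs \<omega> \<in> ext_space A"
  by (cases xs) (auto simp: wedge_closed)

lemma ext_act_closed: "ext_act A w \<omega> \<in> ext_space A"
  unfolding ext_act_def by (rule lin_ext_closed) (auto intro: foldr_wedge_closed)

lemma ext_act_empty: "ext_act A w (blade {}) = blade {}"
  by (simp add: ext_act_def lin_ext_blade)

lemma wedge_foldr_mem:
  assumes "i \<in> set xs" "\<omega> \<in> ext_space A"
  shows "wedge A (u i) (foldr (\<lambda>i. wedge A (u i)) xs \<omega>) = 0"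
  using assms(1)
proof (induction xs)
  case (Cons a xs)
  let ?r = "foldr (\<lambda>i. wedge A (u i)) xs \<omega>"
  have r: "?r \<in> ext_space A" by (rule foldr_wedge_closed[OF assms(2)])
  have eq: "wedge A (u i) (wedge A (u a) ?r) = - wedge A (u a) (wedge A (u i) ?r)"
    by (rule wedge_wedge[OF r])
  show ?case
  proof (cases "i = a")
    case True
    \<comment> \<open>Wedging twice with the same vector gives an element equal to its own negative,
      so each of its coordinates is 0.\<close>
    then have "wedge A (u i) (wedge A (u a) ?r) J = 0" for J
      using fun_cong[OF eq, of J] by simp
    then show ?thesis by (simp add: fun_eq_iff)
  next
    case False
    then have "i \<in> set xs" using Cons.prems by simp
    then have "wedge A (u i) ?r = 0" by (rule Cons.IH)
    then show ?thesis using eq by (simp only: ext_linear_simps(3)[OF wedge_linear] foldr.simps o_apply neg_equal_0_iff_equal)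
  qed
qed simp

text \<open>A factor inserted into a sorted product passes exactly the smaller factors, at the cost
  of one sign each; their number is its \<open>position\<close>.\<close>

lemma wedge_foldr_insort:
  assumes "i \<notin> set xs" "\<omega> \<in> ext_space A" "sorted xs"
  shows "wedge A (u i) (foldr (\<lambda>i. wedge A (u i)) xs \<omega>)
    = ext_scale ((-1) ^ length (filter (\<lambda>j. j < i) xs)) (foldr (\<lambda>i. wedge A (u i)) (insort i xs) \<omega>)"
  using assms(1,3)
proof (induction xs)
  case (Cons a xs)
  let ?r = "foldr (\<lambda>i. wedge A (u i)) xs \<omega>"
  have r: "?r \<in> ext_space A" by (rule foldr_wedge_closed[OF assms(2)])
  show ?case
  proof (cases "i \<le> a")
    case True
    then have "filter (\<lambda>j. j < i) (a # xs) = []" using Cons.prems by (auto simp: filter_empty_conv)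
    then show ?thesis using True by (simp only: ) simp
  next
    case False
    have IH: "wedge A (u i) ?r = ext_scale ((-1) ^ length (filter (\<lambda>j. j < i) xs))
      (foldr (\<lambda>i. wedge A (u i)) (insort i xs) \<omega>)"
      by (rule Cons.IH) (use Cons.prems in auto)
    then show ?thesis
      using False
      by (simp add: wedge_wedge[OF r, of "u i" "u a"] IH ext_linear_simps(2)[OF wedge_linear] fun_eq_iff)
  qed
qed simp

text \<open>\<open>ext_act\<close> is defined on ordered products only. The sign of
  \<open>create\<close> matches the sign of sorted insertion, which gives multiplicativity for basis
  vectors, and linearity in \<open>v\<close> extends it.\<close>

lemma ext_act_wedge:
  assumes w: "w \<in> grp A" and \<omega>: "\<omega> \<in> ext_space A"
  shows "ext_act A w (wedge A v \<omega>) = wedge A (w v) (ext_act A w \<omega>)"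
proof -
  have basis: "ext_act A w (create A i \<omega>) = wedge A (w (ybas A i)) (ext_act A w \<omega>)"
    if i: "i < rk A" for i
  proof (rule ext_linear_eqI[OF _ _ \<omega>])
    show "ext_linear (\<lambda>\<omega>. ext_act A w (create A i \<omega>))"
      "ext_linear (\<lambda>\<omega>. wedge A (w (ybas A i)) (ext_act A w \<omega>))"
      by (rule ext_linear_compose[OF ext_act_linear create_linear]
          ext_linear_compose[OF wedge_linear ext_act_linear])+
    fix I assume I: "I \<subseteq> {..<rk A}"
    then have fin: "finite I" using finite_subset by blast
    let ?f = "\<lambda>xs. foldr (\<lambda>i. wedge A (w (ybas A i))) xs (blade {})"
    have act: "ext_act A w (blade I) = ?f (sorted_list_of_set I)" if "I \<subseteq> {..<rk A}" for I
      using that by (simp add: ext_act_def lin_ext_blade)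
    have E: "blade {} \<in> ext_space A" by auto
    show "ext_act A w (create A i (blade I)) = wedge A (w (ybas A i)) (ext_act A w (blade I))"
    proof (cases "i \<in> I")
      case True
      have "wedge A (w (ybas A i)) (?f (sorted_list_of_set I)) = 0"
        by (rule wedge_foldr_mem[OF _ E]) (use True fin in auto)
      then show ?thesis
        using True by (simp add: create_blade[OF I] act[OF I] ext_linear_simps(3)[OF ext_act_linear])
    next
      case False
      have ii: "insert i I \<subseteq> {..<rk A}" using I i by auto
      have "position I i = length (filter (\<lambda>j. j < i) (sorted_list_of_set I))"
        using fin distinct_card[of "filter (\<lambda>j. j < i) (sorted_list_of_set I)"]
        by (simp add: position_def)
      moreover have "wedge A (w (ybas A i)) (?f (sorted_list_of_set I))
        = ext_scale ((-1) ^ length (filter (\<lambda>j. j < i) (sorted_list_of_set I)))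
            (?f (insort i (sorted_list_of_set I)))"
        by (rule wedge_foldr_insort[OF _ E]) (use False fin in auto)
      ultimately show ?thesis
        using False fin
        by (simp add: create_blade[OF I] act[OF I] act[OF ii] ext_linear_simps(2)[OF ext_act_linear])
    qed
  qed
  have "wedge A (w v) (ext_act A w \<omega>)
    = (\<Sum>i<rk A. ext_scale (xbas A i v) (wedge A (w (ybas A i)) (ext_act A w \<omega>)))"
    by (subst y_expand[of v]) (simp add: grp_linear[OF w] wedge_sum wedge_scale)
  then show ?thesis
    by (simp add: wedge_eq_create[of A v] ext_linear_simps[OF ext_act_linear] basis)
qed

text \<open>Both sides kill \<open>blade {}\<close> and obey the same rule past a wedge, because the
  contragredient action preserves the pairing: \<open>dual_act w \<xi>\<close> at \<open>w v\<close>
  equals \<open>\<xi> v\<close>.\<close>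

lemma ext_act_contract:
  assumes w: "w \<in> grp A" and \<xi>: "\<xi> \<in> dual A" and \<omega>: "\<omega> \<in> ext_space A"
  shows "ext_act A w (contract A \<xi> \<omega>) = contract A (dual_act w \<xi>) (ext_act A w \<omega>)"
proof (rule ext_generate_eq[OF _ _ _ _ \<omega>])
  show "ext_linear (\<lambda>\<omega>. ext_act A w (contract A \<xi> \<omega>))"
    "ext_linear (\<lambda>\<omega>. contract A (dual_act w \<xi>) (ext_act A w \<omega>))"
    by (rule ext_linear_compose[OF ext_act_linear contract_linear]
        ext_linear_compose[OF contract_linear ext_act_linear])+
  show "ext_act A w (contract A \<xi> (blade {})) = contract A (dual_act w \<xi>) (ext_act A w (blade {}))"
    by (simp add: contract_blade_empty ext_act_empty ext_linear_simps(3)[OF ext_act_linear])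
  fix i \<omega> assume \<omega>: "\<omega> \<in> ext_space A"
    and IH: "ext_act A w (contract A \<xi> \<omega>) = contract A (dual_act w \<xi>) (ext_act A w \<omega>)"
  let ?v = "ybas A i"
  show "ext_act A w (contract A \<xi> (wedge A ?v \<omega>))
    = contract A (dual_act w \<xi>) (ext_act A w (wedge A ?v \<omega>))"
    unfolding ext_act_wedge[OF w \<omega>] contract_wedge[OF \<omega> \<xi>]
      contract_wedge[OF ext_act_closed dual_act_closed[OF w \<xi>]]
    by (simp add: ext_linear_simps(2,4,5)[OF ext_act_linear] ext_act_wedge[OF w contract_closed] IH
        dual_act_apply grp_inv[OF w])
qed

lemma ext_act_comp:
  assumes "v \<in> grp A" "w \<in> grp A" "\<omega> \<in> ext_space A"
  shows "ext_act A (v \<circ> w) \<omega> = ext_act A v (ext_act A w \<omega>)"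
proof (rule ext_generate_eq[OF ext_act_linear ext_linear_compose[OF ext_act_linear ext_act_linear] _ _ assms(3)])
qed (simp_all add: ext_act_empty ext_act_wedge grp_closed assms ext_act_closed)

lemma ext_act_id: "\<omega> \<in> ext_space A \<Longrightarrow> ext_act A id \<omega> = \<omega>"
  by (rule ext_generate_eq[OF ext_act_linear ext_linear_id])
    (simp_all add: ext_act_empty ext_act_wedge grp_closed)

end

section \<open>Reflections\<close>

text \<open>The matrix determinant lemma. With \<open>M = 1 + u v\<close> and
  \<open>k = 1 + v u\<close>, the block matrices satisfy
  \<open>[1, 0; v, 1] [M, u; 0, 1] = [1, u; 0, k] [1, 0; v, 1]\<close>; all four are block
  triangular, and comparing determinants gives \<open>det M = k\<close>.\<close>

lemma det_one_plus_rank_one: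
  fixes u v :: "nat \<Rightarrow> 'a::idom"
  shows "Determinant.det (mat n n (\<lambda>(i, j). (if i = j then 1 else 0) + u i * v j)) = 1 + (\<Sum>i<n. v i * u i)"
proof -
  let ?u = "mat n 1 (\<lambda>(i, j). u i)" and ?v = "mat 1 n (\<lambda>(i, j). v j)"
  let ?M = "mat n n (\<lambda>(i, j). (if i = j then 1 else 0) + u i * v j)"
  let ?k = "1 + (\<Sum>i<n. v i * u i)"
  let ?L = "four_block_mat (1\<^sub>m n) (0\<^sub>m n 1) ?v (1\<^sub>m 1)"
  let ?K = "mat 1 1 (\<lambda>_. ?k)"
  let ?X = "four_block_mat ?M ?u (0\<^sub>m 1 n) (1\<^sub>m 1)" and ?Y = "four_block_mat (1\<^sub>m n) ?u (0\<^sub>m 1 n) ?K"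
  have c: "?u \<in> carrier_mat n 1" "?v \<in> carrier_mat 1 n" "?M \<in> carrier_mat n n" "?K \<in> carrier_mat 1 1"
    by auto
  have e: "?M = 1\<^sub>m n + ?u * ?v"
    by (rule eq_matI) (auto simp: scalar_prod_def)
  have e2: "?v * ?u + 1\<^sub>m 1 = ?K"
    by (rule eq_matI) (auto simp: scalar_prod_def lessThan_atLeast0)
  have e3: "?v * ?M = ?K * ?v"
  proof (rule eq_matI)
    fix i j assume "i < dim_row (?K * ?v)" "j < dim_col (?K * ?v)"
    then have ij: "i = 0" "j < n" by auto
    have "(?v * ?M) $$ (i, j) = (\<Sum>k<n. v k * ((if k = j then 1 else 0) + u k * v j))"
      using ij by (auto simp: scalar_prod_def lessThan_atLeast0)
    also have "\<dots> = (\<Sum>k<n. (if k = j then v k else 0) + (v k * u k) * v j)"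
      by (rule sum.cong) (auto simp: algebra_simps)
    also have "\<dots> = v j + (\<Sum>k<n. v k * u k) * v j"
      using ij by (simp add: sum.distrib sum_distrib_right)
    also have "\<dots> = (?K * ?v) $$ (i, j)"
      using ij by (auto simp: scalar_prod_def algebra_simps)
    finally show "(?v * ?M) $$ (i, j) = (?K * ?v) $$ (i, j)" .
  qed auto
  have "?L * ?X = four_block_mat (1\<^sub>m n * ?M + 0\<^sub>m n 1 * 0\<^sub>m 1 n) (1\<^sub>m n * ?u + 0\<^sub>m n 1 * 1\<^sub>m 1)
      (?v * ?M + 1\<^sub>m 1 * 0\<^sub>m 1 n) (?v * ?u + 1\<^sub>m 1 * 1\<^sub>m 1)"
    by (rule mult_four_block_mat) (use c in auto)
  also have "\<dots> = four_block_mat ?M ?u (?K * ?v) ?K"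
  proof -
    have "1\<^sub>m n * ?M + 0\<^sub>m n 1 * 0\<^sub>m 1 n = ?M" "1\<^sub>m n * ?u + 0\<^sub>m n 1 * 1\<^sub>m 1 = ?u"
      "?v * ?M + 1\<^sub>m 1 * 0\<^sub>m 1 n = ?v * ?M" "?v * ?u + 1\<^sub>m 1 * 1\<^sub>m 1 = ?v * ?u + 1\<^sub>m 1"
      using c by auto
    then show ?thesis by (simp only: e2 e3)
  qed
  also have "\<dots> = four_block_mat (1\<^sub>m n * 1\<^sub>m n + ?u * ?v) (1\<^sub>m n * 0\<^sub>m n 1 + ?u * 1\<^sub>m 1)
      (0\<^sub>m 1 n * 1\<^sub>m n + ?K * ?v) (0\<^sub>m 1 n * 0\<^sub>m n 1 + ?K * 1\<^sub>m 1)"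
  proof -
    have "1\<^sub>m n * 1\<^sub>m n + ?u * ?v = ?M" "1\<^sub>m n * 0\<^sub>m n 1 + ?u * 1\<^sub>m 1 = ?u"
      "0\<^sub>m 1 n * 1\<^sub>m n + ?K * ?v = ?K * ?v" "0\<^sub>m 1 n * 0\<^sub>m n 1 + ?K * 1\<^sub>m 1 = ?K"
      unfolding e using c by auto
    then show ?thesis by (simp only:)
  qed
  also have "\<dots> = ?Y * ?L"
    by (rule mult_four_block_mat[symmetric]) (use c in auto)
  finally have 1: "?L * ?X = ?Y * ?L" .
  have carr: "?L \<in> carrier_mat (n + 1) (n + 1)" "?X \<in> carrier_mat (n + 1) (n + 1)"
      "?Y \<in> carrier_mat (n + 1) (n + 1)"
    using c by (auto intro!: four_block_carrier_mat)
  have "Determinant.det ?L * Determinant.det ?X = Determinant.det ?Y * Determinant.det ?L"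
    using det_mult[OF carr(1,2)] det_mult[OF carr(3,1)] 1 by metis
  moreover have "Determinant.det ?L = Determinant.det (1\<^sub>m n :: 'a mat) * Determinant.det (1\<^sub>m 1 :: 'a mat)"
    by (rule det_four_block_mat_upper_right_zero) (use c in auto)
  moreover have "Determinant.det ?X = Determinant.det ?M * Determinant.det (1\<^sub>m 1 :: 'a mat)"
    by (rule det_four_block_mat_lower_left_zero) (use c in auto)
  moreover have "Determinant.det ?Y = Determinant.det (1\<^sub>m n :: 'a mat) * Determinant.det ?K"
    by (rule det_four_block_mat_lower_left_zero) (use c in auto)
  moreover have "Determinant.det ?K = ?k"
    by (subst det_single) auto
  ultimately show ?thesis by simp
qed

context rca_data
begin

lemma inner_zero_iff: "herm A v v = 0 \<longleftrightarrow> v = 0"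
proof -
  have s: "herm A (scal A a u) w = a * herm A u w" and p: "u \<noteq> 0 \<Longrightarrow> Re (herm A u u) > 0" for a u w
    using herm unfolding pos_def_hermitian_def by blast+
  have "herm A 0 0 = 0" using s[of 0 0 0] by simp
  then show ?thesis using p[of v] by (cases "v = 0") auto
qed

lemma herm_diff: "herm A (u - v) w = herm A u w - herm A v w"
proof -
  have "herm A ((u - v) + v) w = herm A (u - v) w + herm A v w"
    using herm unfolding pos_def_hermitian_def by blast
  then show ?thesis by simp
qed

lemma reflections_grp: "s \<in> reflections A \<Longrightarrow> s \<in> grp A"
  by (simp add: reflections_def)

text \<open>Upgrades vanishing of the root on the fixed hyperplane to equality of that hyperplane
  with its kernel. A kernel vector outside the hyperplane would span the whole space together with
  it, by dimension, and the root would be 0.\<close>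

lemma reflection_fixes:
  assumes s: "s \<in> reflections A" and "root A s v = 0"
  shows "s v = v"
proof (rule ccontr)
  interpret h: finite_dimensional_vector_space "scal A" "ybas A ` {..<rk A}"
    by unfold_locales (use basis_indep basis_span in auto)
  note sl = grp_linear[OF reflections_grp[OF s]]
  note rl = dual_linear[OF root(1)[OF s]]
  let ?U = "{v. s v = v}"
  assume v: "s v \<noteq> v"
  have U: "h.subspace ?U" by (rule h.subspaceI) (auto simp: sl)
  have "h.span ?U = ?U" using U by (simp only: h.span_eq_iff)
  moreover have "v \<notin> ?U" using v by simp
  ultimately have "v \<notin> h.span ?U" by (simp only: not_False_eq_True)
  then have "h.dim (insert v ?U) = h.dim ?U + 1" by (simp add: h.dim_insert)
  also have "\<dots> = rk A" using s by (simp add: reflections_def)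
  also have "\<dots> = h.dim UNIV"
    using h.dim_UNIV basis_inj by (simp add: h.dimension_def card_image)
  finally have "h.span (insert v ?U) = UNIV"
    using h.dim_eq_full by (auto simp: h.dimension_def h.dim_UNIV)
  moreover have "h.span (insert v ?U) \<subseteq> {u. root A s u = 0}"
    by (rule h.span_minimal) (use assms root(3) in \<open>auto intro!: h.subspaceI simp: rl\<close>)
  ultimately have "root A s = (\<lambda>_. 0)" by auto
  then show False using root(2)[OF s] by simp
qed

text \<open>The data only say which covectors annihilate the coroot, so the rank-one formula for
  \<open>s\<close> has to be derived. The image of \<open>s - 1\<close> is a line; the invariant
  Hermitian form serves to show that the coroot spans it and that the root does not vanish on
  it.\<close>

lemma reflection_form:
  assumes s: "s \<in> reflections A"
  obtains \<kappa> where "\<And>v. s v = v + scal A (\<kappa> * root A s v) (coroot A s)" "root A s (coroot A s) \<noteq> 0"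
    "det_h A s = 1 + \<kappa> * root A s (coroot A s)" "det_h A s \<noteq> 0"
proof -
  have sg: "s \<in> grp A" by (rule reflections_grp[OF s])
  note sl = grp_linear[OF sg]
  note rl = dual_linear[OF root(1)[OF s]]
  obtain v0 where v0: "root A s v0 \<noteq> 0" using root(2)[OF s] by auto
  \<comment> \<open>\<open>s\<close> fixes the kernel of the root, so \<open>s v - v\<close> depends
    on \<open>v\<close> only through \<open>root A s v\<close>; dividing by the value at
    \<open>v0\<close> normalises it.\<close>
  define \<beta> where "\<beta> = scal A (1 / root A s v0) (s v0 - v0)"
  have sb: "s v = v + scal A (root A s v) \<beta>" for v
  proof -
    let ?u = "v - scal A (root A s v / root A s v0) v0"
    have "s ?u = ?u" by (rule reflection_fixes[OF s]) (use v0 in \<open>simp add: rl\<close>)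
    then have "s v = v + (scal A (root A s v / root A s v0) (s v0) - scal A (root A s v / root A s v0) v0)"
      by (simp add: sl algebra_simps)
    then show ?thesis by (simp add: \<beta>_def h.scale_right_diff_distrib)
  qed
  have hl: "herm A (u + v) w = herm A u w + herm A v w" "herm A (scal A a u) w = a * herm A u w" for u v w a
    using herm unfolding pos_def_hermitian_def by blast+
  \<comment> \<open>A unitary \<open>s\<close> moves \<open>v0\<close> in a direction orthogonal to
    its fixed vectors. Were the root to vanish at \<beta>, then \<beta> would be orthogonal to
    itself.\<close>
  have orth: "herm A \<beta> u = 0" if u: "root A s u = 0" for u
  proof -
    have "herm A (s v0 - v0) u = herm A (s v0) (s u) - herm A v0 u"
      using reflection_fixes[OF s u] by (simp add: herm_diff)
    also have "\<dots> = 0" by (simp add: herm_invariant[OF sg])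
    finally show ?thesis by (simp add: \<beta>_def hl)
  qed
  obtain k where k: "coroot A s = scal A k \<beta>"
  proof (cases "\<beta> = 0")
    case True
    then have "s = id" using sb by auto
    then have "coroot A s = 0"
    proof -
      have "xbas A i (coroot A s) = 0" if "i < rk A" for i
        by (rule coroot(2)[OF s dual_basis(1)[OF that]]) (simp add: dual_act_def \<open>s = id\<close>)
      then show ?thesis by (intro xbas_eqI) (simp add: dual_linear[OF dual_basis(1)])
    qed
    then show ?thesis using coroot(1)[OF s] by simp
  next
    case False
    define B where "B = herm A \<beta> \<beta>"
    have B: "B \<noteq> 0" using False by (simp add: B_def inner_zero_iff)
    let ?g = "herm A (coroot A s) \<beta> / B"
    have "xbas A i (coroot A s) = xbas A i (scal A ?g \<beta>)" if i: "i < rk A" for i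
    proof -
      \<comment> \<open>\<open>xbas A i\<close> corrected by the Hermitian projection to the line of
        \<beta>. The result vanishes at \<beta>, is therefore fixed by \<open>s\<close>, and so
        annihilates the coroot. For all \<open>i\<close> together this says that the coroot equals
        its projection to that line.\<close>
      define \<xi> where "\<xi> v = xbas A i v - xbas A i \<beta> * herm A v \<beta> / B" for v
      have \<xi>: "\<xi> \<in> dual A"
        by (rule dualI) (simp_all add: \<xi>_def dual_linear[OF dual_basis(1)[OF i]] hl field_simps add_divide_distrib)
      have "\<xi> \<beta> = 0" using B by (simp add: \<xi>_def B_def)
      then have "\<xi> (s v) = \<xi> v" for v unfolding sb[of v] by (simp add: dual_linear[OF \<xi>])
      then have "dual_act s \<xi> = \<xi>"
        using grp_inv(1)[OF sg] by (auto simp: dual_act_apply fun_eq_iff) metis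
      then have "\<xi> (coroot A s) = 0" by (rule coroot(2)[OF s \<xi>])
      then show ?thesis
        by (simp add: \<xi>_def dual_linear[OF dual_basis(1)[OF i]] mult.commute)
    qed
    then have "coroot A s = scal A ?g \<beta>" by (rule xbas_eqI)
    then show ?thesis by (rule that)
  qed
  have k0: "k \<noteq> 0" and b0: "\<beta> \<noteq> 0" using k coroot(1)[OF s] by auto
  have rb: "root A s \<beta> \<noteq> 0" using orth[of \<beta>] b0 inner_zero_iff by auto
  have form: "s v = v + scal A (1 / k * root A s v) (coroot A s)" for v
    using sb[of v] k0 by (simp add: k)
  have "det_h A s = Determinant.det (mat (rk A) (rk A)
      (\<lambda>(i, j). (if i = j then 1 else 0) + xbas A i (coroot A s) * (1 / k * root A s (ybas A j))))"
    unfolding det_h_def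
    by (rule arg_cong[where f = Determinant.det], rule cong_mat)
      (auto simp: form dual_linear[OF dual_basis(1)] dual_basis(2))
  also have "\<dots> = 1 + (\<Sum>i<rk A. (1 / k * root A s (ybas A i)) * xbas A i (coroot A s))"
    by (rule det_one_plus_rank_one)
  also have "\<dots> = 1 + 1 / k * root A s (coroot A s)"
    by (subst dual_expand[OF root(1)[OF s], of "coroot A s"]) (simp add: sum_distrib_left mult_ac)
  finally have det: "det_h A s = 1 + 1 / k * root A s (coroot A s)" .
  \<comment> \<open>The determinant is the eigenvalue of \<open>s\<close> at the coroot, so
    injectivity of \<open>s\<close> makes it nonzero.\<close>
  have "s (coroot A s) = scal A (det_h A s) (coroot A s)"
    unfolding form[of "coroot A s"] det by (simp add: h.scale_left_distrib)
  moreover have "s (coroot A s) \<noteq> 0"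
    using grp_inv(2)[OF sg, of "coroot A s"] grp_inv(2)[OF sg, of 0] coroot(1)[OF s] sl(3) by metis
  ultimately have "det_h A s \<noteq> 0" by auto
  then show ?thesis using that[OF form _ det] k k0 rb by (auto simp: rl)
qed

end

text \<open>As simp rules, the pointwise laws turn sums of functions into abstractions, and the facts about
  linear operators no longer apply to them.\<close>

lemmas pointwise = fun_eq_iff ext_scale_apply plus_fun_apply zero_fun_apply minus_apply uminus_apply
declare ext_scale_apply [simp del] plus_fun_apply [simp del] zero_fun_apply [simp del]
  minus_apply [simp del] uminus_apply [simp del]

section \<open>The Clifford algebra and the spinor module\<close>

lemma spin_free_superset:
  assumes "finite K" "Poly_Mapping.keys f \<subseteq> K"
  shows "spin_free A f \<omega> J = (\<Sum>w\<in>K. Poly_Mapping.lookup f w * foldr (spin_gen A) w \<omega> J)"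
  unfolding spin_free_def by (rule sum.mono_neutral_left) (use assms in \<open>auto simp: in_keys_iff\<close>)

lemma spin_free_add: "spin_free A (f + g) \<omega> = spin_free A f \<omega> + spin_free A g \<omega>"
proof
  fix J
  let ?K = "Poly_Mapping.keys f \<union> Poly_Mapping.keys g"
  have "finite ?K" "Poly_Mapping.keys (f + g) \<subseteq> ?K" by (auto dest: subsetD[OF keys_add])
  then show "spin_free A (f + g) \<omega> J = (spin_free A f \<omega> + spin_free A g \<omega>) J"
    by (simp add: spin_free_superset[where K = ?K] lookup_add pointwise(3) algebra_simps sum.distrib)
qed

lemma spin_free_diff: "spin_free A (f - g) \<omega> = spin_free A f \<omega> - spin_free A g \<omega>"
  using spin_free_add[of A "f - g" g \<omega>] by (simp add: eq_diff_eq)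

lemma spin_free_zero: "spin_free A 0 \<omega> = 0"
  using spin_free_diff[of A 0 0 \<omega>] by simp

lemma spin_free_single:
  "spin_free A (Poly_Mapping.single w a) \<omega> = ext_scale a (foldr (spin_gen A) w \<omega>)"
  by (auto simp: pointwise spin_free_superset[where K = "{w}"])

lemma spin_free_scalar: "spin_free A (scalar a) \<omega> = ext_scale a \<omega>"
  by (simp add: scalar_def spin_free_single)

lemma spin_free_one: "spin_free A 1 \<omega> = \<omega>"
  using spin_free_scalar[of A 1 \<omega>] by (simp add: scalar_simps)

lemma spin_free_letter: "spin_free A (letter g) \<omega> = spin_gen A g \<omega>"
  by (simp add: letter_def spin_free_single)

lemma spin_gen_linear: "ext_linear (spin_gen A g)"
proof (cases g)
  case (Cov \<xi>)
  have "spin_gen A (Cov \<xi>) = (\<lambda>\<omega>. ext_scale 2 (contract A \<xi> \<omega>))" by (simp add: ext_scale_def)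
  then show ?thesis using Cov ext_linear_scale[OF contract_linear] by metis
qed (simp_all add: wedge_linear ext_linear_id[folded id_def])

lemma spin_word_linear: "ext_linear (foldr (spin_gen A) w)"
proof (induction w)
  case (Cons g w)
  then show ?case using ext_linear_compose[OF spin_gen_linear Cons, of A g] by (simp add: comp_def)
qed (simp add: id_def ext_linear_id)

lemma spin_gen_closed: "\<omega> \<in> ext_space A \<Longrightarrow> spin_gen A g \<omega> \<in> ext_space A"
  using ext_space_closed(3)[OF contract_closed, of 2] by (cases g) (auto simp: wedge_closed ext_scale_def)

lemma spin_word_closed: "\<omega> \<in> ext_space A \<Longrightarrow> foldr (spin_gen A) w \<omega> \<in> ext_space A"
  by (induction w) (auto intro: spin_gen_closed)

lemma spin_free_eq_sum: "spin_free A f = (\<lambda>\<omega>. \<Sum>w\<in>Poly_Mapping.keys f.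
    ext_scale (Poly_Mapping.lookup f w) (foldr (spin_gen A) w \<omega>))"
  by (auto simp: pointwise spin_free_def sum_fun_apply)

lemma spin_free_linear: "ext_linear (spin_free A f)"
  unfolding spin_free_eq_sum by (rule ext_linear_sum, rule ext_linear_scale, rule spin_word_linear)

lemma spin_free_closed: "\<omega> \<in> ext_space A \<Longrightarrow> spin_free A f \<omega> \<in> ext_space A"
  unfolding spin_free_eq_sum by (rule ext_space_sum, rule ext_space_closed, rule spin_word_closed)

lemma spin_free_mult: "spin_free A (f * g) \<omega> = spin_free A f (spin_free A g \<omega>)"
proof (induction f rule: poly_mapping_additive_induct)
  case (1 w a)
  show ?case
  proof (induction g rule: poly_mapping_additive_induct)
    case (1 v b)
    show ?case
      by (simp add: mult_single spin_free_single plus_list_def ext_linear_simps(2)[OF spin_word_linear])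
  next
    case (2 f g)
    then show ?case
      by (simp add: spin_free_add distrib_left ext_linear_simps(1)[OF spin_free_linear])
  qed
next
  case (2 f g)
  then show ?case by (simp add: spin_free_add distrib_right)
qed

context rca_data
begin

lemma V_gens_iff [simp]: "Vec v \<in> V_gens A" "Cov \<xi> \<in> V_gens A \<longleftrightarrow> \<xi> \<in> dual A" "Grp w \<notin> V_gens A"
  by (auto simp: V_gens_def)

lemma dual_closed: "\<xi> \<in> dual A \<Longrightarrow> \<eta> \<in> dual A \<Longrightarrow> (\<lambda>v. \<xi> v + \<eta> v) \<in> dual A"
  "\<xi> \<in> dual A \<Longrightarrow> (\<lambda>v. a * \<xi> v) \<in> dual A"
  by (auto intro!: dualI simp: dual_linear algebra_simps)

lemma letter_closed: "V_gens A \<subseteq> X \<Longrightarrow> lv v \<in> carrier (free_algebra X)"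
  "V_gens A \<subseteq> X \<Longrightarrow> \<xi> \<in> dual A \<Longrightarrow> lc \<xi> \<in> carrier (free_algebra X)"
  by (auto simp: subset_iff)

lemma tensor_rels_closed: "V_gens A \<subseteq> X \<Longrightarrow> tensor_rels A \<subseteq> carrier (free_algebra X)"
  unfolding tensor_rels_def
  by (auto intro!: free_algebra_closed(3,5-8) letter_closed dual_closed)

lemma cliff_rels_closed: "cliff_rels A \<subseteq> carrier (free_algebra (V_gens A))"
  using tensor_rels_closed[OF subset_refl] unfolding cliff_rels_def
  by (auto intro!: free_algebra_closed(3,5-8) letter_closed dual_basis)

end

sublocale rca_data \<subseteq> cl: presentation "V_gens A" "cliff_rels A"
  by unfold_locales (rule cliff_rels_closed)

context rca_data
begin

lemma cliff_eq: "cliff A = cl.Q" "cliff_class A = cl.cl"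
  by (simp_all add: cliff_def cliff_class_def)

lemma spin_lv: "spin_free A (lv v) \<omega> = wedge A v \<omega>"
  and spin_lc: "spin_free A (lc \<xi>) \<omega> = ext_scale 2 (contract A \<xi> \<omega>)"
  by (simp_all add: spin_free_letter ext_scale_def)

text \<open>The seven kinds of relations reduce to linearity of wedge and contraction in the vector
  or covector, to their anticommutation, and to \<open>contract_wedge\<close>. This lets the spinor
  action descend to the Clifford algebra.\<close>

lemma spin_rel_zero:
  assumes "r \<in> cliff_rels A" "\<omega> \<in> ext_space A"
  shows "spin_free A r \<omega> = 0"
proof -
  have ca: "contract A (\<lambda>v. \<xi> v + \<eta> v) \<omega> = contract A \<xi> \<omega> + contract A \<eta> \<omega>"
    "contract A (\<lambda>v. a * \<xi> v) \<omega> = ext_scale a (contract A \<xi> \<omega>)" for \<xi> \<eta> a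
    by (simp_all add: contract_eq_annihilate ext_vs.scale_left_distrib sum.distrib ext_vs.scale_sum_right)
  have cc: "contract A \<xi> (contract A \<eta> \<omega>) + contract A \<eta> (contract A \<xi> \<omega>) = 0" for \<xi> \<eta>
    using contract_contract[OF assms(2), of \<xi> \<eta>] by simp
  have ww: "wedge A u (wedge A v \<omega>) + wedge A v (wedge A u \<omega>) = 0" for u v
    using wedge_wedge[OF assms(2), of u v] by simp
  note simps = spin_free_diff spin_free_add spin_free_mult spin_lv spin_lc spin_free_scalar
    ext_linear_simps(2)[OF contract_linear] ext_linear_simps(2)[OF wedge_linear]
  from assms(1) consider
      u v where "r = lv (u + v) - lv u - lv v"
    | a v where "r = lv (scal A a v) - scalar a * lv v"
    | \<xi> \<eta> where "r = lc (\<lambda>v. \<xi> v + \<eta> v) - lc \<xi> - lc \<eta>"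
    | a \<xi> where "r = lc (\<lambda>v. a * \<xi> v) - scalar a * lc \<xi>"
    | i j where "r = lc (xbas A i) * lc (xbas A j) + lc (xbas A j) * lc (xbas A i)"
    | i j where "r = lv (ybas A i) * lv (ybas A j) + lv (ybas A j) * lv (ybas A i)"
    | i j where "i < rk A" "j < rk A"
        "r = lc (xbas A i) * lv (ybas A j) + lv (ybas A j) * lc (xbas A i) - scalar (if i = j then -2 else 0)"
    unfolding cliff_rels_def tensor_rels_def by blast
  then show ?thesis
  proof cases
    case 5
    have "spin_free A r \<omega> = ext_scale 4 (contract A (xbas A i) (contract A (xbas A j) \<omega>)
        + contract A (xbas A j) (contract A (xbas A i) \<omega>))"
      by (simp add: 5 simps pointwise)
    then show ?thesis by (simp add: cc)
  next
    case 7
    then show ?thesis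
      by (auto simp: simps contract_wedge[OF assms(2) dual_basis(1)] dual_basis pointwise)
  qed (simp_all add: simps wedge_add wedge_scale ca ww ext_vs.scale_right_distrib pointwise)
qed

text \<open>The elements that annihilate \<open>ext_space A\<close> form a two-sided ideal, closed
  under multiplication on the right because every word preserves \<open>ext_space A\<close>.
  Minimality of the generated ideal does the rest.\<close>

lemma spin_J_zero:
  assumes "f \<in> cl.J" "\<omega> \<in> ext_space A"
  shows "spin_free A f \<omega> = 0"
proof -
  let ?K = "{f \<in> carrier cl.F. \<forall>\<omega>\<in>ext_space A. spin_free A f \<omega> = 0}"
  have neg: "spin_free A (- f) \<omega> = - spin_free A f \<omega>" for f \<omega>
    using spin_free_diff[of A 0 f \<omega>] by (simp add: spin_free_zero)
  have "ideal ?K cl.F"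
  proof (rule idealI[OF ring_free_algebra])
    show "subgroup ?K (add_monoid cl.F)"
    proof (rule cl.F.add.subgroupI)
      fix a assume "a \<in> ?K"
      then show "\<ominus>\<^bsub>cl.F\<^esub> a \<in> ?K" by (simp add: cl.minus_eq_diff neg free_algebra_closed)
    qed (auto simp: spin_free_add intro!: exI[of _ 0] simp: spin_free_zero)
  qed (auto simp: spin_free_mult spin_free_closed ext_linear_simps(3)[OF spin_free_linear])
  then have "cl.J \<subseteq> ?K"
    by (rule cl.J_minimal) (use cliff_rels_closed spin_rel_zero in auto)
  then show ?thesis using assms by auto
qed

text \<open>Restriction to \<open>ext_space A\<close> is needed: outside it, letters vanish but scalars do not.\<close>

lemma spin_class:
  assumes "\<omega> \<in> ext_space A"
  shows "spin A (cliff_class A f) \<omega> = spin_free A f \<omega>"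
proof -
  have "f \<in> cliff_class A f" by (simp add: cliff_eq cl.in_cl_iff cl.J_closed)
  then have "(SOME f'. f' \<in> cliff_class A f) \<in> cliff_class A f" by (rule someI)
  then have "(SOME f'. f' \<in> cliff_class A f) - f \<in> cl.J" by (simp add: cliff_eq cl.in_cl_iff)
  from spin_J_zero[OF this assms] show ?thesis by (simp add: spin_def spin_free_diff)
qed

lemma spin_mult:
  assumes "g \<in> carrier (cliff A)" "h \<in> carrier (cliff A)" "\<omega> \<in> ext_space A"
  shows "spin A (g \<otimes>\<^bsub>cliff A\<^esub> h) \<omega> = spin A g (spin A h \<omega>)"
proof -
  from assms(1) obtain f where f: "f \<in> carrier cl.F" "g = cl.cl f"
    unfolding cliff_eq by (rule cl.Q_carrierE)
  from assms(2) obtain f' where f': "f' \<in> carrier cl.F" "h = cl.cl f'"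
    unfolding cliff_eq by (rule cl.Q_carrierE)
  have "spin A (cl.cl (f * f')) \<omega> = spin A (cl.cl f) (spin A (cl.cl f') \<omega>)"
    by (simp add: spin_class[unfolded cliff_eq] assms(3) spin_free_closed spin_free_mult)
  then show ?thesis by (simp add: f f' cliff_eq cl.cl_mult)
qed

lemma spin_one: "\<omega> \<in> ext_space A \<Longrightarrow> spin A \<one>\<^bsub>cliff A\<^esub> \<omega> = \<omega>"
  using spin_class[of \<omega> 1] by (simp add: cliff_eq cl.cl_one spin_free_one)

section \<open>Clifford relations for arbitrary vectors and covectors, modulo the ideal\<close>

lemma tensor_relsI:
  "lv (u + v) - lv u - lv v \<in> tensor_rels A"
  "lv (scal A a v) - scalar a * lv v \<in> tensor_rels A"
  "\<xi> \<in> dual A \<Longrightarrow> \<eta> \<in> dual A \<Longrightarrow> lc (\<lambda>v. \<xi> v + \<eta> v) - lc \<xi> - lc \<eta> \<in> tensor_rels A"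
  "\<xi> \<in> dual A \<Longrightarrow> lc (\<lambda>v. a * \<xi> v) - scalar a * lc \<xi> \<in> tensor_rels A"
  unfolding tensor_rels_def by (fastforce, fastforce, blast, blast)

lemma cliff_relsI:
  "i < rk A \<Longrightarrow> j < rk A \<Longrightarrow> lc (xbas A i) * lc (xbas A j) + lc (xbas A j) * lc (xbas A i) \<in> cliff_rels A"
  "i < rk A \<Longrightarrow> j < rk A \<Longrightarrow> lv (ybas A i) * lv (ybas A j) + lv (ybas A j) * lv (ybas A i) \<in> cliff_rels A"
  "i < rk A \<Longrightarrow> j < rk A \<Longrightarrow> lc (xbas A i) * lv (ybas A j) + lv (ybas A j) * lc (xbas A i) -
     scalar (if i = j then -2 else 0) \<in> cliff_rels A"
  unfolding cliff_rels_def by blast+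

text \<open>The Clifford relations are imposed on basis elements while \<open>mu_rep\<close>
  involves roots and coroots, so letters are expanded in basis letters modulo \<open>J\<close>. The
  induction carries membership in \<open>dual A\<close> along because additivity of letters is a
  relation only there.\<close>

lemma lc_expand:
  assumes "\<xi> \<in> dual A"
  shows "lc \<xi> - (\<Sum>i<rk A. scalar (\<xi> (ybas A i)) * lc (xbas A i)) \<in> cl.J"
proof -
  have rel: "f \<in> cl.J" if "f \<in> tensor_rels A" for f
    using that by (intro cl.rel_in_J) (simp add: cliff_rels_def)
  have "m \<le> rk A \<Longrightarrow> (\<lambda>v. \<Sum>i<m. \<xi> (ybas A i) * xbas A i v) \<in> dual A \<and>
    lc (\<lambda>v. \<Sum>i<m. \<xi> (ybas A i) * xbas A i v) - (\<Sum>i<m. scalar (\<xi> (ybas A i)) * lc (xbas A i)) \<in> cl.J" for m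
  proof (induction m)
    case 0
    \<comment> \<open>The letter of the zero covector is not literally 0 in the free algebra; it
      lies in \<open>J\<close> by the homogeneity relation with scalar 0.\<close>
    have "(\<lambda>v. 0 * \<xi> v) \<in> dual A" by (rule dual_closed(2)[OF assms])
    moreover have "lc (\<lambda>v. 0 * \<xi> v) - scalar 0 * lc \<xi> \<in> cl.J"
      by (rule rel, rule tensor_relsI(4)[OF assms])
    ultimately show ?case by (simp add: scalar_simps)
  next
    case (Suc m)
    let ?\<eta> = "\<lambda>v. \<Sum>i<m. \<xi> (ybas A i) * xbas A i v" and ?\<zeta> = "\<lambda>v. \<xi> (ybas A m) * xbas A m v"
    have x: "xbas A m \<in> dual A" by (rule dual_basis(1)) (use Suc.prems in simp)
    have \<eta>: "?\<eta> \<in> dual A" and J: "lc ?\<eta> - (\<Sum>i<m. scalar (\<xi> (ybas A i)) * lc (xbas A i)) \<in> cl.J"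
      using Suc by auto
    have \<zeta>: "?\<zeta> \<in> dual A" by (rule dual_closed(2)[OF x])
    have "lc (\<lambda>v. ?\<eta> v + ?\<zeta> v) - lc ?\<eta> - lc ?\<zeta> \<in> cl.J"
      by (rule rel, rule tensor_relsI(3)[OF \<eta> \<zeta>])
    moreover have "lc ?\<zeta> - scalar (\<xi> (ybas A m)) * lc (xbas A m) \<in> cl.J"
      by (rule rel, rule tensor_relsI(4)[OF x])
    ultimately have "(lc (\<lambda>v. ?\<eta> v + ?\<zeta> v) - lc ?\<eta> - lc ?\<zeta>)
        + (lc ?\<zeta> - scalar (\<xi> (ybas A m)) * lc (xbas A m))
        + (lc ?\<eta> - (\<Sum>i<m. scalar (\<xi> (ybas A i)) * lc (xbas A i))) \<in> cl.J"
      using J by (intro cl.J_closed(2))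
    moreover have "(\<lambda>v. ?\<eta> v + ?\<zeta> v) \<in> dual A" by (rule dual_closed(1)[OF \<eta> \<zeta>])
    \<comment> \<open>Telescoping: the three members of \<open>J\<close> add up to the difference
      wanted for one more summand.\<close>
    moreover have "(c - a - b) + (b - d) + (a - e) = c - (e + d)" for a b c d e :: "'h falg"
      by simp
    ultimately show ?case by (simp only: sum.lessThan_Suc simp_thms)
  qed
  from this[of "rk A"] have "lc (\<lambda>v. \<Sum>i<rk A. \<xi> (ybas A i) * xbas A i v)
      - (\<Sum>i<rk A. scalar (\<xi> (ybas A i)) * lc (xbas A i)) \<in> cl.J" by simp
  moreover have "(\<lambda>v. \<Sum>i<rk A. \<xi> (ybas A i) * xbas A i v) = \<xi>"
    by (rule ext, rule trans[OF _ dual_expand[OF assms, symmetric]]) (simp only: mult.commute)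
  ultimately show ?thesis by simp
qed

lemma lv_expand: "lv v - (\<Sum>i<rk A. scalar (xbas A i v) * lv (ybas A i)) \<in> cl.J"
proof -
  have rel: "f \<in> cl.J" if "f \<in> tensor_rels A" for f
    using that by (intro cl.rel_in_J) (simp add: cliff_rels_def)
  have "lv (\<Sum>i<m. scal A (xbas A i v) (ybas A i)) - (\<Sum>i<m. scalar (xbas A i v) * lv (ybas A i)) \<in> cl.J" for m
  proof (induction m)
    case 0
    have "lv (scal A 0 v) - scalar 0 * lv v \<in> cl.J"
      by (rule rel, rule tensor_relsI(2))
    then show ?case by (simp add: scalar_simps)
  next
    case (Suc m)
    let ?u = "\<Sum>i<m. scal A (xbas A i v) (ybas A i)" and ?w = "scal A (xbas A m v) (ybas A m)"
    have "lv (?u + ?w) - lv ?u - lv ?w \<in> cl.J" "lv ?w - scalar (xbas A m v) * lv (ybas A m) \<in> cl.J"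
      by (rule rel, rule tensor_relsI)+
    then have "(lv (?u + ?w) - lv ?u - lv ?w) + (lv ?w - scalar (xbas A m v) * lv (ybas A m))
        + (lv ?u - (\<Sum>i<m. scalar (xbas A i v) * lv (ybas A i))) \<in> cl.J"
      using Suc by (intro cl.J_closed(2))
    moreover have "(c - a - b) + (b - d) + (a - e) = c - (e + d)" for a b c d e :: "'h falg"
      by simp
    ultimately show ?case by (simp only: sum.lessThan_Suc)
  qed
  from this[of "rk A"] show ?thesis by (simp only: y_expand[of v, symmetric])
qed

lemma J_mult_cong:
  assumes "f - f' \<in> cl.J" "g - g' \<in> cl.J" "f' \<in> carrier cl.F" "g \<in> carrier cl.F"
  shows "f * g - f' * g' \<in> cl.J"
proof -
  have "(f - f') * g + f' * (g - g') \<in> cl.J"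
    using assms by (intro cl.J_closed(2,5,6))
  then show ?thesis by (simp add: algebra_simps)
qed

lemma scalar_mult_swap:
  fixes f g :: "'c list \<Rightarrow>\<^sub>0 complex"
  shows "(scalar a * f) * (scalar b * g) = scalar (a * b) * (f * g)"
proof -
  have "f * (scalar b * g) = scalar b * (f * g)"
    by (simp only: mult.assoc[symmetric] scalar_central)
  then show ?thesis by (simp only: mult.assoc[where 'a = "'c list \<Rightarrow>\<^sub>0 complex"] scalar_simps(2))
qed

text \<open>Anticommutators are bilinear, so constants \<open>r i j\<close> on the bases determine
  the constant for combinations. Replacing \<open>u\<close> and \<open>v\<close> by their expansions
  costs only elements of \<open>J\<close>.\<close>

lemma bilinear_relation:
  fixes f g :: "nat \<Rightarrow> 'h falg"
  assumes f: "\<And>i. i < rk A \<Longrightarrow> f i \<in> carrier cl.F" and g: "\<And>i. i < rk A \<Longrightarrow> g i \<in> carrier cl.F"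
    and u: "u - (\<Sum>i<rk A. scalar (a i) * f i) \<in> cl.J" and v: "v - (\<Sum>i<rk A. scalar (b i) * g i) \<in> cl.J"
    and uv: "u \<in> carrier cl.F" "v \<in> carrier cl.F"
    and rel: "\<And>i j. i < rk A \<Longrightarrow> j < rk A \<Longrightarrow> f i * g j + g j * f i - scalar (r i j) \<in> cl.J"
  shows "u * v + v * u - scalar (\<Sum>i<rk A. \<Sum>j<rk A. a i * b j * r i j) \<in> cl.J"
proof -
  let ?f = "\<Sum>i<rk A. scalar (a i) * f i" and ?g = "\<Sum>i<rk A. scalar (b i) * g i"
  have c: "?f \<in> carrier cl.F" "?g \<in> carrier cl.F"
    using f g by (auto intro!: free_algebra_sum_closed free_algebra_closed)
  have 1: "u * v - ?f * ?g \<in> cl.J" "v * u - ?g * ?f \<in> cl.J"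
    using J_mult_cong[OF u v c(1) uv(2)] J_mult_cong[OF v u c(2) uv(1)] by auto
  have s: "scalar (sum h I) = (\<Sum>i\<in>I. scalar (h i))" for h :: "nat \<Rightarrow> complex" and I
    by (induction I rule: infinite_finite_induct) (auto simp: scalar_simps)
  have "?f * ?g + ?g * ?f - scalar (\<Sum>i<rk A. \<Sum>j<rk A. a i * b j * r i j)
    = (\<Sum>i<rk A. \<Sum>j<rk A. scalar (a i * b j) * (f i * g j + g j * f i - scalar (r i j)))"
  proof -
    have fg: "?f * ?g = (\<Sum>i<rk A. \<Sum>j<rk A. scalar (a i * b j) * (f i * g j))"
      by (simp add: sum_product scalar_mult_swap)
    have gf: "?g * ?f = (\<Sum>i<rk A. \<Sum>j<rk A. scalar (a i * b j) * (g j * f i))"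
      by (subst sum.swap) (simp add: sum_product scalar_mult_swap mult.commute[of "b _"])
    show ?thesis
      unfolding fg gf s
      by (simp add: distrib_left right_diff_distrib sum.distrib sum_subtractf scalar_simps(2) mult.assoc)
  qed
  also have "\<dots> \<in> cl.J"
    by (intro cl.J_sum cl.J_closed(5) rel) auto
  finally have "(u * v - ?f * ?g) + (v * u - ?g * ?f)
      + (?f * ?g + ?g * ?f - scalar (\<Sum>i<rk A. \<Sum>j<rk A. a i * b j * r i j)) \<in> cl.J"
    using 1 by (intro cl.J_closed(2))
  then show ?thesis by (simp add: algebra_simps)
qed

text \<open>For a vector anticommuting with itself the relations put twice its square in the ideal;
  multiplying by the scalar 1/2 yields the square.\<close>

lemma J_half: "f + f \<in> cl.J \<Longrightarrow> f \<in> cl.J"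
proof -
  assume "f + f \<in> cl.J"
  then have "scalar (1/2) * (f + f) \<in> cl.J" by (intro cl.J_closed(5)) auto
  moreover have "scalar (1/2) * (f + f) = (scalar (1/2) + scalar (1/2)) * f" by (simp add: algebra_simps)
  ultimately show ?thesis by (simp add: scalar_simps flip: scalar_simps(1))
qed

lemma clifford_relations:
  assumes \<xi>: "\<xi> \<in> dual A"
  shows "lc \<xi> * lc \<xi> \<in> cl.J" "lv v * lv v \<in> cl.J" "lc \<xi> * lv v + lv v * lc \<xi> + scalar (2 * \<xi> v) \<in> cl.J"
proof -
  have c: "lv v \<in> carrier cl.F" "i < rk A \<Longrightarrow> lc (xbas A i) \<in> carrier cl.F" for v i
    by (auto simp: dual_basis)
  have c': "lc \<xi> \<in> carrier cl.F" using \<xi> by auto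
  have rel: "f \<in> cl.J" if "f \<in> cliff_rels A" for f
    using that by (rule cl.rel_in_J)
  have z: "(\<Sum>i<rk A. \<Sum>j<rk A. f i * g j * (0::complex)) = 0" for f g :: "nat \<Rightarrow> complex"
    by simp
  have r1: "lc (xbas A i) * lc (xbas A j) + lc (xbas A j) * lc (xbas A i) - scalar 0 \<in> cl.J"
    and r2: "lv (ybas A i) * lv (ybas A j) + lv (ybas A j) * lv (ybas A i) - scalar 0 \<in> cl.J"
    if "i < rk A" "j < rk A" for i j
    unfolding scalar_simps(5) diff_zero by (rule rel, rule cliff_relsI, (rule that)+)+
  have "lc \<xi> * lc \<xi> + lc \<xi> * lc \<xi> - scalar 0 \<in> cl.J"
    using bilinear_relation[where r = "\<lambda>_ _. 0", OF c(2) c(2) lc_expand[OF \<xi>] lc_expand[OF \<xi>] c' c' r1]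
    by (simp only: z)
  then show "lc \<xi> * lc \<xi> \<in> cl.J" 
    unfolding scalar_simps(5) diff_zero by (rule J_half)
  have "lv v * lv v + lv v * lv v - scalar 0 \<in> cl.J"
    using bilinear_relation[where r = "\<lambda>_ _. 0", OF c(1) c(1) lv_expand[of v] lv_expand[of v] c(1) c(1) r2]
    by (simp only: z)
  then show "lv v * lv v \<in> cl.J" 
    unfolding scalar_simps(5) diff_zero by (rule J_half)
  have "lc \<xi> * lv v + lv v * lc \<xi>
      - scalar (\<Sum>i<rk A. \<Sum>j<rk A. \<xi> (ybas A i) * xbas A j v * (if i = j then -2 else 0)) \<in> cl.J"
    by (rule bilinear_relation[OF c(2) c(1) lc_expand[OF \<xi>] lv_expand c' c(1)])
      (assumption, rule rel, rule cliff_relsI)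
  moreover have "(\<Sum>i<rk A. \<Sum>j<rk A. \<xi> (ybas A i) * xbas A j v * (if i = j then -2 else 0)) = - (2 * \<xi> v)"
  proof -
    have "(\<Sum>i<rk A. \<Sum>j<rk A. \<xi> (ybas A i) * xbas A j v * (if i = j then -2 else 0))
      = (\<Sum>i<rk A. \<Sum>j<rk A. if i = j then -2 * (xbas A i v * \<xi> (ybas A i)) else 0)"
      by (intro sum.cong refl) simp
    then show ?thesis
      by (subst dual_expand[OF \<xi>, of v]) (simp add: sum_distrib_left sum_negf)
  qed
  ultimately show "lc \<xi> * lv v + lv v * lc \<xi> + scalar (2 * \<xi> v) \<in> cl.J"
    by (simp add: scalar_simps)
qed

text \<open>Multiply the mixed relation by \<xi> on the left and by \<open>v\<close> on the right
  and discard the product of the two squares, which lies in \<open>J\<close>. This quadratic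
  equation is what makes \<open>mu A s\<close> invertible.\<close>

lemma lc_lv_square:
  assumes \<xi>: "\<xi> \<in> dual A"
  shows "(lc \<xi> * lv v) * (lc \<xi> * lv v) + scalar (2 * \<xi> v) * (lc \<xi> * lv v) \<in> cl.J"
proof -
  note J = clifford_relations(1)[OF \<xi>] clifford_relations(2,3)[OF \<xi>, of v]
  have c: "lv v \<in> carrier cl.F" "lc \<xi> \<in> carrier cl.F" using \<xi> by auto
  have "lc \<xi> * (lc \<xi> * lv v + lv v * lc \<xi> + scalar (2 * \<xi> v)) * lv v
      - (lc \<xi> * lc \<xi>) * (lv v * lv v) \<in> cl.J"
    by (rule cl.J_closed(4)[OF cl.J_closed(6)[OF cl.J_closed(5)[OF J(3) c(2)] c(1)] cl.J_closed(6)[OF J(1)]])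
      (use c in auto)
  moreover have "lc \<xi> * scalar (2 * \<xi> v) * lv v = scalar (2 * \<xi> v) * (lc \<xi> * lv v)"
    by (simp add: scalar_central[of "lc \<xi>"] mult.assoc)
  ultimately show ?thesis by (simp add: algebra_simps)
qed

lemma mu_parameters:
  assumes s: "s \<in> reflections A"
  defines "l \<equiv> csqrt (det_h A s)" and "k \<equiv> root A s (coroot A s)"
  shows "l \<noteq> 0" "l * l = det_h A s" "k \<noteq> 0"
proof -
  from reflection_form[OF s] show "k \<noteq> 0" "l \<noteq> 0" unfolding k_def l_def by (metis, metis csqrt_eq_0)
  show "l * l = det_h A s" unfolding l_def by (simp flip: power2_eq_square)
qed

lemma mu_rep_closed: "s \<in> reflections A \<Longrightarrow> mu_rep A s \<in> carrier cl.F"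
  unfolding mu_rep_def Let_def
  by (intro free_algebra_closed) (auto simp: root)

lemma scalar_inverse:
  fixes e :: "'c list \<Rightarrow>\<^sub>0 complex"
  assumes "a * b = 1"
  shows "(scalar a' * e + scalar a) * (scalar b' * e + scalar b)
    = scalar (a' * b') * (e * e) + scalar (a' * b + a * b') * e + 1"
proof -
  have "(scalar a' * e) * scalar b = scalar (a' * b) * e"
    using scalar_mult_swap[of a' e b 1] by simp
  moreover have "scalar a * (scalar b' * e) = scalar (a * b') * e" "scalar a * scalar b = (scalar (a * b) :: 'c list \<Rightarrow>\<^sub>0 complex)"
    by (simp_all only: scalar_simps(2) mult.assoc[where 'a = "'c list \<Rightarrow>\<^sub>0 complex"])
  ultimately have "(scalar a' * e + scalar a) * (scalar b' * e + scalar b)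
    = scalar (a' * b') * (e * e) + scalar (a' * b) * e + scalar (a * b') * e + scalar (a * b)"
    by (simp only: distrib_left distrib_right scalar_mult_swap add_ac)
  then show ?thesis by (simp only: assms scalar_simps distrib_right add.assoc)
qed

lemma mu_unit:
  assumes s: "s \<in> reflections A"
  shows "mu A s \<in> Units (cliff A)"
proof -
  define l where "l = csqrt (det_h A s)"
  define k where "k = root A s (coroot A s)"
  note p = mu_parameters[OF s, folded l_def k_def]
  define a where "a = (l - 1 / l) / (2 * k)"
  define e where "e = lc (root A s) * lv (coroot A s)"
  have mu: "mu_rep A s = scalar a * e + scalar l"
    by (simp add: mu_rep_def Let_def l_def k_def a_def e_def mult.assoc)
  have r: "root A s \<in> dual A" by (rule root(1)[OF s])
  have ec: "e \<in> carrier cl.F" unfolding e_def using r by (intro free_algebra_closed) auto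
  have J: "e * e + scalar (2 * k) * e \<in> cl.J"
    unfolding e_def k_def by (rule lc_lv_square[OF r])
  \<comment> \<open>The inverse flips the sign of \<open>a\<close> and inverts \<open>l\<close>. As
    \<open>2 * k * a = l - 1 / l\<close>, both products with \<open>mu_rep A s\<close> equal 1 minus
    \<open>a * a\<close> times the quadratic expression \<open>e * e + 2 * k * e\<close>, which lies
    in \<open>J\<close>.\<close>
  let ?n = "scalar (- a) * e + scalar (1 / l)"
  have nc: "?n \<in> carrier cl.F" and mc: "mu_rep A s \<in> carrier cl.F"
    using ec mu_rep_closed[OF s] by auto
  have id1: "a * (1 / l) + l * (- a) = (a * - a) * (2 * k)" "- a * l + 1 / l * a = (a * - a) * (2 * k)"
    "- a * a = a * - a"
    using p(1,3) by (auto simp: a_def field_simps)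
  have m: "scalar (a * - a) * (e * e + scalar (2 * k) * e)
    = scalar (a * - a) * (e * e) + scalar ((a * - a) * (2 * k)) * e"
    unfolding scalar_simps(2)[of "a * - a" "2 * k"]
    by (simp only: distrib_left mult.assoc[where 'a = "'h falg"])
  have "mu_rep A s * ?n - 1 = scalar (a * - a) * (e * e + scalar (2 * k) * e)"
    unfolding mu by (subst scalar_inverse) (use p(1) in simp, simp only: id1(1) m add_diff_cancel_right')
  then have 1: "cl.cl (mu_rep A s * ?n) = cl.cl 1"
    using J by (intro cl.cl_eqI) (simp add: cl.J_closed(5))
  have "?n * mu_rep A s - 1 = scalar (a * - a) * (e * e + scalar (2 * k) * e)"
    unfolding mu by (subst scalar_inverse)
      (use p(1) in simp, simp only: id1(2,3) m add_diff_cancel_right')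
  then have 2: "cl.cl (?n * mu_rep A s) = cl.cl 1"
    using J by (intro cl.cl_eqI) (simp add: cl.J_closed(5))
  have "cl.cl (mu_rep A s) \<in> Units cl.Q"
    unfolding Units_def
    using 1 2 nc mc cl.cl_closed by (auto simp: cl.cl_mult cl.cl_one intro!: bexI[of _ "cl.cl ?n"])
  then show ?thesis by (simp add: mu_def cliff_eq)
qed

end

section \<open>The double cover\<close>

context rca_data
begin

lemma cliff_ring: "ring (cliff A)"
  unfolding cliff_eq by (rule cl.Q.ring_axioms)

text \<open>Let W be the wedge with the coroot and C the contraction by the root. The generator acts
  as \<open>1 / l - 2 * a * W * C\<close>, and moving it past the wedge with \<open>v\<close> leaves
  an extra W with coefficient \<open>2 * a * root A s v\<close>. Since
  \<open>2 * a = \<kappa> / l\<close>, this is the wedge with \<open>s v - v\<close>, scaled by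
  \<open>1 / l\<close>.\<close>

lemma spin_mu_wedge:
  assumes s: "s \<in> reflections A" and \<omega>: "\<omega> \<in> ext_space A"
  shows "spin_free A (mu_rep A s) (wedge A v \<omega>) = wedge A (s v) (spin_free A (mu_rep A s) \<omega>)"
proof -
  define l where "l = csqrt (det_h A s)"
  define k where "k = root A s (coroot A s)"
  note p = mu_parameters[OF s, folded l_def k_def]
  define a where "a = (l - 1 / l) / (2 * k)"
  have r: "root A s \<in> dual A" by (rule root(1)[OF s])
  let ?W = "wedge A (coroot A s)" and ?C = "contract A (root A s)"
  obtain \<kappa> where s_eq: "s v = v + scal A (\<kappa> * root A s v) (coroot A s)" and det: "det_h A s = 1 + \<kappa> * k" for v
    using reflection_form[OF s] unfolding k_def by metis
  have lk: "l - 2 * a * k = 1 / l" using p(1,3) by (simp add: a_def field_simps)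
  \<comment> \<open>From \<open>l * l = 1 + \<kappa> * k\<close> one gets
    \<open>l - 1 / l = \<kappa> * k / l\<close>, and the left side is \<open>2 * a * k\<close> by
    the choice of \<open>a\<close>.\<close>
  have "2 * a * k = \<kappa> * k / l"
    using p det by (simp add: a_def field_simps)
  then have ak: "2 * a = \<kappa> / l" using p(1,3) by (simp add: field_simps)
  have S: "spin_free A (mu_rep A s) \<eta> = ext_scale (1 / l) \<eta> - ext_scale (2 * a) (?W (?C \<eta>))"
    if "\<eta> \<in> ext_space A" for \<eta>
  proof -
    have "spin_free A (mu_rep A s) \<eta> = ext_scale a (ext_scale 2 (?C (?W \<eta>))) + ext_scale l \<eta>"
      by (simp add: mu_rep_def Let_def flip: l_def k_def a_def)
        (simp add: spin_free_add spin_free_mult spin_lv spin_lc spin_free_scalar)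
    then show ?thesis
      unfolding contract_wedge[OF that r] lk[symmetric] by (simp add: pointwise k_def algebra_simps)
  qed
  have WW: "?W (?W \<eta>) = 0" if "\<eta> \<in> ext_space A" for \<eta>
  proof
    fix J show "?W (?W \<eta>) J = 0 J"
      using fun_cong[OF wedge_wedge[OF that, of "coroot A s" "coroot A s"], of J] by (simp add: pointwise(2-))
  qed
  have "spin_free A (mu_rep A s) (wedge A v \<omega>)
    = ext_scale (1 / l) (wedge A v \<omega>) - ext_scale (2 * a) (?W (- ext_scale (root A s v) \<omega> - wedge A v (?C \<omega>)))"
    unfolding S[OF wedge_closed] contract_wedge[OF \<omega> r] ..
  also have "\<dots> = ext_scale (1 / l) (wedge A v \<omega>) + ext_scale (2 * a * root A s v) (?W \<omega>)
      + ext_scale (2 * a) (?W (wedge A v (?C \<omega>)))"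
    by (simp only: ext_linear_simps(2,4,5)[OF wedge_linear]) (simp add: pointwise algebra_simps)
  also have "\<dots> = wedge A (s v) (ext_scale (1 / l) \<omega> - ext_scale (2 * a) (?W (?C \<omega>)))"
  proof -
    let ?\<eta> = "ext_scale (1 / l) \<omega> - ext_scale (2 * a) (?W (?C \<omega>))"
    have "wedge A (s v) ?\<eta> = wedge A v ?\<eta> + ext_scale (\<kappa> * root A s v) (?W ?\<eta>)"
      by (simp only: s_eq[of v] wedge_add wedge_scale)
    moreover have "wedge A v ?\<eta> = ext_scale (1 / l) (wedge A v \<omega>) + ext_scale (2 * a) (?W (wedge A v (?C \<omega>)))"
      using wedge_wedge[OF contract_closed[of A "root A s" \<omega>], of v "coroot A s"]
      by (simp only: ext_linear_simps(2,5)[OF wedge_linear]) (simp add: pointwise)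
    moreover have "?W ?\<eta> = ext_scale (1 / l) (?W \<omega>)"
      by (simp only: ext_linear_simps(2,5)[OF wedge_linear] WW[OF contract_closed]) (simp add: pointwise)
    moreover have "2 * a * root A s v = \<kappa> / l * root A s v" by (simp only: ak)
    ultimately show ?thesis by (simp only:) (simp add: pointwise algebra_simps)
  qed
  finally show ?thesis by (simp only: S[OF \<omega>])
qed

text \<open>Both sides intertwine the wedge with \<open>v\<close> and the wedge with
  \<open>s v\<close>, so only \<open>blade {}\<close> matters. With \<open>l\<close> the chosen root
  of the determinant and \<open>k\<close> the pairing of root and coroot, their product acts there
  by \<open>- 2 * k\<close>, and the eigenvalue is \<open>l - (l - 1 / l) = 1 / l\<close>.\<close>

lemma spin_mu:
  assumes s: "s \<in> reflections A" and \<omega>: "\<omega> \<in> ext_space A"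
  shows "spin A (mu A s) \<omega> = ext_scale (1 / csqrt (det_h A s)) (ext_act A s \<omega>)"
proof -
  let ?l = "csqrt (det_h A s)"
  have sg: "s \<in> grp A" by (rule reflections_grp[OF s])
  have E: "blade {} \<in> ext_space A" by auto
  have "spin_free A (mu_rep A s) \<omega> = ext_scale (1 / ?l) (ext_act A s \<omega>)"
  proof (rule ext_generate_eq[OF spin_free_linear ext_linear_scale[OF ext_act_linear] _ _ \<omega>])
    let ?k = "root A s (coroot A s)"
    note p = mu_parameters[OF s]
    have "spin_free A (mu_rep A s) (blade {})
      = ext_scale ((?l - 1 / ?l) / (2 * ?k)) (ext_scale 2 (contract A (root A s) (wedge A (coroot A s) (blade {}))))
        + ext_scale ?l (blade {})"
      by (simp add: mu_rep_def Let_def spin_free_add spin_free_mult spin_lv spin_lc spin_free_scalar)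
    also have "\<dots> = ext_scale (1 / ?l) (blade {})"
      unfolding contract_wedge[OF E root(1)[OF s]] contract_blade_empty ext_linear_simps(3)[OF wedge_linear]
      using p(1,3) by (simp add: pointwise field_simps)
    finally show "spin_free A (mu_rep A s) (blade {}) = ext_scale (1 / ?l) (ext_act A s (blade {}))"
      by (simp only: ext_act_empty)
  next
    fix i \<omega> assume w: "\<omega> \<in> ext_space A"
      and IH: "spin_free A (mu_rep A s) \<omega> = ext_scale (1 / ?l) (ext_act A s \<omega>)"
    show "spin_free A (mu_rep A s) (wedge A (ybas A i) \<omega>)
      = ext_scale (1 / ?l) (ext_act A s (wedge A (ybas A i) \<omega>))"
      by (simp only: spin_mu_wedge[OF s w] IH ext_act_wedge[OF sg w] ext_linear_simps(2)[OF wedge_linear])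
  qed
  then show ?thesis by (simp only: mu_def spin_class[OF \<omega>])
qed

lemma neg_mu_eq: "s \<in> reflections A \<Longrightarrow> neg_mu A s = cliff_class A (- mu_rep A s)"
  unfolding neg_mu_def mu_def cliff_eq by (rule cl.cl_uminus[OF mu_rep_closed])

lemma neg_mu_unit: "s \<in> reflections A \<Longrightarrow> neg_mu A s \<in> Units (cliff A)"
proof -
  assume s: "s \<in> reflections A"
  interpret Q: ring "cliff A" by (rule cliff_ring)
  have "neg_mu A s = (\<ominus>\<^bsub>cliff A\<^esub> \<one>\<^bsub>cliff A\<^esub>) \<otimes>\<^bsub>cliff A\<^esub> mu A s"
    using mu_unit[OF s] by (simp add: neg_mu_def Q.l_minus Q.Units_closed)
  then show ?thesis using Q.Units_m_closed[OF Q.Units_minus_one_closed mu_unit[OF s]] by simp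
qed

lemma spin_neg_mu:
  assumes s: "s \<in> reflections A" and \<omega>: "\<omega> \<in> ext_space A"
  shows "spin A (neg_mu A s) \<omega> = ext_scale (- 1 / csqrt (det_h A s)) (ext_act A s \<omega>)"
proof -
  have "spin A (neg_mu A s) \<omega> = - spin A (mu A s) \<omega>"
    unfolding neg_mu_eq[OF s] mu_def spin_class[OF \<omega>]
    using spin_free_diff[of A 0 "mu_rep A s" \<omega>] by (simp add: spin_free_zero)
  then show ?thesis unfolding spin_mu[OF s \<omega>] by (simp add: pointwise)
qed

text \<open>\<open>subgroup_generated\<close> intersects its generators with the carrier; the
  intersection disappears because all of them are units.\<close>

lemma carrier_Wtilde: "carrier (Wtilde A)
    = generate (units_of (cliff A)) (mu A ` reflections A \<union> neg_mu A ` reflections A)"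
proof -
  have "mu A ` reflections A \<union> neg_mu A ` reflections A \<subseteq> carrier (units_of (cliff A))"
    using mu_unit neg_mu_unit by (auto simp: units_of_carrier)
  then show ?thesis by (simp add: Wtilde_def subgroup_generated_def Int_absorb1)
qed

lemma Wtilde_simps [simp]: "g \<otimes>\<^bsub>Wtilde A\<^esub> h = g \<otimes>\<^bsub>cliff A\<^esub> h" "\<one>\<^bsub>Wtilde A\<^esub> = \<one>\<^bsub>cliff A\<^esub>"
  by (simp_all add: Wtilde_def subgroup_generated_def units_of_mult units_of_one)

lemma group_units: "Group.group (units_of (cliff A))"
proof -
  interpret Q: ring "cliff A" by (rule cliff_ring)
  show ?thesis by (rule Q.units_group)
qed

lemma group_Wtilde: "Group.group (Wtilde A)"
  unfolding Wtilde_def by (rule group.group_subgroup_generated[OF group_units])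

lemma Wtilde_units: "g \<in> carrier (Wtilde A) \<Longrightarrow> g \<in> Units (cliff A)"
  unfolding Wtilde_def
  using group.carrier_subgroup_generated_subset[OF group_units] by (auto simp: units_of_carrier)

lemma Wtilde_closed: "g \<in> carrier (Wtilde A) \<Longrightarrow> g \<in> carrier (cliff A)"
  using Wtilde_units by (auto simp: Units_def)

lemma mu_in_Wtilde: "s \<in> reflections A \<Longrightarrow> mu A s \<in> carrier (Wtilde A)"
  "s \<in> reflections A \<Longrightarrow> neg_mu A s \<in> carrier (Wtilde A)"
  unfolding carrier_Wtilde by (auto intro: generate.incl)

text \<open>Stands in for the pair of \<open>cover\<close> and \<open>chi\<close> until
  \<open>cover\<close> is known to satisfy its definite description.\<close>

definition lifts :: "'h falg set \<Rightarrow> ('h \<Rightarrow> 'h) \<Rightarrow> complex \<Rightarrow> bool" where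
  "lifts g w a \<longleftrightarrow> w \<in> grp A \<and> a \<noteq> 0 \<and> (\<forall>\<omega>\<in>ext_space A. spin A g \<omega> = ext_scale a (ext_act A w \<omega>))"

text \<open>Degree 0 determines the scalar, since every group element fixes \<open>blade {}\<close>;
  degree 1 then determines the group element vector by vector.\<close>

lemma lifts_unique:
  assumes "lifts g w a" "lifts g v b"
  shows "w = v" "a = b"
proof -
  have eq: "ext_scale a (ext_act A w \<omega>) = ext_scale b (ext_act A v \<omega>)" if "\<omega> \<in> ext_space A" for \<omega>
    using assms that by (auto simp: lifts_def)
  have E: "blade {} \<in> ext_space A" by auto
  have "blade {} {} = 1" by (simp add: blade_def)
  then show ab: "a = b"
    using fun_cong[OF eq[OF E], of "{}"] by (simp add: ext_act_empty ext_scale_apply)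
  have "w u = v u" for u
  proof (rule wedge_inj)
    have "ext_scale a (wedge A (w u) (blade {})) = ext_scale a (wedge A (v u) (blade {}))"
      using eq[OF wedge_closed, of u "blade {}"] assms ext_act_wedge[OF _ E] ab
      by (simp add: lifts_def ext_act_empty)
    then show "wedge A (w u) (blade {}) = wedge A (v u) (blade {})"
      using assms(1) by (simp add: lifts_def)
  qed
  then show "w = v" by auto
qed

lemma lifts_mult:
  assumes "lifts g w a" "lifts h v b" "g \<in> carrier (cliff A)" "h \<in> carrier (cliff A)"
  shows "lifts (g \<otimes>\<^bsub>cliff A\<^esub> h) (w \<circ> v) (a * b)"
proof -
  have "spin A (g \<otimes>\<^bsub>cliff A\<^esub> h) \<omega> = ext_scale (a * b) (ext_act A (w \<circ> v) \<omega>)" if \<omega>: "\<omega> \<in> ext_space A" for \<omega>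
  proof -
    have "spin A (g \<otimes>\<^bsub>cliff A\<^esub> h) \<omega> = spin A g (spin A h \<omega>)" by (rule spin_mult[OF assms(3,4) \<omega>])
    also have "\<dots> = ext_scale a (ext_act A w (ext_scale b (ext_act A v \<omega>)))"
      using assms \<omega> by (simp add: lifts_def ext_space_closed(3) ext_act_closed)
    finally show ?thesis
      using assms \<omega> by (simp add: lifts_def ext_linear_simps(2)[OF ext_act_linear] ext_act_comp)
  qed
  then show ?thesis using assms by (simp add: lifts_def grp_closed)
qed

lemma lifts_inv:
  assumes "lifts g w a" "g \<in> Units (cliff A)"
  shows "lifts (inv\<^bsub>cliff A\<^esub> g) (inv_into UNIV w) (1 / a)"
proof -
  interpret Q: ring "cliff A" by (rule cliff_ring)
  from assms have w: "w \<in> grp A" and a: "a \<noteq> 0" by (auto simp: lifts_def)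
  have "spin A (inv\<^bsub>cliff A\<^esub> g) \<omega> = ext_scale (1 / a) (ext_act A (inv_into UNIV w) \<omega>)"
    if \<omega>: "\<omega> \<in> ext_space A" for \<omega>
  proof -
    \<comment> \<open>The claimed value is a preimage of \<omega> under \<open>g\<close>; applying
      the inverse of \<open>g\<close> to that equation gives the claim.\<close>
    let ?\<eta> = "ext_scale (1 / a) (ext_act A (inv_into UNIV w) \<omega>)"
    have \<eta>: "?\<eta> \<in> ext_space A" by (intro ext_space_closed ext_act_closed)
    have "w \<circ> inv_into UNIV w = id" using grp_inv[OF w] by auto
    then have "ext_act A w (ext_act A (inv_into UNIV w) \<omega>) = \<omega>"
      using ext_act_comp[OF w grp_inv_closed[OF w] \<omega>] ext_act_id[OF \<omega>] by simp
    then have "spin A g ?\<eta> = \<omega>"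
      using assms(1) \<eta> a by (simp add: lifts_def ext_linear_simps(2)[OF ext_act_linear])
    then have "spin A (inv\<^bsub>cliff A\<^esub> g) \<omega> = spin A (inv\<^bsub>cliff A\<^esub> g \<otimes>\<^bsub>cliff A\<^esub> g) ?\<eta>"
      using spin_mult[OF Q.Units_closed[OF Q.Units_inv_Units[OF assms(2)]] Q.Units_closed[OF assms(2)] \<eta>] by simp
    then show ?thesis using spin_one[OF \<eta>] by (simp add: Q.Units_l_inv[OF assms(2)])
  qed
  then show ?thesis using w a by (simp add: lifts_def grp_inv_closed)
qed

lemma lifts_mu:
  assumes s: "s \<in> reflections A"
  shows "lifts (mu A s) s (1 / csqrt (det_h A s))" "lifts (neg_mu A s) s (- 1 / csqrt (det_h A s))"
  using mu_parameters(1)[OF s] spin_mu[OF s] spin_neg_mu[OF s] reflections_grp[OF s]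
  by (simp_all add: lifts_def)

lemma lifts_one: "lifts \<one>\<^bsub>cliff A\<^esub> id 1"
  by (simp add: lifts_def grp_closed spin_one ext_act_id)

lemma Wtilde_lifts:
  assumes "g \<in> carrier (Wtilde A)"
  shows "\<exists>w a. lifts g w a"
  using assms unfolding carrier_Wtilde
proof (induction g)
  case one
  then show ?case using lifts_one by (auto simp: units_of_one)
next
  case (incl h)
  then show ?case using lifts_mu by blast
next
  case (inv h)
  interpret Q: ring "cliff A" by (rule cliff_ring)
  from inv have h: "h \<in> Units (cliff A)" using mu_unit neg_mu_unit by auto
  from inv have "\<exists>w a. lifts h w a" using lifts_mu by blast
  then show ?case using lifts_inv[OF _ h] unfolding Q.units_of_inv[OF h] by blast
next
  case (eng g h)
  then have "g \<in> carrier (cliff A)" "h \<in> carrier (cliff A)"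
    using Wtilde_closed by (simp_all add: carrier_Wtilde)
  then show ?case using eng lifts_mult by (metis units_of_mult)
qed

text \<open>Supplies uniqueness in the description that defines \<open>cover\<close>. Membership is
  carried through the induction because homomorphism laws hold on the carrier only.\<close>

lemma hom_Wtilde_eqI:
  assumes G: "Group.group G" and p: "p \<in> hom (Wtilde A) G" and q: "q \<in> hom (Wtilde A) G"
    and eq: "\<And>s. s \<in> reflections A \<Longrightarrow> p (mu A s) = q (mu A s)"
      "\<And>s. s \<in> reflections A \<Longrightarrow> p (neg_mu A s) = q (neg_mu A s)"
    and g: "g \<in> carrier (Wtilde A)"
  shows "p g = q g"
proof -
  interpret p: group_hom "Wtilde A" G p
    using group_Wtilde G p by (simp add: group_hom_def group_hom_axioms_def)
  interpret q: group_hom "Wtilde A" G q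
    using group_Wtilde G q by (simp add: group_hom_def group_hom_axioms_def)
  have "g \<in> carrier (Wtilde A) \<and> p g = q g"
    using g unfolding carrier_Wtilde
  proof (induction g)
    case one
    then show ?case using p.hom_one q.hom_one p.one_closed generate.one
      by (metis Wtilde_simps(2) units_of_one)
  next
    case (incl h)
    then show ?case using eq by (auto intro: generate.incl)
  next
    case (inv h)
    then have h: "h \<in> carrier (Wtilde A)" "p h = q h" using eq mu_in_Wtilde by auto
    have "inv\<^bsub>units_of (cliff A)\<^esub> h = inv\<^bsub>Wtilde A\<^esub> h"
      using h(1) unfolding Wtilde_def by (rule group.inv_subgroup_generated[OF group_units, symmetric])
    moreover have "inv\<^bsub>units_of (cliff A)\<^esub> h
      \<in> generate (units_of (cliff A)) (mu A ` reflections A \<union> neg_mu A ` reflections A)"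
      by (rule generate.inv[OF inv])
    ultimately show ?case using h by (simp add: p.hom_inv q.hom_inv)
  next
    case (eng g h)
    then have "g \<in> carrier (Wtilde A)" "h \<in> carrier (Wtilde A)" by (simp_all add: carrier_Wtilde)
    then show ?case
      using eng p.hom_mult[of g h] q.hom_mult[of g h]
      by (auto simp: units_of_mult intro: generate.eng[of g "units_of (cliff A)", unfolded units_of_mult])
  qed
  then show ?thesis ..
qed

text \<open>Existence comes from the spinor action and not from a presentation of \<open>W\<close>:
  \<open>p\<close> sends \<open>g\<close> to the unique group element that it lifts, and
  \<open>lifts_mult\<close> makes \<open>p\<close> multiplicative.\<close>

lemma cover_spec:
  "cover A \<in> hom (Wtilde A) (Wgroup A)" (is ?hom)
  "g \<in> carrier (Wtilde A) \<Longrightarrow> lifts g (cover A g) (chi A g)"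
proof -
  define p where "p = (\<lambda>g\<in>carrier (Wtilde A). THE w. \<exists>a. lifts g w a)"
  have p: "\<exists>a. lifts g (p g) a" if "g \<in> carrier (Wtilde A)" for g
  proof -
    obtain w where w: "\<exists>a. lifts g w a" using Wtilde_lifts[OF \<open>g \<in> carrier (Wtilde A)\<close>] by blast
    then have "\<exists>!w. \<exists>a. lifts g w a" using lifts_unique(1) by blast
    then have "\<exists>a. lifts g (THE w. \<exists>a. lifts g w a) a" by (rule theI')
    then show ?thesis using that by (simp add: p_def)
  qed
  have p_eq: "p g = w" if "g \<in> carrier (Wtilde A)" "lifts g w a" for g w a
    using p[OF that(1)] lifts_unique(1)[OF that(2)] by blast
  have phom: "p \<in> hom (Wtilde A) (Wgroup A)"
  proof (rule homI)
    fix g assume "g \<in> carrier (Wtilde A)"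
    then show "p g \<in> carrier (Wgroup A)" using p[of g] by (auto simp: lifts_def)
  next
    fix g h assume gh: "g \<in> carrier (Wtilde A)" "h \<in> carrier (Wtilde A)"
    then have "g \<otimes>\<^bsub>Wtilde A\<^esub> h \<in> carrier (Wtilde A)"
      by (rule monoid.m_closed[OF group.is_monoid[OF group_Wtilde]])
    moreover obtain a b where "lifts g (p g) a" "lifts h (p h) b" using p gh by blast
    ultimately show "p (g \<otimes>\<^bsub>Wtilde A\<^esub> h) = p g \<otimes>\<^bsub>Wgroup A\<^esub> p h"
      using lifts_mult gh Wtilde_closed p_eq by (metis Wtilde_simps(1) Wgroup_simps(2))
  qed
  have pmu: "p (mu A s) = s" "p (neg_mu A s) = s" if "s \<in> reflections A" for s
    using p_eq mu_in_Wtilde lifts_mu that by blast+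
  have "cover A = p"
    unfolding cover_def
  proof (rule the_equality)
    show "p \<in> hom (Wtilde A) (Wgroup A) \<and> p \<in> extensional (carrier (Wtilde A)) \<and>
      (\<forall>s\<in>reflections A. p (mu A s) = s \<and> p (neg_mu A s) = s)"
      using phom pmu by (auto simp: p_def)
    fix q assume q: "q \<in> hom (Wtilde A) (Wgroup A) \<and> q \<in> extensional (carrier (Wtilde A)) \<and>
      (\<forall>s\<in>reflections A. q (mu A s) = s \<and> q (neg_mu A s) = s)"
    show "q = p"
    proof (rule extensionalityI[where A = "carrier (Wtilde A)"])
      fix g assume "g \<in> carrier (Wtilde A)"
      then show "q g = p g"
        by (rule hom_Wtilde_eqI[OF group_W, rotated 4]) (use q phom pmu in auto)
    qed (use q in \<open>auto simp: p_def\<close>)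
  qed
  then show ?hom using phom by simp
  assume g: "g \<in> carrier (Wtilde A)"
  then obtain a where a: "lifts g (cover A g) a" using p \<open>cover A = p\<close> by blast
  have "blade {} \<in> ext_space A" "blade {} {} = 1" by (auto, simp add: blade_def)
  then have "chi A g = a" using a by (simp add: chi_def lifts_def ext_act_empty ext_scale_apply)
  then show "lifts g (cover A g) (chi A g)" using a by simp
qed

lemma chi_mult:
  assumes "g \<in> carrier (Wtilde A)" "h \<in> carrier (Wtilde A)"
  shows "chi A (g \<otimes>\<^bsub>Wtilde A\<^esub> h) = chi A g * chi A h"
proof -
  have "g \<otimes>\<^bsub>Wtilde A\<^esub> h \<in> carrier (Wtilde A)"
    by (rule monoid.m_closed[OF group.is_monoid[OF group_Wtilde] assms])
  from lifts_unique(2)[OF cover_spec(2)[OF this]] lifts_mult[OF cover_spec(2)[OF assms(1)] cover_spec(2)[OF assms(2)]]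
  show ?thesis using assms Wtilde_closed by simp
qed

lemma cover_closed: "g \<in> carrier (Wtilde A) \<Longrightarrow> cover A g \<in> grp A"
  using cover_spec(2) by (simp add: lifts_def)

lemma cover_mult: "g \<in> carrier (Wtilde A) \<Longrightarrow> h \<in> carrier (Wtilde A) \<Longrightarrow>
    cover A (g \<otimes>\<^bsub>Wtilde A\<^esub> h) = cover A g \<circ> cover A h"
  using hom_mult[OF cover_spec(1)] by fastforce

lemma cover_one: "cover A \<one>\<^bsub>Wtilde A\<^esub> = id" and chi_one: "chi A \<one>\<^bsub>Wtilde A\<^esub> = 1"
  using lifts_unique[OF cover_spec(2) lifts_one] monoid.one_closed[OF group.is_monoid[OF group_Wtilde]] by auto

end

section \<open>Representations\<close>

lemma cring_complex_field: "cring complex_field"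
proof (rule cringI)
  show "abelian_group complex_field"
  proof (rule abelian_groupI)
    show "\<exists>y\<in>carrier complex_field. y \<oplus>\<^bsub>complex_field\<^esub> x = \<zero>\<^bsub>complex_field\<^esub>" for x
      by (rule bexI[of _ "- x"]) (auto simp: complex_field_def)
  qed (auto simp: complex_field_def)
  show "comm_monoid complex_field"
    by (rule comm_monoidI) (auto simp: complex_field_def)
qed (auto simp: complex_field_def algebra_simps)

lemma complex_field_simps [simp]:
  "carrier complex_field = UNIV" "a \<otimes>\<^bsub>complex_field\<^esub> b = a * b" "a \<oplus>\<^bsub>complex_field\<^esub> b = a + b"
  "\<one>\<^bsub>complex_field\<^esub> = 1" "\<zero>\<^bsub>complex_field\<^esub> = 0"
  by (simp_all add: complex_field_def)

definition is_subrep :: "('g, 'x) monoid_scheme \<Rightarrow> ('g, 'v) rep \<Rightarrow> 'v set \<Rightarrow> bool" where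
  "is_subrep G V U \<longleftrightarrow> U \<subseteq> carrier V \<and> \<zero>\<^bsub>V\<^esub> \<in> U \<and>
     (\<forall>u\<in>U. \<forall>v\<in>U. u \<oplus>\<^bsub>V\<^esub> v \<in> U) \<and> (\<forall>a. \<forall>u\<in>U. a \<odot>\<^bsub>V\<^esub> u \<in> U) \<and>
     (\<forall>g\<in>carrier G. \<forall>u\<in>U. ract V g u \<in> U)"

lemma subrep_simps [simp]:
  "carrier (subrep V U) = U" "add (subrep V U) = add V" "zero (subrep V U) = zero V"
  "smult (subrep V U) = smult V" "ract (subrep V U) = ract V" "subrep (subrep V U) U' = subrep V U'"
  by (simp_all add: subrep_def)

lemma subrep_is_rep:
  assumes V: "is_rep G V" and U: "is_subrep G V U"
  shows "is_rep G (subrep V U)"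
proof -
  interpret V: Module.module complex_field V using V by (simp add: is_rep_def)
  have UV: "u \<in> carrier V" if "u \<in> U" for u using U that by (auto simp: is_subrep_def)
  have "Module.module complex_field (subrep V U)"
  proof (rule moduleI[OF cring_complex_field])
    show "abelian_group (subrep V U)"
    proof (rule abelian_groupI)
      fix x assume x: "x \<in> carrier (subrep V U)"
      \<comment> \<open>\<open>is_subrep\<close> lists closure under scalars but not under negation,
        so the additive inverse is produced as multiplication by -1.\<close>
      have "(-1) \<odot>\<^bsub>V\<^esub> x \<oplus>\<^bsub>V\<^esub> x = (-1) \<odot>\<^bsub>V\<^esub> x \<oplus>\<^bsub>V\<^esub> 1 \<odot>\<^bsub>V\<^esub> x"
        using V.smult_one[of x] x UV by simp
      also have "\<dots> = \<zero>\<^bsub>V\<^esub>"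
        using V.smult_l_distr[of "-1" 1 x] V.smult_l_null[of x] x UV by simp
      finally show "\<exists>y\<in>carrier (subrep V U). y \<oplus>\<^bsub>subrep V U\<^esub> x = \<zero>\<^bsub>subrep V U\<^esub>"
        using U x by (auto simp: is_subrep_def)
    qed (use U UV V.M.a_assoc V.M.a_comm in \<open>auto simp: is_subrep_def\<close>)
  qed (use U UV V.smult_l_distr V.smult_r_distr V.smult_assoc1 V.smult_one in \<open>auto simp: is_subrep_def\<close>)
  then show ?thesis
    using V U UV by (auto simp: is_rep_def is_subrep_def)
qed

section \<open>Quotients of representations\<close>

locale rep_quotient =
  fixes G :: "('g, 'x) monoid_scheme" and V :: "('g, 'v) rep" and N :: "'v set"
  assumes group: "Group.group G" and rep: "is_rep G V" and sub: "is_subrep G V N"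
begin

sublocale G: Group.group G
  by (rule group)

sublocale V: Module.module complex_field V
  using rep by (simp add: is_rep_def)

lemma N_closed: "n \<in> N \<Longrightarrow> n \<in> carrier V" "\<zero>\<^bsub>V\<^esub> \<in> N" "n \<in> N \<Longrightarrow> m \<in> N \<Longrightarrow> n \<oplus>\<^bsub>V\<^esub> m \<in> N"
  "n \<in> N \<Longrightarrow> a \<odot>\<^bsub>V\<^esub> n \<in> N" "g \<in> carrier G \<Longrightarrow> n \<in> N \<Longrightarrow> ract V g n \<in> N"
  using sub by (auto simp: is_subrep_def)

lemma act: "g \<in> carrier G \<Longrightarrow> v \<in> carrier V \<Longrightarrow> ract V g v \<in> carrier V"
  "g \<in> carrier G \<Longrightarrow> u \<in> carrier V \<Longrightarrow> v \<in> carrier V \<Longrightarrow> ract V g (u \<oplus>\<^bsub>V\<^esub> v) = ract V g u \<oplus>\<^bsub>V\<^esub> ract V g v"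
  "g \<in> carrier G \<Longrightarrow> v \<in> carrier V \<Longrightarrow> ract V g (a \<odot>\<^bsub>V\<^esub> v) = a \<odot>\<^bsub>V\<^esub> ract V g v"
  "v \<in> carrier V \<Longrightarrow> ract V \<one>\<^bsub>G\<^esub> v = v"
  "g \<in> carrier G \<Longrightarrow> h \<in> carrier G \<Longrightarrow> v \<in> carrier V \<Longrightarrow> ract V (g \<otimes>\<^bsub>G\<^esub> h) v = ract V g (ract V h v)"
  using rep unfolding is_rep_def by blast+

lemma minus_eq: "v \<in> carrier V \<Longrightarrow> \<ominus>\<^bsub>V\<^esub> v = (-1) \<odot>\<^bsub>V\<^esub> v"
  using V.smult_l_minus[of 1 v] V.smult_one[of v] V.R.minus_equality[of "-1" 1] by simp

sublocale N: abelian_subgroup N V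
proof (rule abelian_subgroupI3[OF _ V.M.abelian_group_axioms])
  show "additive_subgroup N V"
    unfolding additive_subgroup_def
  proof (rule V.M.add.subgroupI)
    fix a assume "a \<in> N"
    then show "\<ominus>\<^bsub>V\<^esub> a \<in> N" using N_closed(1,4) by (simp add: minus_eq)
  qed (use N_closed in auto)
qed

abbreviation "qcl v \<equiv> N +>\<^bsub>V\<^esub> v"
abbreviation "Vq \<equiv> quotrep V N"

lemma carrier_quot: "A \<in> carrier Vq \<longleftrightarrow> (\<exists>v\<in>carrier V. A = qcl v)"
  by (auto simp: quotrep_def A_RCOSETS_def')

lemma mem_qcl: "u \<in> qcl v \<longleftrightarrow> (\<exists>n\<in>N. u = n \<oplus>\<^bsub>V\<^esub> v)"
  by (auto simp: a_r_coset_def')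

lemma qcl_eq_iff:
  assumes "u \<in> carrier V" "v \<in> carrier V"
  shows "qcl u = qcl v \<longleftrightarrow> (\<exists>n\<in>N. u = n \<oplus>\<^bsub>V\<^esub> v)"
proof
  assume "qcl u = qcl v"
  then have "u \<in> qcl v" using N.a_rcos_self[OF assms(1)] by simp
  then show "\<exists>n\<in>N. u = n \<oplus>\<^bsub>V\<^esub> v" by (simp only: mem_qcl)
next
  assume "\<exists>n\<in>N. u = n \<oplus>\<^bsub>V\<^esub> v"
  then have "u \<in> qcl v" by (simp only: mem_qcl)
  then show "qcl u = qcl v"
    by (rule V.M.a_repr_independence[OF _ assms(2) N.a_subgroup, symmetric])
qed

text \<open>\<open>quotrep\<close> defines its operations as unions over all representatives. Such a
  union is a single coset because representatives differ by elements of \<open>N\<close>, which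
  \<open>f\<close> preserves.\<close>

lemma union_qcl:
  assumes f: "\<And>v. v \<in> carrier V \<Longrightarrow> f v \<in> carrier V"
    and add: "\<And>u v. u \<in> carrier V \<Longrightarrow> v \<in> carrier V \<Longrightarrow> f (u \<oplus>\<^bsub>V\<^esub> v) = f u \<oplus>\<^bsub>V\<^esub> f v"
    and N: "\<And>n. n \<in> N \<Longrightarrow> f n \<in> N" and v: "v \<in> carrier V"
  shows "(\<Union>u\<in>qcl v. qcl (f u)) = qcl (f v)"
proof -
  have "qcl (f u) = qcl (f v)" if u: "u \<in> qcl v" for u
  proof -
    obtain n where n: "n \<in> N" "u = n \<oplus>\<^bsub>V\<^esub> v" using u by (auto simp: mem_qcl)
    then show ?thesis
      using add[of n v] N f v N_closed(1) by (subst qcl_eq_iff) auto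
  qed
  moreover have "v \<in> qcl v" using N.a_rcos_self[OF v] .
  ultimately show ?thesis by blast
qed

lemma quot_simps:
  "v \<in> carrier V \<Longrightarrow> a \<odot>\<^bsub>Vq\<^esub> qcl v = qcl (a \<odot>\<^bsub>V\<^esub> v)"
  "g \<in> carrier G \<Longrightarrow> v \<in> carrier V \<Longrightarrow> ract Vq g (qcl v) = qcl (ract V g v)"
  "u \<in> carrier V \<Longrightarrow> v \<in> carrier V \<Longrightarrow> qcl u \<oplus>\<^bsub>Vq\<^esub> qcl v = qcl (u \<oplus>\<^bsub>V\<^esub> v)"
  "\<zero>\<^bsub>Vq\<^esub> = qcl \<zero>\<^bsub>V\<^esub>"
proof -
  show "a \<odot>\<^bsub>Vq\<^esub> qcl v = qcl (a \<odot>\<^bsub>V\<^esub> v)" if "v \<in> carrier V"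
    using union_qcl[of "\<lambda>v. a \<odot>\<^bsub>V\<^esub> v", OF _ _ N_closed(4) that] V.smult_r_distr
    by (simp add: quotrep_def)
  show "ract Vq g (qcl v) = qcl (ract V g v)" if "g \<in> carrier G" "v \<in> carrier V"
    using union_qcl[of "ract V g", OF act(1,2)[OF that(1)] N_closed(5)[OF that(1)] that(2)]
    by (simp add: quotrep_def)
  show "qcl u \<oplus>\<^bsub>Vq\<^esub> qcl v = qcl (u \<oplus>\<^bsub>V\<^esub> v)" if "u \<in> carrier V" "v \<in> carrier V"
    using N.a_rcos_sum[OF that] by (simp add: quotrep_def)
  show "\<zero>\<^bsub>Vq\<^esub> = qcl \<zero>\<^bsub>V\<^esub>"
    using N_closed(1) by (force simp: quotrep_def a_r_coset_def')
qed

lemma quot_is_rep: "is_rep G Vq"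
proof -
  have "Module.module complex_field Vq"
  proof (rule moduleI[OF cring_complex_field])
    show "abelian_group Vq"
    proof (rule abelian_groupI)
      fix x assume "x \<in> carrier Vq"
      then obtain v where v: "v \<in> carrier V" "x = qcl v" by (auto simp: carrier_quot)
      then have "qcl (\<ominus>\<^bsub>V\<^esub> v) \<oplus>\<^bsub>Vq\<^esub> x = \<zero>\<^bsub>Vq\<^esub>"
        by (simp add: quot_simps V.M.l_neg)
      moreover have "qcl (\<ominus>\<^bsub>V\<^esub> v) \<in> carrier Vq" using v by (auto simp: carrier_quot)
      ultimately show "\<exists>y\<in>carrier Vq. y \<oplus>\<^bsub>Vq\<^esub> x = \<zero>\<^bsub>Vq\<^esub>" by blast
    qed (auto simp: carrier_quot quot_simps V.M.a_ac)
  qed (auto simp: carrier_quot quot_simps V.smult_l_distr[simplified] V.smult_r_distr V.smult_assoc1[simplified] V.smult_one[simplified])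
  then show ?thesis
    unfolding is_rep_def by (auto simp: carrier_quot quot_simps act) (use act(1) in blast)
qed

end

lemma rep_isoI:
  assumes "is_rep G V" "is_rep G V'" "bij_betw f (carrier V) (carrier V')"
    "\<And>u v. u \<in> carrier V \<Longrightarrow> v \<in> carrier V \<Longrightarrow> f (u \<oplus>\<^bsub>V\<^esub> v) = f u \<oplus>\<^bsub>V'\<^esub> f v"
    "\<And>a v. v \<in> carrier V \<Longrightarrow> f (a \<odot>\<^bsub>V\<^esub> v) = a \<odot>\<^bsub>V'\<^esub> f v"
    "\<And>g v. g \<in> carrier G \<Longrightarrow> v \<in> carrier V \<Longrightarrow> f (ract V g v) = ract V' g (f v)"
  shows "rep_iso G V V'"
  using assms unfolding rep_iso_def by blast

lemma rep_iso_sym: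
  assumes "rep_iso G V V'"
  shows "rep_iso G V' V"
proof -
  from assms obtain f where V: "is_rep G V" and V': "is_rep G V'" and f: "bij_betw f (carrier V) (carrier V')"
    and add: "\<And>u v. u \<in> carrier V \<Longrightarrow> v \<in> carrier V \<Longrightarrow> f (u \<oplus>\<^bsub>V\<^esub> v) = f u \<oplus>\<^bsub>V'\<^esub> f v"
    and sm: "\<And>a v. v \<in> carrier V \<Longrightarrow> f (a \<odot>\<^bsub>V\<^esub> v) = a \<odot>\<^bsub>V'\<^esub> f v"
    and ra: "\<And>g v. g \<in> carrier G \<Longrightarrow> v \<in> carrier V \<Longrightarrow> f (ract V g v) = ract V' g (f v)"
    unfolding rep_iso_def by blast
  interpret V: Module.module complex_field V using V by (simp add: is_rep_def)
  let ?g = "inv_into (carrier V) f"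
  have fg: "f (?g v) = v" "?g v \<in> carrier V" if "v \<in> carrier V'" for v
    using f that by (auto simp: bij_betw_def f_inv_into_f inv_into_into)
  have gI: "?g v = u" if "u \<in> carrier V" "f u = v" for u v
    using f that by (auto simp: bij_betw_def)
  have act: "ract V g v \<in> carrier V" if "g \<in> carrier G" "v \<in> carrier V" for g v
    using V that by (simp add: is_rep_def)
  have sc: "a \<odot>\<^bsub>V\<^esub> v \<in> carrier V" if "v \<in> carrier V" for a v using V.smult_closed[of a v] that by simp
  show ?thesis
  proof (rule rep_isoI[OF V' V bij_betw_inv_into[OF f]])
  qed (rule gI; simp add: fg add sm ra act sc)+
qed

text \<open>The isomorphism is the projection restricted to \<open>U\<close>. Uniqueness of
  decompositions makes it injective, and it is surjective because the \<open>N\<close> component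
  disappears in the quotient.\<close>

lemma rep_iso_complement:
  assumes G: "Group.group G" and K: "is_rep G K" and U: "is_subrep G K U" and N: "is_subrep G K N"
    and sum: "direct_sum2 K (carrier K) U N"
  shows "rep_iso G (subrep K U) (quotrep K N)"
proof -
  interpret rep_quotient G K N using G K N by (rule rep_quotient.intro)
  have UK: "u \<in> carrier K" if "u \<in> U" for u using U that by (auto simp: is_subrep_def)
  have bij: "bij_betw (\<lambda>(a, b). a \<oplus>\<^bsub>K\<^esub> b) (U \<times> N) (carrier K)"
    using sum by (simp add: direct_sum2_def)
  show ?thesis
  proof (rule rep_isoI[OF subrep_is_rep[OF K U] quot_is_rep, where f = qcl])
    have "inj_on qcl U"
    proof (rule inj_onI)
      fix u v assume uv: "u \<in> U" "v \<in> U" "qcl u = qcl v"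
      then obtain n where n: "n \<in> N" "u = n \<oplus>\<^bsub>K\<^esub> v" using qcl_eq_iff UK by blast
      then have "(\<lambda>(a, b). a \<oplus>\<^bsub>K\<^esub> b) (u, \<zero>\<^bsub>K\<^esub>) = (\<lambda>(a, b). a \<oplus>\<^bsub>K\<^esub> b) (v, n)"
        using uv UK N_closed by (simp add: V.M.a_comm)
      then have "(u, \<zero>\<^bsub>K\<^esub>) = (v, n)"
        by (rule inj_onD[OF bij_betw_imp_inj_on[OF bij]]) (use uv n N_closed in auto)
      then show "u = v" by simp
    qed
    moreover have "qcl ` U = carrier (quotrep K N)"
    proof (intro equalityI subsetI)
      fix A assume "A \<in> carrier (quotrep K N)"
      then obtain v where v: "v \<in> carrier K" "A = qcl v" by (auto simp: carrier_quot)
      then obtain u n where un: "u \<in> U" "n \<in> N" "v = u \<oplus>\<^bsub>K\<^esub> n"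
        using bij_betw_imp_surj_on[OF bij] by force
      then have "v = n \<oplus>\<^bsub>K\<^esub> u" using UK N_closed by (simp add: V.M.a_comm)
      then have "A = qcl u" using v un UK qcl_eq_iff by blast
      then show "A \<in> qcl ` U" using un by blast
    qed (use UK in \<open>auto simp: carrier_quot\<close>)
    ultimately show "bij_betw qcl (carrier (subrep K U)) (carrier (quotrep K N))"
      by (simp add: bij_betw_def)
  qed (use UK in \<open>auto simp: quot_simps\<close>)
qed

text \<open>Actions that agree on carriers may differ as functions elsewhere, so the records need
  not be equal; the identity map is still an isomorphism.\<close>

lemma is_rep_ract_cong:
  assumes V: "is_rep G V" and eq: "\<And>g v. g \<in> carrier G \<Longrightarrow> v \<in> carrier V \<Longrightarrow> r g v = ract V g v"
    and G: "Group.group G"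
  shows "rep_iso G V (V\<lparr>ract := r\<rparr>)"
proof (rule rep_isoI[OF V, where f = "\<lambda>v. v"])
  have m: "Module.module complex_field V" using V by (simp add: is_rep_def)
  then interpret V: Module.module complex_field V .
  interpret G: Group.group G by fact
  have "Module.module complex_field (V\<lparr>ract := r\<rparr>)"
  proof (rule moduleI[OF cring_complex_field])
    show "abelian_group (V\<lparr>ract := r\<rparr>)"
    proof (rule abelian_groupI)
      fix x assume "x \<in> carrier (V\<lparr>ract := r\<rparr>)"
      then have "\<ominus>\<^bsub>V\<^esub> x \<in> carrier V" "\<ominus>\<^bsub>V\<^esub> x \<oplus>\<^bsub>V\<^esub> x = \<zero>\<^bsub>V\<^esub>"
        using V.M.l_neg V.M.a_inv_closed by auto
      then show "\<exists>y\<in>carrier (V\<lparr>ract := r\<rparr>). y \<oplus>\<^bsub>V\<lparr>ract := r\<rparr>\<^esub> x = \<zero>\<^bsub>V\<lparr>ract := r\<rparr>\<^esub>"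
        by auto
    qed (use V.M.a_assoc V.M.a_comm in auto)
  qed (use V.smult_closed V.smult_l_distr V.smult_r_distr V.smult_assoc1 V.smult_one in auto)
  then show "is_rep G (V\<lparr>ract := r\<rparr>)"
    using V V.smult_closed by (auto simp: is_rep_def eq)
qed (auto simp: eq bij_betw_def)

section \<open>Modules over the Cherednik algebra\<close>

context rca_data
begin

lemma H_gens_iff [simp]: "Vec v \<in> H_gens A" "Cov \<xi> \<in> H_gens A \<longleftrightarrow> \<xi> \<in> dual A" "Grp w \<in> H_gens A \<longleftrightarrow> w \<in> grp A"
  by (auto simp: H_gens_def)

lemma H_letters_closed:
  "lv v \<in> carrier (free_algebra (H_gens A))" "\<xi> \<in> dual A \<Longrightarrow> lc \<xi> \<in> carrier (free_algebra (H_gens A))"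
  "w \<in> grp A \<Longrightarrow> lg w \<in> carrier (free_algebra (H_gens A))"
  by auto

lemma smash_rels_closed: "smash_rels A \<subseteq> carrier (free_algebra (H_gens A))"
  unfolding smash_rels_def
  by (auto intro!: free_algebra_closed(2,5-8) H_letters_closed grp_closed dual_act_closed)

lemma cherednik_rels_closed: "cherednik_rels A \<subseteq> carrier (free_algebra (H_gens A))"
  unfolding cherednik_rels_def
  by (auto intro!: free_algebra_closed(3,5-8) free_algebra_sum_closed H_letters_closed reflections_grp)

lemma H_rels_closed: "H_rels A \<subseteq> carrier (free_algebra (H_gens A))"
  using tensor_rels_closed[of "H_gens A"] smash_rels_closed cherednik_rels_closed
  by (auto simp: H_rels_def H_gens_def)

end

sublocale rca_data \<subseteq> H: presentation "H_gens A" "H_rels A"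
  by unfold_locales (rule H_rels_closed)

locale cherednik_module = rca_data A for A :: "'h::ab_group_add rca" +
  fixes M :: "('h, 'm::ab_group_add) hmod"
  assumes H_module: "H_module A M"
begin

sublocale m: vector_space "mscale M"
  using H_module by (simp add: H_module_def)

abbreviation "mlinear \<equiv> Vector_Spaces.linear (mscale M) (mscale M)"

definition act :: "'h falg \<Rightarrow> 'm \<Rightarrow> 'm" where
  "act f = mact M (H_class A f)"

lemma mact_hom: "mact M \<in> Ring.ring_hom (H_alg A) (End_ring (mscale M))"
  using H_module by (simp add: H_module_def)

lemma H_eq: "H_alg A = H.Q" "H_class A = H.cl"
  by (simp_all add: H_alg_def H_class_def)

lemma act_mult: "f \<in> carrier H.F \<Longrightarrow> g \<in> carrier H.F \<Longrightarrow> act (f * g) m = act f (act g m)"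
  using ring_hom_mult[OF mact_hom, of "H_class A f" "H_class A g"]
  by (simp add: act_def H_eq H.cl_mult H.cl_closed End_ring_def)

lemma act_add: "f \<in> carrier H.F \<Longrightarrow> g \<in> carrier H.F \<Longrightarrow> act (f + g) m = act f m + act g m"
  using ring_hom_add[OF mact_hom, of "H_class A f" "H_class A g"]
  by (simp add: act_def H_eq H.cl_add H.cl_closed End_ring_def)

lemma act_one: "act 1 m = m"
  using ring_hom_one[OF mact_hom] by (simp add: act_def H_eq H.cl_one End_ring_def)

lemma act_scalar: "act (scalar a) m = mscale M a m"
  using H_module by (simp add: H_module_def act_def)

lemma act_linear: "f \<in> carrier H.F \<Longrightarrow> mlinear (act f)"
  using ring_hom_closed[OF mact_hom, of "H_class A f"]
  by (simp add: act_def H_eq H.cl_closed End_ring_def)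

lemma act_diff:
  assumes "f \<in> carrier H.F" "g \<in> carrier H.F"
  shows "act (f - g) m = act f m - act g m"
  using act_add[of "f - g" g m] assms by (simp add: free_algebra_closed eq_diff_eq)

lemma act_zero: "act 0 m = 0"
  using act_scalar[of 0 m] by (simp add: scalar_simps)

lemma act_sum:
  assumes "\<And>i. i \<in> I \<Longrightarrow> f i \<in> carrier H.F"
  shows "act (\<Sum>i\<in>I. f i) m = (\<Sum>i\<in>I. act (f i) m)"
  using assms
  by (induction I rule: infinite_finite_induct) (auto simp: act_zero act_add free_algebra_sum_closed)

lemma act_rel: "f - g \<in> H_rels A \<Longrightarrow> act f = act g"
  by (simp add: act_def H_eq H.cl_rel_eqI)

lemma mlinear_simps:
  assumes "mlinear T"
  shows "T (u + v) = T u + T v" "T (mscale M a v) = mscale M a (T v)" "T 0 = 0" "T (u - v) = T u - T v"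
    "T (\<Sum>i\<in>I. f i) = (\<Sum>i\<in>I. T (f i))"
proof -
  interpret Vector_Spaces.linear "mscale M" "mscale M" T by fact
  show "T (u + v) = T u + T v" "T (mscale M a v) = mscale M a (T v)" "T 0 = 0" "T (u - v) = T u - T v"
    "T (\<Sum>i\<in>I. f i) = (\<Sum>i\<in>I. T (f i))"
    by (rule add scale zero diff sum)+
qed

definition X :: "('h \<Rightarrow> complex) \<Rightarrow> 'm \<Rightarrow> 'm" where "X \<xi> = act (lc \<xi>)"
definition Y :: "'h \<Rightarrow> 'm \<Rightarrow> 'm" where "Y v = act (lv v)"

lemma xact_eq: "xact A M i = X (xbas A i)" and yact_eq: "yact A M i = Y (ybas A i)"
  and wact_eq: "wact A M w = act (lg w)"
  by (simp_all add: xact_def yact_def wact_def X_def Y_def act_def)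

lemma X_linear: "\<xi> \<in> dual A \<Longrightarrow> mlinear (X \<xi>)" and Y_linear: "mlinear (Y v)"
  and wact_linear: "w \<in> grp A \<Longrightarrow> mlinear (wact A M w)"
  unfolding X_def Y_def wact_eq by (auto intro!: act_linear)

lemma X_add:
  assumes "\<xi> \<in> dual A" "\<eta> \<in> dual A"
  shows "X (\<lambda>v. \<xi> v + \<eta> v) m = X \<xi> m + X \<eta> m"
proof -
  have "act (lc (\<lambda>v. \<xi> v + \<eta> v)) = act (lc \<xi> + lc \<eta>)"
    by (rule act_rel) (use tensor_relsI(3)[OF assms] in \<open>simp add: H_rels_def diff_diff_eq\<close>)
  then show ?thesis using assms by (simp add: X_def act_add)
qed

lemma X_scale:
  assumes "\<xi> \<in> dual A"
  shows "X (\<lambda>v. a * \<xi> v) m = mscale M a (X \<xi> m)"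
proof -
  have "act (lc (\<lambda>v. a * \<xi> v)) = act (scalar a * lc \<xi>)"
    by (rule act_rel) (use tensor_relsI(4)[OF assms] in \<open>simp add: H_rels_def\<close>)
  then show ?thesis using assms by (simp add: X_def act_mult act_scalar)
qed

lemma Y_add: "Y (u + v) m = Y u m + Y v m"
proof -
  have "act (lv (u + v)) = act (lv u + lv v)"
    by (rule act_rel) (use tensor_relsI(1)[of u v] in \<open>simp add: H_rels_def diff_diff_eq\<close>)
  then show ?thesis by (simp add: Y_def act_add)
qed

lemma Y_scale: "Y (scal A a v) m = mscale M a (Y v m)"
proof -
  have "act (lv (scal A a v)) = act (scalar a * lv v)"
    by (rule act_rel) (use tensor_relsI(2)[of a v] in \<open>simp add: H_rels_def\<close>)
  then show ?thesis by (simp add: Y_def act_mult act_scalar)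
qed

lemma X_expand:
  assumes "\<xi> \<in> dual A"
  shows "X \<xi> m = (\<Sum>i<rk A. mscale M (\<xi> (ybas A i)) (X (xbas A i) m))"
proof -
  have "k \<le> rk A \<Longrightarrow> (\<lambda>v. \<Sum>i<k. \<xi> (ybas A i) * xbas A i v) \<in> dual A \<and>
    X (\<lambda>v. \<Sum>i<k. \<xi> (ybas A i) * xbas A i v) m = (\<Sum>i<k. mscale M (\<xi> (ybas A i)) (X (xbas A i) m))" for k
  proof (induction k)
    case 0
    show ?case using dual_closed(2)[OF assms, of 0] X_scale[OF assms, of 0 m] by simp
  next
    case (Suc k)
    then have x: "xbas A k \<in> dual A" by (intro dual_basis) simp
    show ?case
      using Suc dual_closed(1)[OF _ dual_closed(2)[OF x], of "\<lambda>v. \<Sum>i<k. \<xi> (ybas A i) * xbas A i v" "\<xi> (ybas A k)"]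
        X_add[OF _ dual_closed(2)[OF x], of "\<lambda>v. \<Sum>i<k. \<xi> (ybas A i) * xbas A i v" "\<xi> (ybas A k)" m]
      by (simp add: X_scale[OF x])
  qed
  from this[of "rk A"] have "X (\<lambda>v. \<Sum>i<rk A. \<xi> (ybas A i) * xbas A i v) m
    = (\<Sum>i<rk A. mscale M (\<xi> (ybas A i)) (X (xbas A i) m))" by simp
  moreover have "(\<lambda>v. \<Sum>i<rk A. \<xi> (ybas A i) * xbas A i v) = \<xi>"
    by (rule ext, rule trans[OF _ dual_expand[OF assms, symmetric]]) (simp only: mult.commute)
  ultimately show ?thesis by simp
qed

lemma Y_expand: "Y v m = (\<Sum>i<rk A. mscale M (xbas A i v) (Y (ybas A i) m))"
proof -
  have "Y 0 m = 0" using Y_scale[of 0 0 m] by simp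
  then have "Y (\<Sum>i\<in>I. f i) m = (\<Sum>i\<in>I. Y (f i) m)" for I and f :: "nat \<Rightarrow> 'h"
    by (induction I rule: infinite_finite_induct) (auto simp: Y_add)
  from this[of "\<lambda>i. scal A (xbas A i v) (ybas A i)" "{..<rk A}"]
  show ?thesis by (simp only: y_expand[of v, symmetric] Y_scale)
qed

lemma X_commute:
  assumes "\<xi> \<in> dual A" "\<eta> \<in> dual A"
  shows "X \<xi> (X \<eta> m) = X \<eta> (X \<xi> m)"
proof -
  have "act (lc \<xi> * lc \<eta>) = act (lc \<eta> * lc \<xi>)"
    by (rule act_rel) (use assms in \<open>unfold H_rels_def cherednik_rels_def, blast\<close>)
  then show ?thesis using assms by (simp add: X_def flip: act_mult)
qed

lemma Y_commute: "Y u (Y v m) = Y v (Y u m)"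
proof -
  have "act (lv u * lv v) = act (lv v * lv u)"
    by (rule act_rel) (unfold H_rels_def cherednik_rels_def, blast)
  then show ?thesis by (simp add: Y_def flip: act_mult)
qed

lemma wact_id: "wact A M id m = m"
proof -
  have "act (lg id) = act 1"
    by (rule act_rel) (unfold H_rels_def smash_rels_def, blast)
  then show ?thesis by (simp add: wact_eq act_one)
qed

lemma wact_comp:
  assumes "v \<in> grp A" "w \<in> grp A"
  shows "wact A M (v \<circ> w) m = wact A M v (wact A M w m)"
proof -
  have "act (lg (v \<circ> w)) = act (lg v * lg w)"
    by (rule act_rel) (use assms in \<open>unfold H_rels_def smash_rels_def, blast\<close>)
  then show ?thesis using assms by (simp add: wact_eq act_mult)
qed

lemma wact_Y:
  assumes "w \<in> grp A"
  shows "wact A M w (Y v m) = Y (w v) (wact A M w m)"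
proof -
  have "act (lg w * lv v) = act (lv (w v) * lg w)"
    by (rule act_rel) (use assms in \<open>unfold H_rels_def smash_rels_def, blast\<close>)
  then show ?thesis using assms by (simp add: wact_eq Y_def flip: act_mult)
qed

lemma wact_X:
  assumes "w \<in> grp A" "\<xi> \<in> dual A"
  shows "wact A M w (X \<xi> m) = X (dual_act w \<xi>) (wact A M w m)"
proof -
  have "act (lg w * lc \<xi>) = act (lc (dual_act w \<xi>) * lg w)"
    by (rule act_rel) (use assms in \<open>unfold H_rels_def smash_rels_def, blast\<close>)
  then show ?thesis using assms dual_act_closed[OF assms] by (simp add: wact_eq X_def flip: act_mult)
qed

text \<open>The operator of the commutator of \<open>y\<close> and \<xi>. It is built from scalars
  and group elements alone, so it preserves every \<open>W\<close>-stable subspace of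
  \<open>M\<close>.\<close>

definition Z :: "'h \<Rightarrow> ('h \<Rightarrow> complex) \<Rightarrow> 'm \<Rightarrow> 'm" where
  "Z y \<xi> m = mscale M (par_t A * \<xi> y) m - (\<Sum>s\<in>reflections A.
     mscale M (par_c A s * (root A s y * \<xi> (coroot A s) / root A s (coroot A s))) (wact A M s m))"

lemma Y_X:
  assumes "\<xi> \<in> dual A"
  shows "Y y (X \<xi> m) = X \<xi> (Y y m) + Z y \<xi> m"
proof -
  let ?k = "\<lambda>s. par_c A s * (root A s y * \<xi> (coroot A s) / root A s (coroot A s))"
  let ?z = "scalar (par_t A * \<xi> y) - (\<Sum>s\<in>reflections A. scalar (?k s) * lg s)"
  have c: "scalar (?k s) * lg s \<in> carrier H.F" if "s \<in> reflections A" for s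
    using that reflections_grp by auto
  have zc: "?z \<in> carrier H.F"
    using c by (auto intro!: free_algebra_closed(6) free_algebra_sum_closed)
  have "act (lv y * lc \<xi> - lc \<xi> * lv y) = act ?z"
    by (rule act_rel) (use assms in \<open>unfold H_rels_def cherednik_rels_def, blast\<close>)
  then have "act (lv y * lc \<xi>) m - act (lc \<xi> * lv y) m = act ?z m"
    using assms by (subst act_diff[symmetric]) (auto simp del: mult.assoc)
  also have "act ?z m = Z y \<xi> m"
    using c reflections_grp
    by (simp add: Z_def act_diff free_algebra_sum_closed act_scalar act_sum act_mult wact_eq)
  finally have "act (lv y * lc \<xi>) m - act (lc \<xi> * lv y) m = Z y \<xi> m" .
  then show ?thesis
    using assms by (simp add: X_def Y_def act_mult algebra_simps)
qed

text \<open>The canonical element, the sum of the \<open>x_i \<otimes> y_i\<close>, is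
  \<open>W\<close>-invariant because the matrices of \<open>w\<close> and of its inverse cancel.
  Bilinearity of \<open>B\<close> enters through basis expansions with covectors in
  \<open>dual A\<close>, which suits operators coming from the algebra.\<close>

lemma invariant_pairing:
  assumes x: "\<And>\<xi> v. \<xi> \<in> dual A \<Longrightarrow> B \<xi> v = (\<Sum>j<rk A. mscale M (\<xi> (ybas A j)) (B (xbas A j) v))"
    and y: "\<And>\<xi> v. \<xi> \<in> dual A \<Longrightarrow> B \<xi> v = (\<Sum>k<rk A. mscale M (xbas A k v) (B \<xi> (ybas A k)))"
    and w: "w \<in> grp A"
  shows "(\<Sum>i<rk A. B (dual_act w (xbas A i)) (w (ybas A i))) = (\<Sum>i<rk A. B (xbas A i) (ybas A i))"
proof -
  let ?c = "\<lambda>i j k. xbas A i (inv_into UNIV w (ybas A j)) * xbas A k (w (ybas A i))"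
  have delta: "(\<Sum>i<rk A. ?c i j k) = (if j = k then 1 else 0)" if jk: "j < rk A" "k < rk A" for j k
  proof -
    let ?u = "inv_into UNIV w (ybas A j)"
    have "(\<Sum>i<rk A. ?c i j k) = xbas A k (w (\<Sum>i<rk A. scal A (xbas A i ?u) (ybas A i)))"
      by (simp add: grp_linear[OF w] dual_linear[OF dual_basis(1)[OF jk(2)]])
    also have "\<dots> = xbas A k (ybas A j)" by (simp only: y_expand[symmetric] grp_inv[OF w])
    finally show ?thesis using dual_basis(2)[OF jk(2,1)] by auto
  qed
  have "B (dual_act w (xbas A i)) (w (ybas A i))
    = (\<Sum>j<rk A. \<Sum>k<rk A. mscale M (?c i j k) (B (xbas A j) (ybas A k)))" if i: "i < rk A" for i
  proof -
    have "B (dual_act w (xbas A i)) (w (ybas A i))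
      = (\<Sum>j<rk A. mscale M (xbas A i (inv_into UNIV w (ybas A j))) (B (xbas A j) (w (ybas A i))))"
      by (subst x[OF dual_act_closed[OF w dual_basis(1)[OF i]]]) (simp add: dual_act_apply)
    also have "\<dots> = (\<Sum>j<rk A. \<Sum>k<rk A. mscale M (?c i j k) (B (xbas A j) (ybas A k)))"
    proof (rule sum.cong[OF refl])
      fix j assume "j \<in> {..<rk A}"
      then have "xbas A j \<in> dual A" by (intro dual_basis) simp
      from y[OF this, of "w (ybas A i)"]
      show "mscale M (xbas A i (inv_into UNIV w (ybas A j))) (B (xbas A j) (w (ybas A i)))
        = (\<Sum>k<rk A. mscale M (?c i j k) (B (xbas A j) (ybas A k)))"
        by (simp add: m.scale_sum_right)
    qed
    finally show ?thesis .
  qed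
  then have "(\<Sum>i<rk A. B (dual_act w (xbas A i)) (w (ybas A i)))
    = (\<Sum>i<rk A. \<Sum>j<rk A. \<Sum>k<rk A. mscale M (?c i j k) (B (xbas A j) (ybas A k)))" by simp
  also have "\<dots> = (\<Sum>j<rk A. \<Sum>k<rk A. mscale M (\<Sum>i<rk A. ?c i j k) (B (xbas A j) (ybas A k)))"
    by (subst sum.swap, rule sum.cong[OF refl], subst sum.swap) (simp only: m.scale_sum_left)
  also have "\<dots> = (\<Sum>j<rk A. \<Sum>k<rk A. if j = k then B (xbas A j) (ybas A k) else 0)"
    by (intro sum.cong refl) (simp add: delta)
  also have "\<dots> = (\<Sum>i<rk A. B (xbas A i) (ybas A i))" by simp
  finally show ?thesis .
qed

text \<open>Moving \<open>w\<close> past the generators translates both dual bases, and the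
  canonical element does not notice. This keeps translates of Euler-stable spans
  Euler-stable.\<close>

lemma euler_wact:
  assumes w: "w \<in> grp A"
  shows "euler A M (wact A M w m) = wact A M w (euler A M m)"
proof -
  let ?B = "\<lambda>\<xi> v. X \<xi> (Y v (wact A M w m))"
  have "wact A M w (euler A M m) = (\<Sum>i<rk A. ?B (dual_act w (xbas A i)) (w (ybas A i)))"
    by (simp add: euler_def xact_eq yact_eq mlinear_simps(5)[OF wact_linear[OF w]] wact_X[OF w]
        wact_Y[OF w] dual_basis)
  also have "\<dots> = (\<Sum>i<rk A. ?B (xbas A i) (ybas A i))"
  proof (rule invariant_pairing[where B = ?B, OF _ _ w])
    fix \<xi> v assume x: "\<xi> \<in> dual A"
    show "?B \<xi> v = (\<Sum>j<rk A. mscale M (\<xi> (ybas A j)) (?B (xbas A j) v))"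
      by (rule X_expand[OF x])
    show "?B \<xi> v = (\<Sum>k<rk A. mscale M (xbas A k v) (?B \<xi> (ybas A k)))"
      by (subst Y_expand) (simp add: mlinear_simps[OF X_linear[OF x]])
  qed
  finally show ?thesis by (simp add: euler_def xact_eq yact_eq)
qed

end

section \<open>Operators on \<open>M \<otimes> S\<close>\<close>

lemma MS_closed: "0 \<in> MS A" "\<phi> \<in> MS A \<Longrightarrow> \<psi> \<in> MS A \<Longrightarrow> \<phi> + \<psi> \<in> MS A"
  by (auto simp: MS_def pointwise)

context cherednik_module
begin

definition spinor_scale :: "complex \<Rightarrow> 'm spinors \<Rightarrow> 'm spinors" where
  "spinor_scale a \<psi> = (\<lambda>I. mscale M a (\<psi> I))"

lemma spinor_scale_apply: "spinor_scale a \<psi> J = mscale M a (\<psi> J)"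
  by (simp add: spinor_scale_def)

sublocale s: vector_space spinor_scale
  by unfold_locales (simp_all add: spinor_scale_def pointwise algebra_simps)

abbreviation "slinear \<equiv> Vector_Spaces.linear spinor_scale spinor_scale"

lemma slinearI:
  assumes "\<And>\<phi> \<psi>. T (\<phi> + \<psi>) = T \<phi> + T \<psi>" "\<And>a \<psi>. T (spinor_scale a \<psi>) = spinor_scale a (T \<psi>)"
  shows "slinear T"
  by unfold_locales (use assms in auto)

lemma slinear_simps:
  assumes "slinear T"
  shows "T (\<phi> + \<psi>) = T \<phi> + T \<psi>" "T (spinor_scale a \<psi>) = spinor_scale a (T \<psi>)" "T 0 = 0"
    "T (\<phi> - \<psi>) = T \<phi> - T \<psi>" "T (\<Sum>i\<in>I. f i) = (\<Sum>i\<in>I. T (f i))"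
proof -
  interpret Vector_Spaces.linear spinor_scale spinor_scale T by fact
  show "T (\<phi> + \<psi>) = T \<phi> + T \<psi>" "T (spinor_scale a \<psi>) = spinor_scale a (T \<psi>)" "T 0 = 0"
    "T (\<phi> - \<psi>) = T \<phi> - T \<psi>" "T (\<Sum>i\<in>I. f i) = (\<Sum>i\<in>I. T (f i))"
    by (rule add scale zero diff sum)+
qed

abbreviation "tens \<equiv> tensor_op A M"

lemma tensor_op_apply: "tens S T \<psi> J = (\<Sum>I\<in>Pow {..<rk A}. mscale M (T (blade I) J) (S (\<psi> I)))"
  by (simp add: tensor_op_def)

lemma tensor_op_closed:
  assumes "\<And>I. I \<subseteq> {..<rk A} \<Longrightarrow> T (blade I) \<in> ext_space A"
  shows "tens S T \<psi> \<in> MS A"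
  using assms by (auto simp: MS_def tensor_op_def ext_space_def intro!: sum.neutral)

lemma tensor_op_linear:
  assumes "mlinear S"
  shows "slinear (tens S T)"
  by (rule slinearI)
    (simp_all add: pointwise tensor_op_apply spinor_scale_apply mlinear_simps[OF assms]
      m.scale_right_distrib sum.distrib m.scale_sum_right mult.commute)

lemma tensor_op_cong:
  assumes "\<And>m. S m = S' m" "\<And>\<omega>. \<omega> \<in> ext_space A \<Longrightarrow> T \<omega> = T' \<omega>"
  shows "tens S T \<psi> = tens S' T' \<psi>"
  unfolding tensor_op_def by (intro ext sum.cong refl) (simp add: assms ext_space_closed(4))

text \<open>\<open>tensor_op\<close> sums over blades inside \<open>{..<rk A}\<close> only; the
  closure hypothesis on \<open>T'\<close> ensures that no component of the intermediate element is
  lost.\<close>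

lemma tensor_op_comp:
  assumes S: "mlinear S" and T: "ext_linear T" and T': "\<And>I. I \<subseteq> {..<rk A} \<Longrightarrow> T' (blade I) \<in> ext_space A"
  shows "tens S T (tens S' T' \<psi>) = tens (\<lambda>m. S (S' m)) (\<lambda>\<omega>. T (T' \<omega>)) \<psi>"
proof
  fix J
  have "tens S T (tens S' T' \<psi>) J = (\<Sum>I\<in>Pow {..<rk A}. \<Sum>K\<in>Pow {..<rk A}.
      mscale M (T' (blade K) I * T (blade I) J) (S (S' (\<psi> K))))"
    by (simp add: tensor_op_apply mlinear_simps[OF S] m.scale_sum_right mult.commute)
  also have "\<dots> = (\<Sum>K\<in>Pow {..<rk A}. \<Sum>I\<in>Pow {..<rk A}.
      mscale M (T' (blade K) I * T (blade I) J) (S (S' (\<psi> K))))"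
    by (rule sum.swap)
  also have "\<dots> = (\<Sum>K\<in>Pow {..<rk A}. mscale M (T (T' (blade K)) J) (S (S' (\<psi> K))))"
    by (rule sum.cong[OF refl]) (simp add: ext_linear_expand[OF T T'] m.scale_sum_left)
  finally show "tens S T (tens S' T' \<psi>) J = tens (\<lambda>m. S (S' m)) (\<lambda>\<omega>. T (T' \<omega>)) \<psi> J"
    by (simp add: tensor_op_apply)
qed

lemma tensor_op_id:
  assumes "\<psi> \<in> MS A"
  shows "tens S (\<lambda>\<omega>. \<omega>) \<psi> J = (if J \<subseteq> {..<rk A} then S (\<psi> J) else 0)"
proof -
  have "tens S (\<lambda>\<omega>. \<omega>) \<psi> J = (\<Sum>I\<in>Pow {..<rk A}. if I = J then S (\<psi> J) else 0)"
    unfolding tensor_op_apply by (rule sum.cong) (auto simp: blade_def)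
  then show ?thesis by simp
qed

lemma tensor_op_scale_right: "tens S (\<lambda>\<omega>. ext_scale a (T \<omega>)) \<psi> = spinor_scale a (tens S T \<psi>)"
  by (simp add: pointwise tensor_op_apply spinor_scale_apply m.scale_sum_right)

lemma tensor_op_scale_left: "tens (\<lambda>m. mscale M a (S m)) T \<psi> = spinor_scale a (tens S T \<psi>)"
  by (simp add: pointwise tensor_op_apply spinor_scale_apply m.scale_sum_right mult.commute)

lemma tensor_op_add_right: "tens S (\<lambda>\<omega>. T \<omega> + T' \<omega>) \<psi> = tens S T \<psi> + tens S T' \<psi>"
  by (simp add: pointwise tensor_op_apply m.scale_left_distrib sum.distrib)

lemma tensor_op_add_left: "tens (\<lambda>m. S m + S' m) T \<psi> = tens S T \<psi> + tens S' T \<psi>"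
  by (simp add: pointwise tensor_op_apply m.scale_right_distrib sum.distrib)

lemma tensor_op_sum_right: "tens S (\<lambda>\<omega>. \<Sum>i\<in>I. T i \<omega>) \<psi> = (\<Sum>i\<in>I. tens S (T i) \<psi>)"
  by (rule ext) (simp add: sum_fun_apply tensor_op_apply m.scale_sum_left sum.swap[of _ I])

lemma tensor_op_sum_left: "tens (\<lambda>m. \<Sum>i\<in>I. S i m) T \<psi> = (\<Sum>i\<in>I. tens (S i) T \<psi>)"
  by (rule ext) (simp add: sum_fun_apply tensor_op_apply m.scale_sum_right sum.swap[of _ I])

section \<open>The two Koszul differentials\<close>

abbreviation "dx \<equiv> coh_d A M"
abbreviation "dy \<equiv> hom_d A M"

lemma dx_eq: "dx \<psi> = (\<Sum>i<rk A. tens (X (xbas A i)) (wedge A (ybas A i)) \<psi>)"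
  by (simp add: coh_d_def pointwise(1) sum_fun_apply xact_eq[abs_def])

lemma dy_eq: "dy \<psi> = (\<Sum>i<rk A. tens (Y (ybas A i)) (contract A (xbas A i)) \<psi>)"
  by (simp add: hom_d_def pointwise(1) sum_fun_apply yact_eq[abs_def])

lemma Dx_eq: "Dx A M = dx"
proof
  fix \<psi>
  have "tens (xact A M i) (spin A (cliff_class A (lv (ybas A i)))) \<psi> = tens (xact A M i) (wedge A (ybas A i)) \<psi>" for i
    by (rule tensor_op_cong) (simp_all add: spin_class spin_lv)
  then show "Dx A M \<psi> = dx \<psi>" by (simp add: Dx_def coh_d_def)
qed

lemma Dy_eq: "Dy A M \<psi> = spinor_scale 2 (dy \<psi>)"
proof -
  have "tens (yact A M i) (spin A (cliff_class A (lc (xbas A i)))) \<psi>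
    = tens (yact A M i) (\<lambda>\<omega>. ext_scale 2 (contract A (xbas A i) \<omega>)) \<psi>" for i
    by (rule tensor_op_cong) (simp_all add: spin_class spin_lc)
  then show ?thesis
    by (simp add: Dy_def hom_d_def tensor_op_scale_right pointwise(1) spinor_scale_apply m.scale_sum_right)
qed

lemma slinear_sum: "(\<And>i. i \<in> I \<Longrightarrow> slinear (T i)) \<Longrightarrow> slinear (\<lambda>\<psi>. \<Sum>i\<in>I. T i \<psi>)"
proof (rule slinearI)
  fix \<phi> \<psi> a assume T: "\<And>i. i \<in> I \<Longrightarrow> slinear (T i)"
  show "(\<Sum>i\<in>I. T i (\<phi> + \<psi>)) = (\<Sum>i\<in>I. T i \<phi>) + (\<Sum>i\<in>I. T i \<psi>)"
    unfolding sum.distrib[symmetric] by (rule sum.cong[OF refl]) (rule slinear_simps(1)[OF T])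
  show "(\<Sum>i\<in>I. T i (spinor_scale a \<psi>)) = spinor_scale a (\<Sum>i\<in>I. T i \<psi>)"
    unfolding s.scale_sum_right by (rule sum.cong[OF refl]) (rule slinear_simps(2)[OF T])
qed

lemma dx_linear: "slinear dx"
  unfolding dx_eq[abs_def] by (rule slinear_sum, rule tensor_op_linear, rule X_linear, rule dual_basis) simp

lemma dy_linear: "slinear dy"
  unfolding dy_eq[abs_def] by (rule slinear_sum, rule tensor_op_linear, rule Y_linear)

lemma MS_sum: "(\<And>i. i \<in> I \<Longrightarrow> f i \<in> MS A) \<Longrightarrow> (\<Sum>i\<in>I. f i) \<in> MS A"
  by (induction I rule: infinite_finite_induct) (auto simp: MS_closed)

lemma MS_scale: "\<psi> \<in> MS A \<Longrightarrow> spinor_scale a \<psi> \<in> MS A"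
  by (auto simp: MS_def spinor_scale_apply)

lemma dx_closed: "dx \<psi> \<in> MS A"
  unfolding dx_eq by (rule MS_sum, rule tensor_op_closed, rule wedge_closed)

lemma dy_closed: "dy \<psi> \<in> MS A"
  unfolding dy_eq by (rule MS_sum, rule tensor_op_closed, rule contract_closed)

lemma spinor_eq_neg_self:
  fixes \<psi> :: "'m spinors"
  assumes "\<psi> = - \<psi>"
  shows "\<psi> = 0"
proof -
  have "spinor_scale 2 \<psi> = \<psi> + \<psi>" using s.scale_left_distrib[of 1 1 \<psi>] by simp
  also have "\<dots> = 0" using assms by (metis add.right_inverse)
  finally show ?thesis by simp
qed

text \<open>Commuting operators on \<open>M\<close> stand against anticommuting ones on the exterior
  algebra, so exchanging \<open>i\<close> and \<open>j\<close> turns the double sum into its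
  negative. Both differentials square to zero for this reason.\<close>

lemma antisymmetric_sum:
  assumes comm: "\<And>i j m. i < rk A \<Longrightarrow> j < rk A \<Longrightarrow> S i (S j m) = S j (S i m)"
    and anti: "\<And>i j \<omega>. i < rk A \<Longrightarrow> j < rk A \<Longrightarrow> \<omega> \<in> ext_space A \<Longrightarrow> T i (T j \<omega>) = - T j (T i \<omega>)"
    and S: "\<And>i. i < rk A \<Longrightarrow> mlinear (S i)" and T: "\<And>i. ext_linear (T i)" and Tc: "\<And>i \<omega>. T i \<omega> \<in> ext_space A"
  shows "(\<Sum>i<rk A. tens (S i) (T i) (\<Sum>j<rk A. tens (S j) (T j) \<psi>)) = 0"
proof -
  let ?f = "\<lambda>i j. tens (\<lambda>m. S i (S j m)) (\<lambda>\<omega>. T i (T j \<omega>)) \<psi>"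
  have "tens (S i) (T i) (\<Sum>j<rk A. tens (S j) (T j) \<psi>) = (\<Sum>j<rk A. ?f i j)" if "i < rk A" for i
    using S[OF that] by (simp add: slinear_simps(5)[OF tensor_op_linear] tensor_op_comp[OF S[OF that] T Tc])
  then have sum: "(\<Sum>i<rk A. tens (S i) (T i) (\<Sum>j<rk A. tens (S j) (T j) \<psi>)) = (\<Sum>i<rk A. \<Sum>j<rk A. ?f i j)"
    by simp
  have neg: "?f i j = - ?f j i" if ij: "i < rk A" "j < rk A" for i j
  proof -
    have "?f i j = tens (\<lambda>m. S j (S i m)) (\<lambda>\<omega>. ext_scale (-1) (T j (T i \<omega>))) \<psi>"
      by (rule tensor_op_cong) (rule comm[OF ij], simp add: anti[OF ij])
    then show ?thesis unfolding tensor_op_scale_right by simp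
  qed
  have "(\<Sum>i<rk A. \<Sum>j<rk A. ?f i j) = (\<Sum>i<rk A. \<Sum>j<rk A. - ?f j i)"
    by (intro sum.cong refl) (rule neg, simp_all)
  also have "\<dots> = - (\<Sum>i<rk A. \<Sum>j<rk A. ?f i j)"
    by (simp add: sum_negf) (rule sum.swap)
  finally show ?thesis unfolding sum by (rule spinor_eq_neg_self)
qed

lemma dx_dx: "dx (dx \<psi>) = 0"
  unfolding dx_eq
  by (rule antisymmetric_sum)
    (simp_all add: X_commute X_linear dual_basis wedge_linear wedge_closed, rule wedge_wedge)

lemma dy_dy: "dy (dy \<psi>) = 0"
  unfolding dy_eq
  by (rule antisymmetric_sum)
    (rule Y_commute, erule contract_contract, rule Y_linear, rule contract_linear, rule contract_closed)

section \<open>The diagonal action of the reflection group on spinors\<close>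

definition R :: "('h \<Rightarrow> 'h) \<Rightarrow> 'm spinors \<Rightarrow> 'm spinors" where
  "R w = tens (wact A M w) (ext_act A w)"

lemma R_linear: "w \<in> grp A \<Longrightarrow> slinear (R w)"
  unfolding R_def by (rule tensor_op_linear[OF wact_linear])

lemma R_closed: "R w \<psi> \<in> MS A"
  unfolding R_def by (rule tensor_op_closed, rule ext_act_closed)

lemma R_comp:
  assumes "v \<in> grp A" "w \<in> grp A"
  shows "R (v \<circ> w) \<psi> = R v (R w \<psi>)"
  unfolding R_def tensor_op_comp[OF wact_linear[OF assms(1)] ext_act_linear ext_act_closed]
  by (rule tensor_op_cong) (simp_all add: wact_comp ext_act_comp assms)

lemma R_id: "\<psi> \<in> MS A \<Longrightarrow> R id \<psi> = \<psi>"
proof -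
  assume "\<psi> \<in> MS A"
  have "R id \<psi> = tens (\<lambda>m. m) (\<lambda>\<omega>. \<omega>) \<psi>"
    unfolding R_def by (rule tensor_op_cong) (simp_all add: wact_id ext_act_id)
  then show ?thesis using \<open>\<psi> \<in> MS A\<close> by (auto simp: tensor_op_id MS_def pointwise(1))
qed

lemma invariant_tensor:
  assumes x: "\<And>\<xi> v. \<xi> \<in> dual A \<Longrightarrow> B \<xi> v = (\<Sum>j<rk A. spinor_scale (\<xi> (ybas A j)) (B (xbas A j) v))"
    and y: "\<And>\<xi> v. \<xi> \<in> dual A \<Longrightarrow> B \<xi> v = (\<Sum>k<rk A. spinor_scale (xbas A k v) (B \<xi> (ybas A k)))"
    and w: "w \<in> grp A"
  shows "(\<Sum>i<rk A. B (dual_act w (xbas A i)) (w (ybas A i))) = (\<Sum>i<rk A. B (xbas A i) (ybas A i))"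
proof
  fix J
  have "(\<Sum>i<rk A. B (dual_act w (xbas A i)) (w (ybas A i)) J) = (\<Sum>i<rk A. B (xbas A i) (ybas A i) J)"
  proof (rule invariant_pairing[where B = "\<lambda>\<xi> v. B \<xi> v J", OF _ _ w])
    fix \<xi> v assume \<xi>: "\<xi> \<in> dual A"
    show "B \<xi> v J = (\<Sum>j<rk A. mscale M (\<xi> (ybas A j)) (B (xbas A j) v J))"
      using fun_cong[OF x[OF \<xi>], of v J] by (simp only: sum_fun_apply spinor_scale_apply)
    show "B \<xi> v J = (\<Sum>k<rk A. mscale M (xbas A k v) (B \<xi> (ybas A k) J))"
      using fun_cong[OF y[OF \<xi>], of v J] by (simp only: sum_fun_apply spinor_scale_apply)
  qed
  then show "(\<Sum>i<rk A. B (dual_act w (xbas A i)) (w (ybas A i))) J = (\<Sum>i<rk A. B (xbas A i) (ybas A i)) J"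
    by (simp add: sum_fun_apply)
qed

lemma X_expand_tensor: "\<xi> \<in> dual A \<Longrightarrow> tens (X \<xi>) T \<psi> = (\<Sum>j<rk A. spinor_scale (\<xi> (ybas A j)) (tens (X (xbas A j)) T \<psi>))"
  by (simp only: tensor_op_cong[OF X_expand refl] tensor_op_sum_left tensor_op_scale_left)

lemma Y_expand_tensor: "tens (Y v) T \<psi> = (\<Sum>j<rk A. spinor_scale (xbas A j v) (tens (Y (ybas A j)) T \<psi>))"
  by (subst Y_expand[abs_def]) (simp add: tensor_op_sum_left tensor_op_scale_left)

lemma wedge_expand: "wedge A v \<omega> = (\<Sum>i<rk A. ext_scale (xbas A i v) (wedge A (ybas A i) \<omega>))"
  by (simp add: wedge_eq_create[of A v] wedge_ybas)

lemma contract_expand: "contract A \<xi> \<omega> = (\<Sum>i<rk A. ext_scale (\<xi> (ybas A i)) (contract A (xbas A i) \<omega>))"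
  by (simp add: contract_eq_annihilate[of A \<xi>] contract_xbas)

lemma wedge_expand_tensor: "tens S (wedge A v) \<psi> = (\<Sum>j<rk A. spinor_scale (xbas A j v) (tens S (wedge A (ybas A j)) \<psi>))"
  by (subst wedge_expand[abs_def]) (simp add: tensor_op_sum_right tensor_op_scale_right)

lemma contract_expand_tensor: "tens S (contract A \<xi>) \<psi> = (\<Sum>j<rk A. spinor_scale (\<xi> (ybas A j)) (tens S (contract A (xbas A j)) \<psi>))"
  by (subst contract_expand[abs_def]) (simp add: tensor_op_sum_right tensor_op_scale_right)

text \<open>Moving \<open>w\<close> past each summand replaces the dual bases by their translates,
  which leaves the canonical element unchanged.\<close>

lemma R_dx:
  assumes w: "w \<in> grp A"
  shows "R w (dx \<psi>) = dx (R w \<psi>)"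
proof -
  let ?B = "\<lambda>\<xi> v. tens (X \<xi>) (wedge A v) (R w \<psi>)"
  have "R w (tens (X (xbas A i)) (wedge A (ybas A i)) \<psi>) = ?B (dual_act w (xbas A i)) (w (ybas A i))"
    if "i < rk A" for i
  proof -
    have x: "xbas A i \<in> dual A" by (rule dual_basis(1)[OF that])
    show ?thesis
      unfolding R_def tensor_op_comp[OF wact_linear[OF w] ext_act_linear wedge_closed]
        tensor_op_comp[OF X_linear[OF dual_act_closed[OF w x]] wedge_linear ext_act_closed]
      by (rule tensor_op_cong) (simp_all add: wact_X[OF w x] ext_act_wedge[OF w])
  qed
  then have "R w (dx \<psi>) = (\<Sum>i<rk A. ?B (dual_act w (xbas A i)) (w (ybas A i)))"
    by (simp add: dx_eq slinear_simps(5)[OF R_linear[OF w]])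
  also have "\<dots> = (\<Sum>i<rk A. ?B (xbas A i) (ybas A i))"
    by (rule invariant_tensor[where B = ?B, OF _ _ w]) (erule X_expand_tensor, rule wedge_expand_tensor)
  finally show ?thesis by (simp add: dx_eq)
qed

lemma R_dy:
  assumes w: "w \<in> grp A"
  shows "R w (dy \<psi>) = dy (R w \<psi>)"
proof -
  let ?B = "\<lambda>\<xi> v. tens (Y v) (contract A \<xi>) (R w \<psi>)"
  have "R w (tens (Y (ybas A i)) (contract A (xbas A i)) \<psi>) = ?B (dual_act w (xbas A i)) (w (ybas A i))"
    if "i < rk A" for i
  proof -
    have x: "xbas A i \<in> dual A" by (rule dual_basis(1)[OF that])
    show ?thesis
      unfolding R_def tensor_op_comp[OF wact_linear[OF w] ext_act_linear contract_closed]
        tensor_op_comp[OF Y_linear contract_linear ext_act_closed]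
      by (rule tensor_op_cong) (simp_all add: wact_Y[OF w] ext_act_contract[OF w x])
  qed
  then have "R w (dy \<psi>) = (\<Sum>i<rk A. ?B (dual_act w (xbas A i)) (w (ybas A i)))"
    by (simp add: dy_eq slinear_simps(5)[OF R_linear[OF w]])
  also have "\<dots> = (\<Sum>i<rk A. ?B (xbas A i) (ybas A i))"
    by (rule invariant_tensor[where B = ?B, OF _ _ w]) (rule contract_expand_tensor, rule Y_expand_tensor)
  finally show ?thesis by (simp add: dy_eq)
qed

end

section \<open>The representations on \<open>M \<otimes> S\<close>\<close>

context cherednik_module
begin

lemma MS_rep_simps [simp]:
  "carrier (MS_rep A M a) = MS A" "\<zero>\<^bsub>MS_rep A M a\<^esub> = 0" "\<phi> \<oplus>\<^bsub>MS_rep A M a\<^esub> \<psi> = \<phi> + \<psi>"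
  "z \<odot>\<^bsub>MS_rep A M a\<^esub> \<psi> = spinor_scale z \<psi>" "ract (MS_rep A M a) = a"
  by (simp_all add: MS_rep_def spinor_scale_def zero_fun_def plus_fun_def)

lemma MS_rep_module: "Module.module complex_field (MS_rep A M a)"
proof (rule moduleI[OF cring_complex_field])
  show "abelian_group (MS_rep A M a)"
  proof (rule abelian_groupI)
    fix \<psi> assume "\<psi> \<in> carrier (MS_rep A M a)"
    then show "\<exists>\<phi>\<in>carrier (MS_rep A M a). \<phi> \<oplus>\<^bsub>MS_rep A M a\<^esub> \<psi> = \<zero>\<^bsub>MS_rep A M a\<^esub>"
      using MS_scale[of \<psi> "-1"] by (intro bexI[of _ "spinor_scale (-1) \<psi>"]) auto
  qed (auto simp: MS_closed add_ac)
qed (auto simp: MS_closed MS_scale s.scale_left_distrib s.scale_right_distrib)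

lemma spinor_ract:
  assumes g: "g \<in> carrier (Wtilde A)"
  shows "ract (spinor_rep A M) g \<psi> = spinor_scale (chi A g) (R (cover A g) \<psi>)"
proof -
  have "tens (wact A M (cover A g)) (spin A g) \<psi>
    = tens (wact A M (cover A g)) (\<lambda>\<omega>. ext_scale (chi A g) (ext_act A (cover A g) \<omega>)) \<psi>"
    by (rule tensor_op_cong) (use cover_spec(2)[OF g] in \<open>simp_all add: lifts_def\<close>)
  then show ?thesis by (simp add: spinor_rep_def tensor_op_scale_right R_def)
qed

lemma ext_ract: "ract (ext_rep A M) g = R (cover A g)"
  by (simp add: ext_rep_def R_def fun_eq_iff)

lemma is_rep_ext: "is_rep (Wtilde A) (ext_rep A M)"
  unfolding is_rep_def ext_ract
proof (intro conjI ballI allI)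
  show "Module.module complex_field (ext_rep A M)" unfolding ext_rep_def by (rule MS_rep_module)
qed (auto simp: ext_rep_def R_closed R_comp R_id cover_mult[simplified] cover_one[simplified] cover_closed
    slinear_simps[OF R_linear[OF cover_closed]])

lemma is_rep_spinor: "is_rep (Wtilde A) (spinor_rep A M)"
proof -
  have one: "\<one>\<^bsub>Wtilde A\<^esub> \<in> carrier (Wtilde A)"
    by (rule monoid.one_closed[OF group.is_monoid[OF group_Wtilde]])
  have mult: "g \<otimes>\<^bsub>Wtilde A\<^esub> h \<in> carrier (Wtilde A)" if "g \<in> carrier (Wtilde A)" "h \<in> carrier (Wtilde A)" for g h
    using that by (rule monoid.m_closed[OF group.is_monoid[OF group_Wtilde]])
  have "Module.module complex_field (spinor_rep A M)" unfolding spinor_rep_def by (rule MS_rep_module)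
  moreover have c: "carrier (spinor_rep A M) = MS A" "\<phi> \<oplus>\<^bsub>spinor_rep A M\<^esub> \<psi> = \<phi> + \<psi>"
    "z \<odot>\<^bsub>spinor_rep A M\<^esub> \<psi> = spinor_scale z \<psi>" for \<phi> \<psi> z by (simp_all add: spinor_rep_def)
  ultimately show ?thesis
    unfolding is_rep_def
    by (auto simp del: Wtilde_simps simp: c spinor_ract one mult R_closed MS_scale
        slinear_simps[OF R_linear[OF cover_closed]]
        chi_one cover_one R_id chi_mult cover_mult R_comp cover_closed s.scale_right_distrib mult.commute)
qed

text \<open>Formulated with \<open>R\<close> instead of the double cover: the two actions of a cover
  element differ by the scalar \<open>chi\<close>, so a stable subspace is a subrepresentation of
  \<open>spinor_rep\<close> and of \<open>ext_rep\<close> alike.\<close>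

definition stable :: "'m spinors set \<Rightarrow> bool" where
  "stable U \<longleftrightarrow> U \<subseteq> MS A \<and> s.subspace U \<and> (\<forall>w\<in>grp A. \<forall>\<psi>\<in>U. R w \<psi> \<in> U)"

lemma stable_subrep:
  assumes "stable U" "U \<subseteq> K"
  shows "is_subrep (Wtilde A) (subrep (spinor_rep A M) K) U" "is_subrep (Wtilde A) (subrep (ext_rep A M) K) U"
proof -
  have c: "\<zero>\<^bsub>spinor_rep A M\<^esub> = 0" "\<phi> \<oplus>\<^bsub>spinor_rep A M\<^esub> \<psi> = \<phi> + \<psi>"
    "z \<odot>\<^bsub>spinor_rep A M\<^esub> \<psi> = spinor_scale z \<psi>" "\<zero>\<^bsub>ext_rep A M\<^esub> = 0" "\<phi> \<oplus>\<^bsub>ext_rep A M\<^esub> \<psi> = \<phi> + \<psi>"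
    "z \<odot>\<^bsub>ext_rep A M\<^esub> \<psi> = spinor_scale z \<psi>" for \<phi> \<psi> z by (simp_all add: spinor_rep_def ext_rep_def)
  show "is_subrep (Wtilde A) (subrep (spinor_rep A M) K) U" "is_subrep (Wtilde A) (subrep (ext_rep A M) K) U"
    using assms unfolding is_subrep_def
    by (auto simp: stable_def c s.subspace_def spinor_ract ext_ract cover_closed)
qed

lemma stable_is_subrep:
  assumes "stable U"
  shows "is_subrep (Wtilde A) (spinor_rep A M) U" "is_subrep (Wtilde A) (ext_rep A M) U"
proof -
  have "U \<subseteq> MS A" using assms by (simp add: stable_def)
  from stable_subrep[OF assms this]
  show "is_subrep (Wtilde A) (spinor_rep A M) U" "is_subrep (Wtilde A) (ext_rep A M) U"
    by (simp_all add: is_subrep_def spinor_rep_def ext_rep_def)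
qed

lemma ker_on_iff: "\<psi> \<in> ker_on A T \<longleftrightarrow> \<psi> \<in> MS A \<and> T \<psi> = 0"
  by (simp add: ker_on_def zero_fun_def)

lemma stable_ker:
  assumes T: "slinear T" and R: "\<And>w \<psi>. w \<in> grp A \<Longrightarrow> R w (T \<psi>) = T (R w \<psi>)"
  shows "stable (ker_on A T)"
  unfolding stable_def
proof (intro conjI ballI)
  show "s.subspace (ker_on A T)"
    by (rule s.subspaceI) (auto simp: ker_on_iff MS_closed MS_scale slinear_simps[OF T])
  fix w \<psi> assume "w \<in> grp A" "\<psi> \<in> ker_on A T"
  then show "R w \<psi> \<in> ker_on A T"
    using R[of w \<psi>] by (simp add: ker_on_iff R_closed slinear_simps(3)[OF R_linear])
qed (auto simp: ker_on_iff)

lemma stable_im: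
  assumes T: "slinear T" and R: "\<And>w \<psi>. w \<in> grp A \<Longrightarrow> R w (T \<psi>) = T (R w \<psi>)" and closed: "\<And>\<psi>. T \<psi> \<in> MS A"
  shows "stable (im_on A T)"
  unfolding stable_def
proof (intro conjI ballI)
  show "s.subspace (im_on A T)"
  proof (rule s.subspaceI)
    show "0 \<in> im_on A T"
      unfolding im_on_def using slinear_simps(3)[OF T] by (intro image_eqI[of _ _ 0]) (auto simp: MS_closed)
  next
    fix \<phi> \<psi> assume "\<phi> \<in> im_on A T" "\<psi> \<in> im_on A T"
    then obtain p q where "p \<in> MS A" "q \<in> MS A" "\<phi> = T p" "\<psi> = T q" by (auto simp: im_on_def)
    then show "\<phi> + \<psi> \<in> im_on A T"
      unfolding im_on_def by (intro image_eqI[of _ _ "p + q"]) (auto simp: MS_closed slinear_simps[OF T])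
  next
    fix a \<psi> assume "\<psi> \<in> im_on A T"
    then obtain q where "q \<in> MS A" "\<psi> = T q" by (auto simp: im_on_def)
    then show "spinor_scale a \<psi> \<in> im_on A T"
      unfolding im_on_def by (intro image_eqI[of _ _ "spinor_scale a q"]) (auto simp: MS_scale slinear_simps[OF T])
  qed
  fix w \<psi> assume "w \<in> grp A" "\<psi> \<in> im_on A T"
  then show "R w \<psi> \<in> im_on A T"
    using R R_closed by (fastforce simp: im_on_def)
qed (auto simp: im_on_def closed)

text \<open>Both quotients have the same cosets, addition and scalars, and by
  \<open>spinor_ract\<close> their actions differ by exactly \<open>chi\<close>. The isomorphism is
  the identity map.\<close>

lemma quotient_twist_iso:
  assumes K: "stable K" and N: "stable N" "N \<subseteq> K"
  shows "rep_iso (Wtilde A) (quotrep (subrep (spinor_rep A M) K) N)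
    (twist (chi A) (quotrep (subrep (ext_rep A M) K) N))"
proof -
  let ?V = "subrep (spinor_rep A M) K" and ?E = "subrep (ext_rep A M) K"
  interpret V: rep_quotient "Wtilde A" ?V N
    using group_Wtilde subrep_is_rep[OF is_rep_spinor stable_is_subrep(1)[OF K]] stable_subrep(1)[OF N]
    by (rule rep_quotient.intro)
  interpret E: rep_quotient "Wtilde A" ?E N
    using group_Wtilde subrep_is_rep[OF is_rep_ext stable_is_subrep(2)[OF K]] stable_subrep(2)[OF N]
    by (rule rep_quotient.intro)
  have coset: "N +>\<^bsub>?E\<^esub> v = N +>\<^bsub>?V\<^esub> v" for v
    by (simp add: a_r_coset_def' spinor_rep_def ext_rep_def)
  define r where "r g v = chi A g \<odot>\<^bsub>quotrep ?E N\<^esub> ract (quotrep ?E N) g v" for g v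
  \<comment> \<open>Everything except the action agrees literally. The action \<open>r\<close> is
    compared with that of the spinor quotient on cosets of \<open>K\<close> only, hence the appeal
    to \<open>is_rep_ract_cong\<close> below.\<close>
  have eq: "twist (chi A) (quotrep ?E N) = (quotrep ?V N)\<lparr>ract := r\<rparr>"
  proof (rule rep.equality)
    show "carrier (twist (chi A) (quotrep ?E N)) = carrier ((quotrep ?V N)\<lparr>ract := r\<rparr>)"
      by (simp add: twist_def set_eq_iff V.carrier_quot E.carrier_quot coset)
    show "add (twist (chi A) (quotrep ?E N)) = add ((quotrep ?V N)\<lparr>ract := r\<rparr>)"
      by (simp add: twist_def quotrep_def set_add_def' spinor_rep_def ext_rep_def fun_eq_iff)
    show "smult (twist (chi A) (quotrep ?E N)) = smult ((quotrep ?V N)\<lparr>ract := r\<rparr>)"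
      by (simp add: twist_def quotrep_def coset) (simp add: spinor_rep_def ext_rep_def)
    show "ract (twist (chi A) (quotrep ?E N)) = ract ((quotrep ?V N)\<lparr>ract := r\<rparr>)"
      by (simp add: twist_def r_def[abs_def])
  qed (simp_all add: twist_def quotrep_def)
  show ?thesis
    unfolding eq
  proof (rule is_rep_ract_cong[OF V.quot_is_rep _ group_Wtilde])
    fix g v assume g: "g \<in> carrier (Wtilde A)" and "v \<in> carrier (quotrep ?V N)"
    then obtain u where u: "u \<in> K" "v = N +>\<^bsub>?V\<^esub> u" by (auto simp: V.carrier_quot)
    have w: "cover A g \<in> grp A" by (rule cover_closed[OF g])
    have Ru: "R (cover A g) u \<in> K" using K u w by (simp add: stable_def)
    have "r g v = N +>\<^bsub>?E\<^esub> (spinor_scale (chi A g) (R (cover A g) u))"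
      using E.quot_simps(2)[OF g, of u] E.quot_simps(1)[of "R (cover A g) u" "chi A g"] u Ru
      by (simp add: r_def coset[symmetric] ext_ract) (simp add: ext_rep_def)
    also have "\<dots> = ract (quotrep ?V N) g v"
      using V.quot_simps(2)[OF g, of u] u by (simp add: coset spinor_ract[OF g])
    finally show "r g v = ract (quotrep ?V N) g v" .
  qed
qed

lemma ker_Dy: "ker_on A (Dy A M) = ker_on A dy"
  by (auto simp: ker_on_iff Dy_eq)

lemma im_Dy: "im_on A (Dy A M) = im_on A dy"
proof (intro equalityI subsetI)
  fix \<phi> assume "\<phi> \<in> im_on A (Dy A M)"
  then obtain \<psi> where "\<psi> \<in> MS A" "\<phi> = Dy A M \<psi>" by (auto simp: im_on_def)
  then have "\<phi> = dy (spinor_scale 2 \<psi>)" "spinor_scale 2 \<psi> \<in> MS A"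
    by (simp_all add: Dy_eq slinear_simps(2)[OF dy_linear] MS_scale)
  then show "\<phi> \<in> im_on A dy" by (simp add: im_on_def)
next
  fix \<phi> assume "\<phi> \<in> im_on A dy"
  then obtain \<psi> where "\<psi> \<in> MS A" "\<phi> = dy \<psi>" by (auto simp: im_on_def)
  then have "\<phi> = Dy A M (spinor_scale (1/2) \<psi>)" "spinor_scale (1/2) \<psi> \<in> MS A"
    by (simp_all add: Dy_eq slinear_simps(2)[OF dy_linear] MS_scale)
  then show "\<phi> \<in> im_on A (Dy A M)" by (simp add: im_on_def)
qed

lemma dx_stable: "stable (ker_on A dx)" "stable (im_on A dx)" "im_on A dx \<subseteq> ker_on A dx"
  using stable_ker[OF dx_linear R_dx] stable_im[OF dx_linear R_dx dx_closed]
  by (auto simp: ker_on_iff im_on_def dx_closed dx_dx)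

lemma dy_stable: "stable (ker_on A dy)" "stable (im_on A dy)" "im_on A dy \<subseteq> ker_on A dy"
  using stable_ker[OF dy_linear R_dy] stable_im[OF dy_linear R_dy dy_closed]
  by (auto simp: ker_on_iff im_on_def dy_closed dy_dy)

lemma Dx_cohomology_iso:
  "rep_iso (Wtilde A) (quotrep (subrep (spinor_rep A M) (ker_on A (Dx A M))) (im_on A (Dx A M)))
    (twist (chi A) (cohomology A M))"
  unfolding cohomology_def Dx_eq by (rule quotient_twist_iso[OF dx_stable])

lemma Dy_homology_iso:
  "rep_iso (Wtilde A) (quotrep (subrep (spinor_rep A M) (ker_on A (Dy A M))) (im_on A (Dy A M)))
    (twist (chi A) (homology A M))"
  unfolding homology_def ker_Dy im_Dy by (rule quotient_twist_iso[OF dy_stable])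

section \<open>The Dirac operator and its square\<close>

lemma Dirac_eq: "Dirac A M \<psi> = dx \<psi> + spinor_scale 2 (dy \<psi>)"
  by (simp add: Dirac_def Dx_eq Dy_eq pointwise)

lemma Dirac_linear: "slinear (Dirac A M)"
  by (rule slinearI)
    (simp_all add: Dirac_eq slinear_simps[OF dx_linear] slinear_simps[OF dy_linear]
      s.scale_right_distrib add_ac mult.commute)

lemma R_Dirac: "w \<in> grp A \<Longrightarrow> R w (Dirac A M \<psi>) = Dirac A M (R w \<psi>)"
  by (simp add: Dirac_eq slinear_simps[OF R_linear] R_dx R_dy)

text \<open>Half the square of the Dirac operator, as both differentials square to zero and
  \<open>Dy\<close> is twice \<open>dy\<close>.\<close>

definition laplace :: "'m spinors \<Rightarrow> 'm spinors" where
  "laplace \<psi> = dx (dy \<psi>) + dy (dx \<psi>)"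

lemma laplace_linear: "slinear laplace"
  by (rule slinearI)
    (simp_all add: laplace_def slinear_simps[OF dx_linear] slinear_simps[OF dy_linear]
      s.scale_right_distrib add_ac)

lemma laplace_closed: "laplace \<psi> \<in> MS A"
  by (simp add: laplace_def MS_closed dx_closed dy_closed)

lemma Dirac_square: "Dirac A M (Dirac A M \<psi>) = spinor_scale 2 (laplace \<psi>)"
  by (simp add: Dirac_eq laplace_def slinear_simps[OF dx_linear] slinear_simps[OF dy_linear]
      dx_dx dy_dy s.scale_right_distrib)

text \<open>Moving each \<open>Y\<close> past \<open>X\<close> splits \<open>dy (dx \<psi>)\<close>
  into normally ordered terms and commutators \<open>Z\<close>. The normally ordered terms of both
  products combine through the anticommutator of wedge and contraction, and only the diagonal
  survives.\<close>

lemma laplace_eq: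
  assumes \<psi>: "\<psi> \<in> MS A" and J: "J \<subseteq> {..<rk A}"
  shows "laplace \<psi> J = - euler A M (\<psi> J)
    + (\<Sum>i<rk A. \<Sum>j<rk A. tens (Z (ybas A j) (xbas A i)) (\<lambda>\<omega>. contract A (xbas A j) (wedge A (ybas A i) \<omega>)) \<psi> J)"
proof -
  let ?P = "\<lambda>i. wedge A (ybas A i)" and ?C = "\<lambda>j. contract A (xbas A j)"
  let ?X = "\<lambda>i. X (xbas A i)" and ?Y = "\<lambda>j. Y (ybas A j)" and ?Z = "\<lambda>j i. Z (ybas A j) (xbas A i)"
  have xl: "mlinear (?X i)" if "i < rk A" for i by (rule X_linear, rule dual_basis(1)[OF that])
  have 1: "dx (dy \<psi>) = (\<Sum>i<rk A. \<Sum>j<rk A. tens (\<lambda>m. ?X i (?Y j m)) (\<lambda>\<omega>. ?P i (?C j \<omega>)) \<psi>)"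
    unfolding dx_eq dy_eq
    by (rule sum.cong[OF refl]) (simp add: slinear_simps(5)[OF tensor_op_linear[OF xl]]
        tensor_op_comp[OF xl wedge_linear contract_closed])
  have "dy (dx \<psi>) = (\<Sum>j<rk A. \<Sum>i<rk A. tens (\<lambda>m. ?Y j (?X i m)) (\<lambda>\<omega>. ?C j (?P i \<omega>)) \<psi>)"
    unfolding dx_eq dy_eq
    by (rule sum.cong[OF refl]) (simp add: slinear_simps(5)[OF tensor_op_linear[OF Y_linear]]
        tensor_op_comp[OF Y_linear contract_linear wedge_closed])
  also have "\<dots> = (\<Sum>i<rk A. \<Sum>j<rk A. tens (\<lambda>m. ?Y j (?X i m)) (\<lambda>\<omega>. ?C j (?P i \<omega>)) \<psi>)"
    by (rule sum.swap)
  also have "\<dots> = (\<Sum>i<rk A. \<Sum>j<rk A. tens (\<lambda>m. ?X i (?Y j m)) (\<lambda>\<omega>. ?C j (?P i \<omega>)) \<psi>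
      + tens (?Z j i) (\<lambda>\<omega>. ?C j (?P i \<omega>)) \<psi>)"
    unfolding tensor_op_add_left[symmetric]
    by (intro sum.cong refl tensor_op_cong) (simp add: Y_X dual_basis)
  finally have 2: "dy (dx \<psi>) = \<dots>" .
  have 3: "tens (\<lambda>m. ?X i (?Y j m)) (\<lambda>\<omega>. ?P i (?C j \<omega>)) \<psi> + tens (\<lambda>m. ?X i (?Y j m)) (\<lambda>\<omega>. ?C j (?P i \<omega>)) \<psi>
    = spinor_scale (if i = j then -1 else 0) (tens (\<lambda>m. ?X i (?Y j m)) (\<lambda>\<omega>. \<omega>) \<psi>)"
    if ij: "i < rk A" "j < rk A" for i j
    unfolding tensor_op_add_right[symmetric] tensor_op_scale_right[symmetric]
    by (rule tensor_op_cong) (use ij in \<open>auto simp: contract_wedge dual_basis pointwise\<close>)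
  have "laplace \<psi> J = (\<Sum>i<rk A. \<Sum>j<rk A.
      spinor_scale (if i = j then -1 else 0) (tens (\<lambda>m. ?X i (?Y j m)) (\<lambda>\<omega>. \<omega>) \<psi>) J)
      + (\<Sum>i<rk A. \<Sum>j<rk A. tens (?Z j i) (\<lambda>\<omega>. ?C j (?P i \<omega>)) \<psi> J)"
    unfolding laplace_def 1 2 sum_fun_apply sum.distrib[symmetric] plus_fun_apply
    by (intro sum.cong refl) (simp add: fun_cong[OF 3, symmetric] plus_fun_apply add_ac)
  also have "(\<Sum>i<rk A. \<Sum>j<rk A.
      spinor_scale (if i = j then -1 else 0) (tens (\<lambda>m. ?X i (?Y j m)) (\<lambda>\<omega>. \<omega>) \<psi>) J)
    = (\<Sum>i<rk A. \<Sum>j<rk A. if i = j then - ?X i (?Y i (\<psi> J)) else 0)"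
    by (intro sum.cong refl) (simp add: spinor_scale_apply tensor_op_id[OF \<psi>] J)
  also have "\<dots> = - euler A M (\<psi> J)"
    by (simp add: euler_def xact_eq yact_eq sum_negf)
  finally show ?thesis .
qed

end

section \<open>Unitarity\<close>

text \<open>Both matrix coefficients are nonzero only for \<open>i \<notin> I\<close> and
  \<open>J = insert i I\<close>. Then \<open>card J = card I + 1\<close> accounts for the factor 2,
  and counting positions from 1 accounts for the sign.\<close>

lemma create_annihilate_adjoint:
  assumes I: "I \<subseteq> {..<rk A}" and J: "J \<subseteq> {..<rk A}"
  shows "2 ^ card J * create A i (blade I) J = - 2 * (2 ^ card I * cnj (annihilate A i (blade J) I))"
proof -
  have blade: "blade K L = (if L = K then 1 else 0)" for K L by (simp add: blade_def)
  have c: "create A i (blade I) J = (if i \<notin> I \<and> J = insert i I then (-1) ^ position I i else 0)"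
    by (simp add: create_blade[OF I] ext_scale_apply zero_fun_apply blade)
  have a: "annihilate A i (blade J) I = (if i \<in> J \<and> I = J - {i} then (-1) ^ (position J i + 1) else 0)"
    by (simp add: annihilate_blade[OF J] ext_scale_apply zero_fun_apply uminus_apply blade)
  show ?thesis
  proof (cases "i \<notin> I \<and> J = insert i I")
    case True
    have fin: "finite I" using I finite_subset by blast
    have p: "position J i = position I i" using position_insert[OF fin, of i i] True by simp
    have 1: "i \<in> J \<and> I = J - {i}" and 2: "card J = Suc (card I)" using True fin by auto
    show ?thesis unfolding c[unfolded if_P[OF True]] a[unfolded if_P[OF 1]] p 2 by simp
  next
    case False
    then have "\<not> (i \<in> J \<and> I = J - {i})" by auto
    then show ?thesis unfolding c a if_not_P[OF False] by simp
  qed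
qed

locale unitary_cherednik_module = cherednik_module A M
  for A :: "'h::ab_group_add rca" and M :: "('h, 'm::ab_group_add) hmod" +
  fixes B :: "'m \<Rightarrow> 'm \<Rightarrow> complex"
  assumes B: "pos_def_hermitian (mscale M) B"
    and B_xact: "i < rk A \<Longrightarrow> B (xact A M i m) m' = B m (yact A M i m')"
begin

lemma B_simps:
  "B (u + v) w = B u w + B v w" "B (mscale M a u) w = a * B u w" "B w u = cnj (B u w)"
  "u \<noteq> 0 \<Longrightarrow> Re (B u u) > 0"
  using B unfolding pos_def_hermitian_def by blast+

lemma B_right: "B u (v + w) = B u v + B u w" "B u (mscale M a v) = cnj a * B u v"
  using B_simps(1,2) by (simp_all add: B_simps(3)[of u])

lemma B_zero: "B 0 w = 0" "B w 0 = 0"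
  using B_simps(2)[of 0 0 w] B_right(2)[of w 0 0] by auto

lemma B_sum: "B (\<Sum>i\<in>I. f i) w = (\<Sum>i\<in>I. B (f i) w)" "B w (\<Sum>i\<in>I. f i) = (\<Sum>i\<in>I. B w (f i))"
  by (induction I rule: infinite_finite_induct) (auto simp: B_zero B_simps(1) B_right(1))

lemma B_nonneg: "Re (B u u) \<ge> 0"
  using B_simps(4)[of u] B_zero(1)[of 0] by (cases "u = 0") auto

text \<open>The weights \<open>2^p\<close> on \<open>\<And>\<^sup>p\<close> compensate the factor 2 in the action of covectors on spinors.\<close>

definition ip :: "'m spinors \<Rightarrow> 'm spinors \<Rightarrow> complex" where
  "ip \<phi> \<psi> = (\<Sum>I\<in>Pow {..<rk A}. 2 ^ card I * B (\<phi> I) (\<psi> I))"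

lemma ip_simps:
  "ip (\<phi> + \<phi>') \<psi> = ip \<phi> \<psi> + ip \<phi>' \<psi>" "ip \<phi> (\<psi> + \<psi>') = ip \<phi> \<psi> + ip \<phi> \<psi>'"
  "ip 0 \<psi> = 0" "ip \<psi> 0 = 0"
  by (simp_all add: ip_def pointwise B_simps(1) B_right(1) B_zero algebra_simps sum.distrib)

lemma ip_cnj: "ip \<psi> \<phi> = cnj (ip \<phi> \<psi>)"
  by (simp add: ip_def B_simps(3)[of "\<psi> _" "\<phi> _"])

lemma ip_nonneg: "Re (ip \<psi> \<psi>) \<ge> 0"
proof -
  have "Re (2 ^ k * z) = 2 ^ k * Re z" for k z
    by (induction k) auto
  then show ?thesis by (simp add: ip_def sum_nonneg B_nonneg)
qed

lemma ip_zero: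
  assumes "\<psi> \<in> MS A" "Re (ip \<psi> \<psi>) = 0"
  shows "\<psi> = 0"
proof
  fix I
  have r: "Re (2 ^ k * z) = 2 ^ k * Re z" for k z
    by (induction k) auto
  have "(\<Sum>I\<in>Pow {..<rk A}. 2 ^ card I * Re (B (\<psi> I) (\<psi> I))) = 0"
    using assms(2) by (simp add: ip_def r)
  then have "\<forall>I\<in>Pow {..<rk A}. 2 ^ card I * Re (B (\<psi> I) (\<psi> I)) = 0"
    by (subst (asm) sum_nonneg_eq_0_iff) (auto simp: B_nonneg)
  then have "Re (B (\<psi> I) (\<psi> I)) = 0" if "I \<subseteq> {..<rk A}" for I
    using that by simp
  then have "\<psi> I = 0" if "I \<subseteq> {..<rk A}" for I
    using B_simps(4)[of "\<psi> I"] that by (cases "\<psi> I = 0") auto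
  then show "\<psi> I = 0 I" using assms(1) by (cases "I \<subseteq> {..<rk A}") (auto simp: MS_def zero_fun_apply)
qed

lemma ip_sum: "ip (\<Sum>i\<in>I. f i) \<psi> = (\<Sum>i\<in>I. ip (f i) \<psi>)" "ip \<psi> (\<Sum>i\<in>I. f i) = (\<Sum>i\<in>I. ip \<psi> (f i))"
  by (induction I rule: infinite_finite_induct) (auto simp: ip_simps)

text \<open>The adjointness of \<open>x_i\<close> and \<open>y_i\<close> on \<open>M\<close> is
  combined entry by entry with that of the transposed blade coefficients. The factor 2 is the one
  between \<open>dy\<close> and \<open>Dy\<close>.\<close>

lemma dx_adjoint: "ip (dx \<phi>) \<psi> = - 2 * ip \<phi> (dy \<psi>)"
proof -
  have "ip (tens (X (xbas A i)) (wedge A (ybas A i)) \<phi>) \<psi>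
    = - 2 * ip \<phi> (tens (Y (ybas A i)) (contract A (xbas A i)) \<psi>)" if i: "i < rk A" for i
  proof -
    let ?b = "\<lambda>I J. B (X (xbas A i) (\<phi> I)) (\<psi> J)"
    have xy: "B (X (xbas A i) m) m' = B m (Y (ybas A i) m')" for m m'
      using B_xact[OF i] by (simp add: xact_eq yact_eq)
    have "ip (tens (X (xbas A i)) (wedge A (ybas A i)) \<phi>) \<psi>
      = (\<Sum>J\<in>Pow {..<rk A}. \<Sum>I\<in>Pow {..<rk A}. (2 ^ card J * create A i (blade I) J) * ?b I J)"
      by (simp add: ip_def tensor_op_apply B_sum B_simps(2) sum_distrib_left wedge_ybas[OF i] mult.assoc)
    also have "\<dots> = (\<Sum>J\<in>Pow {..<rk A}. \<Sum>I\<in>Pow {..<rk A}.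
        (- 2 * (2 ^ card I * cnj (annihilate A i (blade J) I))) * ?b I J)"
      by (intro sum.cong refl) (simp add: create_annihilate_adjoint)
    also have "\<dots> = (\<Sum>I\<in>Pow {..<rk A}. \<Sum>J\<in>Pow {..<rk A}.
        (- 2 * (2 ^ card I * cnj (annihilate A i (blade J) I))) * ?b I J)"
      by (rule sum.swap)
    also have "\<dots> = - 2 * ip \<phi> (tens (Y (ybas A i)) (contract A (xbas A i)) \<psi>)"
      by (simp add: ip_def tensor_op_apply B_sum B_right(2) sum_distrib_left contract_xbas[OF i] xy mult.assoc
          sum_negf)
    finally show ?thesis .
  qed
  then show ?thesis by (simp add: dx_eq dy_eq ip_sum sum_distrib_left)
qed

lemma dy_adjoint: "2 * ip (dy \<phi>) \<psi> = - ip \<phi> (dx \<psi>)"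
proof -
  have "ip \<phi> (dx \<psi>) = cnj (ip (dx \<psi>) \<phi>)" by (rule ip_cnj)
  also have "\<dots> = - 2 * cnj (ip \<psi> (dy \<phi>))" by (simp add: dx_adjoint)
  also have "cnj (ip \<psi> (dy \<phi>)) = ip (dy \<phi>) \<psi>" by (rule ip_cnj[symmetric])
  finally show ?thesis by simp
qed

text \<open>Pairing the Laplacian with \<psi> gives, up to sign, a combination of the squared norms
  of \<open>dx \<psi>\<close> and \<open>dy \<psi>\<close> with positive coefficients, so both norms
  vanish.\<close>

lemma laplace_ker:
  assumes "laplace \<psi> = 0"
  shows "dx \<psi> = 0" "dy \<psi> = 0"
proof -
  have "0 = 2 * ip (laplace \<psi>) \<psi>" by (simp add: assms ip_simps)
  also have "\<dots> = - 4 * ip (dy \<psi>) (dy \<psi>) - ip (dx \<psi>) (dx \<psi>)"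
    using dy_adjoint[of "dx \<psi>" \<psi>] by (simp add: laplace_def ip_simps dx_adjoint distrib_left)
  finally have "Re (- 4 * ip (dy \<psi>) (dy \<psi>) - ip (dx \<psi>) (dx \<psi>)) = 0" by simp
  then have "4 * Re (ip (dy \<psi>) (dy \<psi>)) + Re (ip (dx \<psi>) (dx \<psi>)) = 0" by simp
  then have "Re (ip (dy \<psi>) (dy \<psi>)) = 0" "Re (ip (dx \<psi>) (dx \<psi>)) = 0"
    using ip_nonneg[of "dy \<psi>"] ip_nonneg[of "dx \<psi>"] by auto
  then show "dx \<psi> = 0" "dy \<psi> = 0" using ip_zero dx_closed dy_closed by auto
qed

lemma ker_Dirac_iff: "\<psi> \<in> ker_on A (Dirac A M) \<longleftrightarrow> \<psi> \<in> MS A \<and> dx \<psi> = 0 \<and> dy \<psi> = 0"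
proof -
  have "laplace \<psi> = 0" if "Dirac A M \<psi> = 0"
    using Dirac_square[of \<psi>] that slinear_simps(3)[OF Dirac_linear] by simp
  then show ?thesis using laplace_ker[of \<psi>] by (auto simp: ker_on_iff) (auto simp: Dirac_eq)
qed

lemma ker_Dirac_square: "ker_on A (Dirac A M) = ker_on A (Dirac A M \<circ> Dirac A M)"
proof -
  have "dx \<psi> = 0 \<and> dy \<psi> = 0" if "Dirac A M (Dirac A M \<psi>) = 0" for \<psi>
    using laplace_ker[of \<psi>] that unfolding Dirac_square by simp
  then show ?thesis
    using slinear_simps(3)[OF Dirac_linear] by (auto simp: ker_Dirac_iff) (auto simp: ker_on_iff Dirac_eq)
qed

lemma ker_im_Dirac: "ker_on A (Dirac A M) \<inter> im_on A (Dirac A M) = {0}"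
proof -
  have "Dirac A M \<phi> = 0" if "\<phi> \<in> MS A" "Dirac A M \<phi> \<in> ker_on A (Dirac A M)" for \<phi>
  proof -
    have "\<phi> \<in> ker_on A (Dirac A M \<circ> Dirac A M)" using that by (simp add: ker_on_iff)
    then show ?thesis by (simp add: ker_on_iff flip: ker_Dirac_square)
  qed
  moreover have "0 \<in> im_on A (Dirac A M)"
    using slinear_simps(3)[OF Dirac_linear] MS_closed(1) unfolding im_on_def by (metis imageI)
  ultimately show ?thesis
    by (auto simp: im_on_def ker_Dirac_iff MS_closed slinear_simps(3)[OF dx_linear] slinear_simps(3)[OF dy_linear])
qed

lemma summands_independent:
  assumes "k \<in> ker_on A (Dirac A M)" "p \<in> im_on A dx" "q \<in> im_on A dy" "k + p + q = 0"
  shows "k = 0" "p = 0" "q = 0"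
proof -
  obtain a b where a: "p = dx a" and b: "q = dy b" using assms by (auto simp: im_on_def)
  have k: "dx k = 0" "dy k = 0" using assms(1) by (auto simp: ker_Dirac_iff)
  \<comment> \<open>\<open>dy\<close> kills \<open>k\<close> and the image of \<open>dy\<close>, so
    the vanishing sum forces \<open>dy p = 0\<close>; as \<open>p = dx a\<close>, adjointness gives
    \<open>p\<close> length 0. The roles are exchanged for \<open>q\<close>.\<close>
  have "dy (k + p + q) = dy p" "dx (k + p + q) = dx q"
    by (simp_all add: slinear_simps[OF dx_linear] slinear_simps[OF dy_linear] k a b dx_dx dy_dy)
  then have "dy p = 0" "dx q = 0"
    using assms(4) slinear_simps(3)[OF dx_linear] slinear_simps(3)[OF dy_linear] by auto
  then have "ip p p = 0" "ip q q = 0"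
    using dx_adjoint[of a p] dy_adjoint[of b q] by (simp_all add: a b ip_simps)
  then show "p = 0" "q = 0" using ip_zero dx_closed dy_closed a b by auto
  then show "k = 0" using assms(4) by simp
qed

end

section \<open>Local finiteness of the Laplacian\<close>

text \<open>A span of \<open>card F\<close> vectors has no larger independent subset, but the
  exponents up to \<open>card F\<close> give one vector more. Coinciding iterates form a separate
  case, since a set of vectors does not record repetitions.\<close>

lemma (in vector_space) linear_powers_dependent:
  assumes F: "finite F" and Ti: "\<And>i. (T ^^ i) v \<in> span F"
  shows "\<exists>N c. (\<exists>i\<le>N. c i \<noteq> 0) \<and> (\<Sum>i\<le>N. scale (c i) ((T ^^ i) v)) = 0"
proof (cases "inj_on (\<lambda>i. (T ^^ i) v) {..card F}")
  case True
  let ?S = "(\<lambda>i. (T ^^ i) v) ` {..card F}"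
  have "card ?S = Suc (card F)" using card_image[OF True] by simp
  then have "dependent ?S"
    using independent_span_bound[OF F, of ?S] Ti by fastforce
  then obtain u where u: "\<exists>x\<in>?S. u x \<noteq> 0" "(\<Sum>x\<in>?S. scale (u x) x) = 0"
    using dependent_finite[of ?S] by auto
  then have "(\<Sum>i\<le>card F. scale (u ((T ^^ i) v)) ((T ^^ i) v)) = 0"
    by (simp add: sum.reindex[OF True])
  then show ?thesis using u(1) by (intro exI[of _ "card F"] exI[of _ "\<lambda>i. u ((T ^^ i) v)"]) auto
next
  case False
  then obtain i j where ij: "i < j" "(T ^^ i) v = (T ^^ j) v"
    unfolding inj_on_def by (metis nat_neq_iff)
  let ?c = "\<lambda>k. if k = i then 1 else if k = j then - 1 else 0"
  have "(\<Sum>k\<le>j. scale (?c k) ((T ^^ k) v)) = (\<Sum>k\<in>{i, j}. scale (?c k) ((T ^^ k) v))"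
    by (rule sum.mono_neutral_right) (use ij in auto)
  also have "\<dots> = 0" using ij by simp
  finally show ?thesis using ij(1) by (intro exI[of _ j] exI[of _ ?c]) (auto intro!: exI[of _ i])
qed

text \<open>A Fitting-type splitting: a polynomial relation for \<open>v\<close> with lowest
  exponent \<open>k\<close> puts \<open>T^k v\<close> in the image of \<open>T^(k+1)\<close>, and
  the hypothesis on kernels lowers \<open>k\<close> to 1.\<close>

lemma (in vector_space) split_kernel_image:
  assumes T: "Vector_Spaces.linear scale scale T"
    and F: "finite F" "v \<in> span F" "T ` span F \<subseteq> span F"
    and ker: "\<And>u. u \<in> span F \<Longrightarrow> T (T u) = 0 \<Longrightarrow> T u = 0"
  shows "\<exists>u\<in>span F. T (v - T u) = 0"
proof -
  interpret T: Vector_Spaces.linear scale scale T by fact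
  have Ti: "(T ^^ i) u \<in> span F" if "u \<in> span F" for i u
    using that F(3) by (induction i) auto
  \<comment> \<open>Inside the stable span the kernels of the powers of \<open>T\<close> stop
    growing after the first; repeated use lowers any positive exponent to 1.\<close>
  have T0: "T u = 0" if "(T ^^ i) u = 0" "u \<in> span F" "i > 0" for i u
    using that
  proof (induction i)
    case (Suc i)
    show ?case
    proof (cases i)
      case (Suc k)
      have "T (T ((T ^^ k) u)) = 0" using Suc.prems(1) Suc by simp
      then have "(T ^^ i) u = 0" using ker Ti[OF Suc.prems(2), of k] Suc by simp
      then show ?thesis using Suc.IH Suc.prems Suc by simp
    qed (use Suc in simp)
  qed simp
  have lin: "(T ^^ i) (x + y) = (T ^^ i) x + (T ^^ i) y" "(T ^^ i) (scale a x) = scale a ((T ^^ i) x)"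
    "(T ^^ i) (\<Sum>j\<in>J. f j) = (\<Sum>j\<in>J. (T ^^ i) (f j))" for i x y a J and f :: "nat \<Rightarrow> 'b"
    by (induction i) (auto simp: T.add T.scale T.sum)
  obtain N c where c: "\<exists>i\<le>N. c i \<noteq> 0" "(\<Sum>i\<le>N. scale (c i) ((T ^^ i) v)) = 0"
    using linear_powers_dependent[OF F(1), of T v] Ti[OF F(2)] by blast
  define k where "k = (LEAST i. c i \<noteq> 0)"
  have k: "c k \<noteq> 0" "k \<le> N" and min: "\<And>i. i < k \<Longrightarrow> c i = 0"
  proof -
    show "c k \<noteq> 0" unfolding k_def using c(1) by (metis (mono_tags) LeastI)
    obtain i where "i \<le> N" "c i \<noteq> 0" using c(1) by blast
    then show "k \<le> N" unfolding k_def using Least_le[of "\<lambda>i. c i \<noteq> 0" i] by simp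
    show "c i = 0" if "i < k" for i
      using not_less_Least[of i "\<lambda>i. c i \<noteq> 0"] that unfolding k_def by blast
  qed
  \<comment> \<open>The relation solved for its lowest term, divided by \<open>c k\<close> and with
    the factor \<open>T^(k+1)\<close> taken out of the rest; the truncated subtraction is exact
    because \<open>i > k\<close>.\<close>
  define u where "u = scale (- 1 / c k) (\<Sum>i\<in>{k<..N}. scale (c i) ((T ^^ (i - k - 1)) v))"
  have u: "u \<in> span F"
    unfolding u_def by (intro span_scale span_sum Ti F(2))
  have shift: "(T ^^ k) (T ((T ^^ (i - k - 1)) v)) = (T ^^ i) v" if "i \<in> {k<..N}" for i
  proof -
    have "(T ^^ i) v = (T ^^ (k + Suc (i - k - 1))) v" using that by simp
    then show ?thesis by (simp only: funpow_add funpow.simps o_apply)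
  qed
  have "(T ^^ k) (T u) = scale (- 1 / c k) (\<Sum>i\<in>{k<..N}. scale (c i) ((T ^^ i) v))"
    by (simp only: u_def T.scale T.sum lin)
      (intro arg_cong2[where f = scale] refl sum.cong, simp only: shift)
  then have "scale (c k) ((T ^^ k) (T u)) = - (\<Sum>i\<in>{k<..N}. scale (c i) ((T ^^ i) v))"
    using k(1) by simp
  moreover have "(\<Sum>i\<le>N. scale (c i) ((T ^^ i) v))
    = scale (c k) ((T ^^ k) v) + (\<Sum>i\<in>{k<..N}. scale (c i) ((T ^^ i) v))"
  proof -
    have "(\<Sum>i\<le>N. scale (c i) ((T ^^ i) v)) = (\<Sum>i\<in>insert k {k<..N}. scale (c i) ((T ^^ i) v))"
    proof (rule sum.mono_neutral_right)
      show "\<forall>i\<in>{..N} - insert k {k<..N}. scale (c i) ((T ^^ i) v) = 0"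
        using min by (auto simp: not_less dest: le_neq_implies_less)
    qed (use k(2) in auto)
    then show ?thesis by simp
  qed
  ultimately have "scale (c k) ((T ^^ k) v) - scale (c k) ((T ^^ k) (T u)) = 0"
    using c(2) by simp
  then have "scale (c k) ((T ^^ k) (v - T u)) = 0"
    using lin(1)[of k "v - T u" "T u"] by (auto simp: scale_right_distrib)
  then have "(T ^^ k) (v - T u) = 0" using k(1) by simp
  moreover have "v - T u \<in> span F" using F u by (intro span_diff) auto
  \<comment> \<open>\<open>T0\<close> covers positive exponents; for \<open>k = 0\<close> the
    difference \<open>v - T u\<close> itself vanishes.\<close>
  ultimately have "T (v - T u) = 0"
    using T0[of k "v - T u"] by (cases "k = 0") (auto simp: T.zero)
  then show ?thesis using u by blast
qed

context unitary_cherednik_module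
begin

lemma euler_linear: "mlinear (euler A M)"
proof -
  have l: "mlinear (\<lambda>m. X (xbas A i) (Y (ybas A i) m))" if "i < rk A" for i
    using Vector_Spaces.linear_compose[OF Y_linear X_linear[OF dual_basis(1)[OF that]]] by (simp add: comp_def)
  have add: "X (xbas A i) (Y (ybas A i) (u + v)) = X (xbas A i) (Y (ybas A i) u) + X (xbas A i) (Y (ybas A i) v)"
    and sc: "X (xbas A i) (Y (ybas A i) (mscale M a u)) = mscale M a (X (xbas A i) (Y (ybas A i) u))"
    if "i < rk A" for i u v a
    using mlinear_simps(1,2)[OF l[OF that]] by auto
  show ?thesis
    by unfold_locales
      (simp_all add: euler_def xact_eq yact_eq add sc sum.distrib m.scale_sum_right algebra_simps)
qed

text \<open>Local finiteness concerns the Euler operator alone while the Laplacian also contains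
  group elements. As \<open>W\<close> is finite, adding all translates keeps the span
  finite-dimensional, and \<open>euler_wact\<close> keeps it Euler-stable.\<close>

lemma W_euler_stable_span:
  assumes lf: "euler_locally_finite A M" and K: "finite K"
  obtains G where "finite G" "K \<subseteq> m.span G" "euler A M ` m.span G \<subseteq> m.span G"
    "\<And>w u. w \<in> grp A \<Longrightarrow> u \<in> m.span G \<Longrightarrow> wact A M w u \<in> m.span G"
proof -
  obtain F where F: "\<And>u. finite (F u)" "\<And>u. u \<in> m.span (F u)" "\<And>u. euler A M ` m.span (F u) \<subseteq> m.span (F u)"
    using lf unfolding euler_locally_finite_def by metis
  define F0 where "F0 = (\<Union>u\<in>K. F u)"
  define G where "G = (\<Union>w\<in>grp A. wact A M w ` F0)"
  have span_image: "f ` m.span S = m.span (f ` S)" if "mlinear f" for f S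
  proof -
    interpret Vector_Spaces.linear "mscale M" "mscale M" f by fact
    show ?thesis by (rule span_image[symmetric])
  qed
  have F0: "m.span (F u) \<subseteq> m.span F0" if "u \<in> K" for u
    using that by (intro m.span_mono) (auto simp: F0_def)
  have F0G: "F0 \<subseteq> G"
  proof
    fix x assume "x \<in> F0"
    then have "x \<in> wact A M id ` F0" by (intro image_eqI[of _ _ x]) (simp_all add: wact_id)
    then show "x \<in> G" unfolding G_def using grp_closed(1) by blast
  qed
  have wG: "wact A M w ` m.span F0 \<subseteq> m.span G" if "w \<in> grp A" for w
    unfolding span_image[OF wact_linear[OF that]] using that by (intro m.span_mono) (auto simp: G_def)
  show ?thesis
  proof (rule that)
    show "finite G" using W_finite K F(1) by (auto simp: G_def F0_def)
    show "K \<subseteq> m.span G" using F(2) F0 m.span_mono[OF F0G] by blast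
    show "euler A M ` m.span G \<subseteq> m.span G"
      unfolding span_image[OF euler_linear]
    proof (rule m.span_minimal[OF _ m.subspace_span], rule image_subsetI)
      fix g assume "g \<in> G"
      then obtain w f where g: "w \<in> grp A" "f \<in> F0" "g = wact A M w f" by (auto simp: G_def)
      then obtain u where u: "u \<in> K" "f \<in> F u" by (auto simp: F0_def)
      have "euler A M f \<in> m.span (F u)" using F(3)[of u] m.span_base[OF u(2)] by auto
      then have "euler A M f \<in> m.span F0" using F0[OF u(1)] by auto
      then show "euler A M g \<in> m.span G" using wG[OF g(1)] g by (auto simp: euler_wact)
    qed
    fix w u assume w: "w \<in> grp A" and u: "u \<in> m.span G"
    have "wact A M w ` G \<subseteq> G"
      using w by (auto simp: G_def wact_comp[symmetric] intro!: grp_closed(2) bexI[rotated])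
    then have "wact A M w ` m.span G \<subseteq> m.span G"
      unfolding span_image[OF wact_linear[OF w]] by (rule m.span_mono)
    then show "wact A M w u \<in> m.span G" using u by auto
  qed
qed

text \<open>Spinors are finitely many coefficients in \<open>M\<close>, one for each blade, so
  finite generation of the coefficients passes to spinors; \<delta> places one coefficient at one
  blade.\<close>

lemma spinors_finite_span:
  assumes G: "finite G"
  obtains F where "finite F" "s.span F = {\<phi> \<in> MS A. \<forall>I. \<phi> I \<in> m.span G}"
proof -
  define \<delta> :: "nat set \<Rightarrow> 'm \<Rightarrow> 'm spinors" where "\<delta> I g = (\<lambda>J. if J = I then g else 0)" for I g
  define F where "F = (\<Union>I\<in>Pow {..<rk A}. \<delta> I ` G)"
  have sub: "s.subspace {\<phi> \<in> MS A. \<forall>I. \<phi> I \<in> m.span G}"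
    by (rule s.subspaceI)
      (auto simp: MS_closed MS_scale spinor_scale_apply pointwise(3,4) intro: m.span_add m.span_scale m.span_zero)
  have \<delta>: "\<delta> I g \<in> s.span F" if I: "I \<subseteq> {..<rk A}" and g: "g \<in> m.span G" for I g
    using g
  proof (induction g rule: m.span_induct_alt)
    case base
    have "\<delta> I 0 = 0" by (auto simp: \<delta>_def pointwise)
    then show ?case by (simp add: s.span_zero)
  next
    case (step c g h)
    have "\<delta> I g \<in> F" using step(1) I by (auto simp: F_def)
    moreover have "\<delta> I (mscale M c g + h) = spinor_scale c (\<delta> I g) + \<delta> I h"
      by (auto simp: \<delta>_def pointwise spinor_scale_apply)
    ultimately show ?case using step(2) by (simp add: s.span_add s.span_scale s.span_base)
  qed
  show ?thesis
  proof (rule that)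
    show "finite F" using G by (simp add: F_def)
    show "s.span F = {\<phi> \<in> MS A. \<forall>I. \<phi> I \<in> m.span G}"
    proof (intro equalityI subsetI)
      fix \<phi> assume "\<phi> \<in> s.span F"
      moreover have "F \<subseteq> {\<phi> \<in> MS A. \<forall>I. \<phi> I \<in> m.span G}"
        by (auto simp: F_def \<delta>_def MS_def m.span_base m.span_zero split: if_splits)
      ultimately show "\<phi> \<in> {\<phi> \<in> MS A. \<forall>I. \<phi> I \<in> m.span G}"
        using s.span_minimal[OF _ sub] by blast
    next
      fix \<phi> assume \<phi>: "\<phi> \<in> {\<phi> \<in> MS A. \<forall>I. \<phi> I \<in> m.span G}"
      have "\<phi> = (\<Sum>I\<in>Pow {..<rk A}. \<delta> I (\<phi> I))"
        using \<phi> by (auto simp: fun_eq_iff sum_fun_apply \<delta>_def MS_def)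
      also have "\<dots> \<in> s.span F" using \<phi> \<delta> by (intro s.span_sum) auto
      finally show "\<phi> \<in> s.span F" .
    qed
  qed
qed

lemma decomposition:
  assumes lf: "euler_locally_finite A M" and \<psi>: "\<psi> \<in> MS A"
  obtains k p q where "k \<in> ker_on A (Dirac A M)" "p \<in> im_on A dx" "q \<in> im_on A dy" "\<psi> = k + p + q"
proof -
  have "finite (\<psi> ` Pow {..<rk A})" by simp
  from W_euler_stable_span[OF lf this] obtain G where G: "finite G" "\<psi> ` Pow {..<rk A} \<subseteq> m.span G"
    "euler A M ` m.span G \<subseteq> m.span G" "\<And>w u. w \<in> grp A \<Longrightarrow> u \<in> m.span G \<Longrightarrow> wact A M w u \<in> m.span G"
    by blast
  obtain F where F: "finite F" "s.span F = {\<phi> \<in> MS A. \<forall>I. \<phi> I \<in> m.span G}"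
    by (rule spinors_finite_span[OF G(1)])
  have Z: "Z y \<xi> u \<in> m.span G" if "u \<in> m.span G" for y \<xi> u
    unfolding Z_def
    by (intro m.span_diff m.span_scale m.span_sum G(4) reflections_grp that)
  \<comment> \<open>By \<open>laplace_eq\<close> the coefficients of the Laplacian are combinations
    of Euler images and \<open>Z\<close> images of the old coefficients, and the span of
    \<open>G\<close> is stable under both.\<close>
  have "laplace \<phi> \<in> s.span F" if "\<phi> \<in> s.span F" for \<phi>
  proof -
    have \<phi>: "\<phi> \<in> MS A" "\<And>I. \<phi> I \<in> m.span G" using that by (auto simp: F(2))
    have "laplace \<phi> J \<in> m.span G" for J
    proof (cases "J \<subseteq> {..<rk A}")
      case True
      show ?thesis
        unfolding laplace_eq[OF \<phi>(1) True] tensor_op_apply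
        by (intro m.span_add m.span_neg m.span_sum m.span_scale Z \<phi>(2)) (use G(3) \<phi>(2) in auto)
    next
      case False
      then show ?thesis using laplace_closed[of \<phi>] by (auto simp: MS_def m.span_zero)
    qed
    then show ?thesis by (simp add: F(2) laplace_closed)
  qed
  then have stable: "laplace ` s.span F \<subseteq> s.span F" by auto
  \<comment> \<open>\<open>laplace u\<close> lies in the kernel of the Dirac operator by
    \<open>laplace_ker\<close>, and visibly in the sum of the two images, so independence of the
    summands makes it 0. This is the kernel condition for the splitting.\<close>
  have ker: "laplace u = 0" if "laplace (laplace u) = 0" for u
  proof -
    have "laplace u \<in> ker_on A (Dirac A M)"
      using laplace_ker[OF that] laplace_closed by (simp add: ker_Dirac_iff)
    moreover have "dx (dy u) \<in> im_on A dx" "dy (dx u) \<in> im_on A dy"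
      by (auto simp: im_on_def dx_closed dy_closed)
    moreover have "laplace u + spinor_scale (-1) (dx (dy u)) + spinor_scale (-1) (dy (dx u)) = 0"
      by (simp add: laplace_def)
    ultimately show ?thesis
      using summands_independent(1) dx_stable(2) dy_stable(2) unfolding stable_def
      by (meson s.subspace_scale)
  qed
  have "\<psi> I \<in> m.span G" for I
    using G(2) \<psi> by (cases "I \<subseteq> {..<rk A}") (auto simp: MS_def m.span_zero)
  then have "\<psi> \<in> s.span F" using \<psi> by (simp add: F(2))
  from s.split_kernel_image[OF laplace_linear F(1) this stable ker]
  obtain u where u: "u \<in> s.span F" "laplace (\<psi> - laplace u) = 0" by blast
  \<comment> \<open>The corrected spinor \<open>\<psi> - laplace u\<close> is the kernel component;
    the two terms of \<open>laplace u\<close> are the components in the two images.\<close>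
  show ?thesis
  proof (rule that)
    have "\<psi> - laplace u = \<psi> + spinor_scale (-1) (laplace u)" by simp
    also have "\<dots> \<in> MS A" by (intro MS_closed MS_scale \<psi> laplace_closed)
    finally show "\<psi> - laplace u \<in> ker_on A (Dirac A M)"
      using laplace_ker[OF u(2)] by (simp add: ker_Dirac_iff)
    show "dx (dy u) \<in> im_on A dx" "dy (dx u) \<in> im_on A dy"
      by (auto simp: im_on_def dx_closed dy_closed)
    show "\<psi> = \<psi> - laplace u + dx (dy u) + dy (dx u)" by (simp add: laplace_def)
  qed
qed

end

section \<open>Direct sum decompositions and the resulting isomorphisms\<close>

context unitary_cherednik_module
begin

lemma ker_Dirac_stable: "stable (ker_on A (Dirac A M))"
  by (rule stable_ker[OF Dirac_linear]) (rule R_Dirac)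

lemma ker_Dirac_subset: "ker_on A (Dirac A M) \<subseteq> ker_on A dx" "ker_on A (Dirac A M) \<subseteq> ker_on A dy"
  using ker_Dirac_iff by (auto simp: ker_on_iff)

lemma add_spinor_rep: "\<phi> \<oplus>\<^bsub>spinor_rep A M\<^esub> \<psi> = \<phi> + \<psi>"
  by (simp add: spinor_rep_def)

lemma direct_sum2I:
  assumes U: "s.subspace U" and V: "s.subspace V"
    and ind: "\<And>u v. u \<in> U \<Longrightarrow> v \<in> V \<Longrightarrow> u + v = 0 \<Longrightarrow> u = 0"
    and K: "\<And>u v. u \<in> U \<Longrightarrow> v \<in> V \<Longrightarrow> u + v \<in> K" "\<And>\<psi>. \<psi> \<in> K \<Longrightarrow> \<exists>u\<in>U. \<exists>v\<in>V. \<psi> = u + v"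
  shows "direct_sum2 (spinor_rep A M) K U V"
  unfolding direct_sum2_def add_spinor_rep bij_betw_def
proof
  show "inj_on (\<lambda>(a, b). a + b) (U \<times> V)"
  proof (rule inj_onI, clarify)
    fix a b a' b' assume ab: "a \<in> U" "b \<in> V" "a' \<in> U" "b' \<in> V" "a + b = a' + b'"
    then have "(a - a') + (b - b') = 0" by (simp add: algebra_simps)
    then have "a - a' = 0" using ind ab s.subspace_diff[OF U] s.subspace_diff[OF V] by blast
    then show "a = a' \<and> b = b'" using ab(5) by simp
  qed
  show "(\<lambda>(a, b). a + b) ` (U \<times> V) = K" using K by force
qed

lemma Dirac_iso_Dx:
  assumes "direct_sum2 (spinor_rep A M) (ker_on A dx) (ker_on A (Dirac A M)) (im_on A dx)"
  shows "rep_iso (Wtilde A) (subrep (spinor_rep A M) (ker_on A (Dirac A M)))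
    (quotrep (subrep (spinor_rep A M) (ker_on A dx)) (im_on A dx))"
  using rep_iso_complement[OF group_Wtilde subrep_is_rep[OF is_rep_spinor stable_is_subrep(1)[OF dx_stable(1)]]
      stable_subrep(1)[OF ker_Dirac_stable ker_Dirac_subset(1)] stable_subrep(1)[OF dx_stable(2,3)]] assms
  by (simp add: direct_sum2_def)

lemma Dirac_iso_Dy:
  assumes "direct_sum2 (spinor_rep A M) (ker_on A dy) (ker_on A (Dirac A M)) (im_on A dy)"
  shows "rep_iso (Wtilde A) (subrep (spinor_rep A M) (ker_on A (Dirac A M)))
    (quotrep (subrep (spinor_rep A M) (ker_on A dy)) (im_on A dy))"
  using rep_iso_complement[OF group_Wtilde subrep_is_rep[OF is_rep_spinor stable_is_subrep(1)[OF dy_stable(1)]]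
      stable_subrep(1)[OF ker_Dirac_stable ker_Dirac_subset(2)] stable_subrep(1)[OF dy_stable(2,3)]] assms
  by (simp add: direct_sum2_def)

text \<open>The denominator is the zero subspace, and the whole kernel is a complement of zero in
  itself.\<close>

lemma dirac_cohomology_iso:
  "rep_iso (Wtilde A) (dirac_cohomology A M) (subrep (spinor_rep A M) (ker_on A (Dirac A M)))"
proof -
  let ?K = "ker_on A (Dirac A M)"
  have sK: "s.subspace ?K" using ker_Dirac_stable by (simp add: stable_def)
  have "stable {0}"
    using MS_closed(1) by (auto simp: stable_def s.subspace_single_0 slinear_simps(3)[OF R_linear])
  moreover have "{0} \<subseteq> ?K" using s.subspace_0[OF sK] by simp
  moreover have "direct_sum2 (spinor_rep A M) ?K ?K {0}"
    by (rule direct_sum2I) (auto simp: sK s.subspace_single_0)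
  ultimately have "rep_iso (Wtilde A) (subrep (spinor_rep A M) ?K) (quotrep (subrep (spinor_rep A M) ?K) {0})"
    using rep_iso_complement[OF group_Wtilde subrep_is_rep[OF is_rep_spinor stable_is_subrep(1)[OF ker_Dirac_stable]]
        stable_subrep(1)[OF ker_Dirac_stable subset_refl] stable_subrep(1)]
    by (simp add: direct_sum2_def)
  then show ?thesis unfolding dirac_cohomology_def ker_im_Dirac by (rule rep_iso_sym)
qed

lemma direct_sums:
  assumes lf: "euler_locally_finite A M"
  shows "direct_sum3 (spinor_rep A M) (MS A) (ker_on A (Dirac A M)) (im_on A dx) (im_on A dy)"
    "direct_sum2 (spinor_rep A M) (ker_on A dx) (ker_on A (Dirac A M)) (im_on A dx)"
    "direct_sum2 (spinor_rep A M) (ker_on A dy) (ker_on A (Dirac A M)) (im_on A dy)"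
proof -
  let ?K = "ker_on A (Dirac A M)" and ?P = "im_on A dx" and ?Q = "im_on A dy"
  have sub: "s.subspace ?K" "s.subspace ?P" "s.subspace ?Q" "s.subspace (ker_on A dx)" "s.subspace (ker_on A dy)"
    and MS: "?K \<subseteq> MS A" "?P \<subseteq> MS A" "?Q \<subseteq> MS A"
    using ker_Dirac_stable dx_stable dy_stable by (auto simp: stable_def)
  note ker = ker_Dirac_subset dx_stable(3) dy_stable(3)
  show "direct_sum3 (spinor_rep A M) (MS A) ?K ?P ?Q"
    unfolding direct_sum3_def add_spinor_rep bij_betw_def
  proof
    show "inj_on (\<lambda>(a, b, c). a + b + c) (?K \<times> ?P \<times> ?Q)"
    proof (rule inj_onI, clarify)
      fix a b c a' b' c' assume "a \<in> ?K" "b \<in> ?P" "c \<in> ?Q" "a' \<in> ?K" "b' \<in> ?P" "c' \<in> ?Q"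
        and eq: "a + b + c = a' + b' + c'"
      then have d: "a - a' \<in> ?K" "b - b' \<in> ?P" "c - c' \<in> ?Q"
        using s.subspace_diff sub by blast+
      have "(a - a') + (b - b') + (c - c') = 0" using eq by (simp add: algebra_simps)
      from summands_independent[OF d this] show "a = a' \<and> (b, c) = (b', c')" by simp
    qed
    show "(\<lambda>(a, b, c). a + b + c) ` (?K \<times> ?P \<times> ?Q) = MS A"
    proof (intro equalityI subsetI)
      fix \<psi> assume "\<psi> \<in> (\<lambda>(a, b, c). a + b + c) ` (?K \<times> ?P \<times> ?Q)"
      then show "\<psi> \<in> MS A" using MS by (auto intro!: MS_closed)
    next
      fix \<psi> :: "'m spinors" assume "\<psi> \<in> MS A"
      from decomposition[OF lf this] obtain k p q where "k \<in> ?K" "p \<in> ?P" "q \<in> ?Q" "\<psi> = k + p + q" .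
      then show "\<psi> \<in> (\<lambda>(a, b, c). a + b + c) ` (?K \<times> ?P \<times> ?Q)" by force
    qed
  qed
  show "direct_sum2 (spinor_rep A M) (ker_on A dx) ?K ?P"
  proof (rule direct_sum2I[OF sub(1,2)])
    fix k p assume kp: "k \<in> ?K" "p \<in> ?P"
    then show "k + p \<in> ker_on A dx" using ker s.subspace_add[OF sub(4)] by blast
    show "k = 0" if "k + p = 0"
      using summands_independent(1)[OF kp s.subspace_0[OF sub(3)]] that by simp
  next
    fix \<psi> assume \<psi>: "\<psi> \<in> ker_on A dx"
    then obtain k p q where d: "k \<in> ?K" "p \<in> ?P" "q \<in> ?Q" "\<psi> = k + p + q"
      using decomposition[OF lf] by (metis ker_on_iff)
    \<comment> \<open>The remaining component \<open>q\<close> lies in \<open>ker dx\<close> as a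
      difference and in \<open>ker dy\<close> because \<open>dy\<close> squares to zero. It is thus
      both in the kernel of the Dirac operator and in the image of \<open>dy\<close>, and the
      relation \<open>- q + 0 + q = 0\<close> makes it vanish.\<close>
    have "k + p \<in> ker_on A dx" using d ker s.subspace_add[OF sub(4)] by blast
    then have "\<psi> - (k + p) \<in> ker_on A dx" using s.subspace_diff[OF sub(4)] \<psi> by blast
    then have "q \<in> ker_on A dx" "q \<in> ker_on A dy" using d ker by auto
    then have "q \<in> ?K" unfolding ker_Dirac_iff by (simp add: ker_on_iff)
    then have "- q \<in> ?K" using s.subspace_neg[OF sub(1)] by blast
    then have "q = 0"
      using summands_independent(3)[OF _ s.subspace_0[OF sub(2)] d(3), of "- q"] by simp
    then show "\<exists>u\<in>?K. \<exists>v\<in>?P. \<psi> = u + v" using d by auto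
  qed
  show "direct_sum2 (spinor_rep A M) (ker_on A dy) ?K ?Q"
  proof (rule direct_sum2I[OF sub(1,3)])
    fix k q assume kq: "k \<in> ?K" "q \<in> ?Q"
    then show "k + q \<in> ker_on A dy" using ker s.subspace_add[OF sub(5)] by blast
    show "k = 0" if "k + q = 0"
      using summands_independent(1)[OF kq(1) s.subspace_0[OF sub(2)] kq(2)] that by simp
  next
    fix \<psi> assume \<psi>: "\<psi> \<in> ker_on A dy"
    then obtain k p q where d: "k \<in> ?K" "p \<in> ?P" "q \<in> ?Q" "\<psi> = k + p + q"
      using decomposition[OF lf] by (metis ker_on_iff)
    have "k + q \<in> ker_on A dy" using d ker s.subspace_add[OF sub(5)] by blast
    then have "\<psi> - (k + q) \<in> ker_on A dy" using s.subspace_diff[OF sub(5)] \<psi> by blast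
    then have "p \<in> ker_on A dx" "p \<in> ker_on A dy" using d ker by auto
    then have "p \<in> ?K" unfolding ker_Dirac_iff by (simp add: ker_on_iff)
    then have "- p \<in> ?K" using s.subspace_neg[OF sub(1)] by blast
    then have "p = 0"
      using summands_independent(2)[OF _ d(2) s.subspace_0[OF sub(3)], of "- p"] by simp
    then show "\<exists>u\<in>?K. \<exists>v\<in>?Q. \<psi> = u + v" using d by auto
  qed
qed

end

theorem theoremC:
  fixes A :: "'h::ab_group_add rca" and M :: "('h, 'm::ab_group_add) hmod"
  assumes "rca_data A"
    and "par_t A \<in> \<real>"
    and "\<forall>s\<in>reflections A. par_c A s \<in> \<real>"
    and "H_module A M"
    and "star_unitary A M"
  shows
    "ker_on A (Dirac A M) \<inter> im_on A (Dirac A M) = {\<lambda>_. 0} \<and>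
     ker_on A (Dirac A M) = ker_on A (Dirac A M \<circ> Dirac A M) \<and>
     rep_iso (Wtilde A) (dirac_cohomology A M) (subrep (spinor_rep A M) (ker_on A (Dirac A M))) \<and>
     rep_iso (Wtilde A)
       (quotrep (subrep (spinor_rep A M) (ker_on A (Dx A M))) (im_on A (Dx A M)))
       (twist (chi A) (cohomology A M)) \<and>
     rep_iso (Wtilde A)
       (quotrep (subrep (spinor_rep A M) (ker_on A (Dy A M))) (im_on A (Dy A M)))
       (twist (chi A) (homology A M)) \<and>
     (euler_locally_finite A M \<longrightarrow>
       direct_sum3 (spinor_rep A M) (MS A)
         (ker_on A (Dirac A M)) (im_on A (Dx A M)) (im_on A (Dy A M)) \<and>
       direct_sum2 (spinor_rep A M) (ker_on A (Dx A M)) (ker_on A (Dirac A M)) (im_on A (Dx A M)) \<and>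
       direct_sum2 (spinor_rep A M) (ker_on A (Dy A M)) (ker_on A (Dirac A M)) (im_on A (Dy A M)) \<and>
       rep_iso (Wtilde A) (subrep (spinor_rep A M) (ker_on A (Dirac A M)))
         (quotrep (subrep (spinor_rep A M) (ker_on A (Dx A M))) (im_on A (Dx A M))) \<and>
       rep_iso (Wtilde A) (subrep (spinor_rep A M) (ker_on A (Dirac A M)))
         (quotrep (subrep (spinor_rep A M) (ker_on A (Dy A M))) (im_on A (Dy A M))))"
proof -
  obtain B where B: "pos_def_hermitian (mscale M) B"
    "\<forall>i<rk A. \<forall>m m'. B (xact A M i m) m' = B m (yact A M i m')"
    using assms(5) unfolding star_unitary_def by blast
  interpret unitary_cherednik_module A M B
    by (intro unitary_cherednik_module.intro cherednik_module.intro cherednik_module_axioms.intro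
        unitary_cherednik_module_axioms.intro assms(1,4)) (use B in auto)
  \<comment> \<open>Kernel and image of \<open>Dy\<close> are those of \<open>dy\<close>, as the
    factor 2 is invertible, so the results for the two differentials carry over.\<close>
  show ?thesis
    using ker_im_Dirac ker_Dirac_square dirac_cohomology_iso Dx_cohomology_iso Dy_homology_iso
      direct_sums Dirac_iso_Dx Dirac_iso_Dy
    unfolding zero_fun_def ker_Dy im_Dy Dx_eq by blast
qed

end
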